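(* Let $r,s\in\mathbb{N}$ with $s\le r$ and let $1\le p<\infty$. Let $(G_W)_{W>0}$ be linear operators of the form $G_W(f)(x)=\sum_{k=-\infty}^{+\infty}f(x_{k,W})\varphi_{k,W}(x)$ with $G_W(f)\in W^s_p(\mathbb{R})$ for all $f\in\Lambda^p$, $W>0$. Assume that there are constants $K_1=K_1(p)$, $K_2=K_2(p)$, $K_3=K_3(s,p)$, $K_5=K_5(s,p)>0$ such that for all $W>0$ $$K_2\|f\|_{\ell_p(\Sigma_W)}\le\|G_W(f)\|_p\le K_1\|f\|_{\ell_p(\Sigma_W)}\quad(f\in\Lambda^p),\qquad\|f-G_W(f)\|_p\le K_3W^{-s}\|f^{(s)}\|_p\quad(f\in W^s_p(\mathbb{R})),$$ $$W^{-s}\|(G_W(f))^{(s)}\|_p\le K_5\,\omega_s(G_W(f),W^{-1})_p\quad(f\in\Lambda^p).$$ Then for $f\in\Lambda^p$ and $W>0$ $$\tilde\Omega_{r,s}\left(f,\tfrac1W,\Sigma_W\right)_p\asymp\|f-G_W(f)\|_p+W^{-s}\|(G_W(f))^{(s)}\|_p,$$ i.e. each side is bounded by a positive constant times the other, with constants independent of $f$ and $W$.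
   Context: Conventions: $\mathbb{N}=\{1,2,\dots\}$; functions are defined pointwise (functions equal almost everywhere are not identified); $\|\cdot\|_p$ is the $L^p(\mathbb{R})$ norm. $W^s_p(\mathbb{R})$ is the usual Sobolev space, whose elements are taken as functions $g\in L^p(\mathbb{R})$ with $g,\dots,g^{(s-1)}$ locally absolutely continuous and $g^{(s)}\in L^p(\mathbb{R})$. In the definition of $G_W$, $x_{k,W}\in\mathbb{R}$ are nodes and $\varphi_{k,W}$ are functions on $\mathbb{R}$; the series is understood to converge, so that $G_W$ is a well-defined linear operator on $\Lambda^p$. $M(\mathbb{R})$ is the set of bounded measurable functions on $\mathbb{R}$. A sequence $\Sigma=(x_j)_{j\in\mathbb{Z}}\subset\mathbb{R}$ is admissible if $0<\inf_j(x_j-x_{j-1})\le\sup_j(x_j-x_{j-1})<\infty$; put $\|f\|_{\ell_p(\Sigma)}=\big(\sum_{j\in\mathbb{Z}}|f(x_j)|^p(x_j-x_{j-1})\big)^{1/p}$. $\Lambda^p=\{f\in M(\mathbb{R}):\|f\|_{\ell_p(\Sigma)}<\infty\text{ for every admissible }\Sigma\}$; one has $W^s_p(\mathbb{R})\subset\Lambda^p\subset L^p(\mathbb{R})$. $\Sigma_W=(j/W)_{j\in\mathbb{Z}}$, so $\|f\|_{\ell_p(\Sigma_W)}=\big(\frac1W\sum_{j\in\mathbb{Z}}|f(j/W)|^p\big)^{1/p}$. Modulus of smoothness: $\Delta_h^s f(x)=\sum_{k=0}^s\binom sk(-1)^{s-k}f(x+kh)$, $\omega_s(f,\delta)_p=\sup_{0<h\le\delta}\|\Delta_h^sf\|_p$.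 Steklov averages ($\delta>0$): $\tilde f_{\delta,r}(x)=(-\delta)^{-r}\int_0^\delta\cdots\int_0^\delta\sum_{m=1}^r(-1)^{r-m+1}\binom rm f\big(x+\frac mr(t_1+\dots+t_r)\big)\,dt_1\cdots dt_r$. Semi-discrete modulus: $\tilde\Omega_{r,s}(f,\frac1W,\Sigma_W)_p=\|\tilde f_{1/W,r}-f\|_{\ell_p(\Sigma_W)}+\omega_s(f,1/W)_p$. *)

theory Defs
  imports "HOL-Analysis.Analysis"
begin

text \<open>
  Functions are real-valued, measurability is Lebesgue measurability, and functions are not
  identified almost everywhere. Norms are real numbers; a norm of a function outside the
  corresponding space has no meaning, so membership in the spaces is a separate notion.
\<close>

section \<open>Function spaces and norms\<close>

definition Lp_norm :: "real \<Rightarrow> (real \<Rightarrow> real) \<Rightarrow> real" where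
  "Lp_norm p g = (\<integral>x. \<bar>g x\<bar> powr p \<partial>lebesgue) powr (1 / p)"

definition Lp_space :: "real \<Rightarrow> (real \<Rightarrow> real) set" where
  "Lp_space p = {g \<in> borel_measurable lebesgue. integrable lebesgue (\<lambda>x. \<bar>g x\<bar> powr p)}"

definition bounded_measurable :: "(real \<Rightarrow> real) set" where
  "bounded_measurable = {f \<in> borel_measurable lebesgue. bounded (range f)}"

text \<open>In the following definition a pair \<open>(u, v)\<close> in \<open>D\<close> stands for the interval with these
  endpoints.\<close>

definition abs_continuous_on_interval :: "real \<Rightarrow> real \<Rightarrow> (real \<Rightarrow> real) \<Rightarrow> bool" where
  "abs_continuous_on_interval a b g \<longleftrightarrow>
    (\<forall>\<epsilon>>0. \<exists>\<delta>>0. \<forall>D. finite D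
        \<and> (\<forall>(u, v)\<in>D. a \<le> u \<and> u \<le> v \<and> v \<le> b)
        \<and> pairwise (\<lambda>I J. {fst I<..<snd I} \<inter> {fst J<..<snd J} = {}) D
        \<and> (\<Sum>(u, v)\<in>D. v - u) < \<delta>
      \<longrightarrow> (\<Sum>(u, v)\<in>D. \<bar>g v - g u\<bar>) < \<epsilon>)"

definition locally_abs_continuous :: "(real \<Rightarrow> real) \<Rightarrow> bool" where
  "locally_abs_continuous g \<longleftrightarrow> (\<forall>a b. a \<le> b \<longrightarrow> abs_continuous_on_interval a b g)"

text \<open>The derivatives of order less than \<open>s\<close> exist everywhere. The derivative of order \<open>s\<close> need
  only exist almost everywhere; at the exceptional points \<open>deriv\<close> has an unspecified value, which
  does not affect membership in \<open>Lp_space\<close> or the value of \<open>Lp_norm\<close>.\<close>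

definition sobolev :: "nat \<Rightarrow> real \<Rightarrow> (real \<Rightarrow> real) set" where
  "sobolev s p = {g \<in> Lp_space p.
      (\<forall>j. j + 1 < s \<longrightarrow> (\<forall>x. (deriv ^^ j) g field_differentiable at x))
      \<and> (\<forall>j<s. locally_abs_continuous ((deriv ^^ j) g))
      \<and> (deriv ^^ s) g \<in> Lp_space p}"

definition admissible :: "(int \<Rightarrow> real) \<Rightarrow> bool" where
  "admissible x \<longleftrightarrow>
     bdd_below (range (\<lambda>j. x j - x (j - 1))) \<and> bdd_above (range (\<lambda>j. x j - x (j - 1)))
     \<and> 0 < (INF j. x j - x (j - 1))"

definition lp_norm :: "real \<Rightarrow> (int \<Rightarrow> real) \<Rightarrow> (real \<Rightarrow> real) \<Rightarrow> real" where
  "lp_norm p x f = (\<Sum>\<^sub>\<infinity>j. \<bar>f (x j)\<bar> powr p * (x j - x (j - 1))) powr (1 / p)"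

definition Lambda_space :: "real \<Rightarrow> (real \<Rightarrow> real) set" where
  "Lambda_space p = {f \<in> bounded_measurable.
      \<forall>x. admissible x \<longrightarrow> (\<lambda>j. \<bar>f (x j)\<bar> powr p * (x j - x (j - 1))) summable_on UNIV}"

definition uniform_nodes :: "real \<Rightarrow> int \<Rightarrow> real" where
  "uniform_nodes W j = of_int j / W"

section \<open>Moduli of smoothness\<close>

definition fin_diff :: "nat \<Rightarrow> real \<Rightarrow> (real \<Rightarrow> real) \<Rightarrow> real \<Rightarrow> real" where
  "fin_diff s h f x = (\<Sum>k=0..s. real (s choose k) * (-1) ^ (s - k) * f (x + real k * h))"

definition modulus :: "nat \<Rightarrow> real \<Rightarrow> (real \<Rightarrow> real) \<Rightarrow> real \<Rightarrow> real" where
  "modulus s p f \<delta> = (SUP h\<in>{0<..\<delta>}. Lp_norm p (fin_diff s h f))"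

text \<open>The \<open>n\<close>-fold iterated integral over \<open>[0,\<delta>]\<close>; the integrand takes the list
  \<open>[t\<^sub>1, \<dots>, t\<^sub>n]\<close> of integration variables.\<close>

fun iterated_integral :: "nat \<Rightarrow> real \<Rightarrow> (real list \<Rightarrow> real) \<Rightarrow> real" where
  "iterated_integral 0 \<delta> F = F []"
| "iterated_integral (Suc n) \<delta> F =
     (LINT t:{0..\<delta>}|lebesgue. iterated_integral n \<delta> (\<lambda>ts. F (t # ts)))"

definition steklov :: "real \<Rightarrow> nat \<Rightarrow> (real \<Rightarrow> real) \<Rightarrow> real \<Rightarrow> real" where
  "steklov \<delta> r f x = 1 / (- \<delta>) ^ r *
     iterated_integral r \<delta> (\<lambda>ts. \<Sum>m=1..r. (-1) ^ (r - m + 1) * real (r choose m)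
        * f (x + real m / real r * sum_list ts))"

definition semidiscrete_modulus ::
    "nat \<Rightarrow> nat \<Rightarrow> real \<Rightarrow> (real \<Rightarrow> real) \<Rightarrow> real \<Rightarrow> (int \<Rightarrow> real) \<Rightarrow> real" where
  "semidiscrete_modulus r s p f \<delta> x =
     lp_norm p x (\<lambda>t. steklov \<delta> r f t - f t) + modulus s p f \<delta>"

section \<open>Sampling operators\<close>

text \<open>\<open>G f\<close> is the sum of the two-sided series of \<open>f (x k) * \<phi> k t\<close> for every \<open>f\<close> in the
  domain \<open>S\<close>; outside \<open>S\<close> nothing is required. Convergence is that of the symmetric
  partial sums, which is implied, with the same sum, by convergence of both one-sided series and by
  unconditional convergence. Linearity of \<open>G\<close> on a linear subspace \<open>S\<close> follows from this form.\<close>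

definition sampling_operator_on ::
    "(real \<Rightarrow> real) set \<Rightarrow> (int \<Rightarrow> real) \<Rightarrow> (int \<Rightarrow> real \<Rightarrow> real)
      \<Rightarrow> ((real \<Rightarrow> real) \<Rightarrow> real \<Rightarrow> real) \<Rightarrow> bool" where
  "sampling_operator_on S x \<phi> G \<longleftrightarrow>
     (\<forall>f\<in>S. \<forall>t. (\<lambda>n. \<Sum>k=-int n..int n. f (x k) * \<phi> k t) \<longlonglongrightarrow> G f t)"

end

theory Submission
  imports Defs
begin

text \<open>
  Write \<open>\<delta> = 1 / W\<close>, let \<open>g\<close> be the Steklov average of \<open>f\<close> with step \<open>\<delta>\<close>, \<open>\<omega>\<close> the modulus of
  smoothness of order \<open>s\<close> of \<open>f\<close> at \<open>\<delta>\<close>, and \<open>l\<close> the discrete norm of \<open>g - f\<close>. The average \<open>g\<close> is the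
  intermediary: it is smooth enough for the direct estimate \<open>\<parallel>g - G g\<parallel> \<le> K\<^sub>3 W\<^sup>-\<^sup>s \<parallel>g\<^sup>(\<^sup>s\<^sup>)\<parallel>\<close>, and its
  distance from \<open>f\<close> is controlled both in \<open>L\<^sup>p\<close> and at the nodes. Three facts that do not involve \<open>G\<close> are
  needed: \<open>\<parallel>g - f\<parallel> \<le> 2\<^sup>r\<^sup>-\<^sup>s \<omega>\<close> (\<open>Lp_ball_steklov_minus\<close>, \<open>modulus_le_lower_order\<close>),
  \<open>\<delta>\<^sup>s \<parallel>g\<^sup>(\<^sup>s\<^sup>)\<parallel> \<le> A \<omega>\<close> (\<open>steklov_sobolev\<close>), and \<open>\<omega>\<^sub>s(u, \<delta>) \<le> \<delta>\<^sup>s \<parallel>u\<^sup>(\<^sup>s\<^sup>)\<parallel>\<close> for Sobolev functions \<open>u\<close>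
  (\<open>modulus_le_sobolev\<close>). Given these, everything is the triangle inequality.
  From \<open>f - G f = (g - G g) + G (g - f) - (g - f)\<close> and the upper norm estimate for \<open>G\<close>, the error of
  \<open>G f\<close> is at most a constant times \<open>l + \<omega>\<close>; the inverse estimate for \<open>G f\<close> and
  \<open>\<omega>\<^sub>s(G f, \<delta>) \<le> \<omega> + 2\<^sup>s \<parallel>f - G f\<parallel>\<close> then bound the derivative term. Conversely
  \<open>\<omega> \<le> \<omega>\<^sub>s(G f, \<delta>) + 2\<^sup>s \<parallel>f - G f\<parallel>\<close> bounds \<open>\<omega>\<close>, and the lower norm estimate applied to \<open>g - f\<close>,
  where \<open>G (g - f) = (g - f) - (g - G g) + (f - G f)\<close>, bounds \<open>l\<close>.

  The three facts rest on the averages \<open>avg h f\<close>, the means of \<open>f\<close> over \<open>[x, x + h]\<close>. The \<open>r\<close>-fold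
  integral in the Steklov average is an \<open>r\<close>-fold iterate of such averages, applied either to
  \<open>c \<mapsto> \<Delta>\<^sup>r\<^bsub>c/r\<^esub> f(x)\<close>, which shows that \<open>g - f\<close> is a mean of differences of \<open>f\<close> with steps at most \<open>\<delta>\<close>, or,
  after rescaling, to \<open>f\<close> itself with steps \<open>h\<^sub>m = m \<delta> / r\<close>. The latter form is the one that can be
  differentiated: each derivative removes one average and replaces it by a difference quotient, so
  that the \<open>s\<close>-th derivative is a combination of averages of \<open>s\<close>-th differences of \<open>f\<close>. Averaging
  with a parameter does not increase \<open>L\<^sup>p\<close> bounds (\<open>Lp_ball_parametric_average\<close>: Jensen and Tonelli).

  Two analytic facts enter at the top order of differentiation. The last average of a merely bounded
  function is differentiable only almost everywhere, by Lebesgue's differentiation theorem; and a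
  Sobolev function has a derivative of order \<open>s - 1\<close> that is only locally absolutely continuous, so
  that its increments have to be recovered from an almost everywhere derivative
  (\<open>locally_abs_continuous_fundamental_theorem\<close>). The latter is proved by splitting the function into
  two increasing absolutely continuous functions by means of the total variation and applying the
  Radon-Nikodym theorem to the interval measures that these generate.

  Finally, functions in \<open>\<Lambda>\<^sup>p\<close> have summable near-maxima over unit intervals, since a
  sequence of points near the terms of an admissible sequence splits into finitely many admissible
  sequences (\<open>summable_near_nodes\<close>). This gives \<open>\<Lambda>\<^sup>p \<subseteq> L\<^sup>p\<close> and the invariance of \<open>\<Lambda>\<^sup>p\<close> under averaging.
\<close>

section \<open>Lebesgue differentiation\<close>

text \<open>
  One-sided averages converge almost everywhere by \<open>integrable_ccontinuous_explicit\<close>; applying this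
  also to the reflected function gives the left-hand difference quotients. One exceptional set serves
  all lower limits \<open>a\<close>, since changing \<open>a\<close> only adds a constant to the integral near \<open>x\<close>.
\<close>

lemma lebesgue_differentiation:
  fixes f :: "real \<Rightarrow> real"
  assumes int: "\<And>a b. f integrable_on {a..b}"
  shows "AE x in lebesgue. \<forall>a<x. ((\<lambda>y. integral {a..y} f) has_real_derivative f x) (at x)"
proof -
  have int': "(\<lambda>x. f (- x)) integrable_on {a..b}" for a b
    using int[of "-b" "-a"] by (metis Henstock_Kurzweil_Integration.integrable_reflect_real minus_minus)
  obtain N1 where N1: "negligible N1"
    "\<And>x e. x \<notin> N1 \<Longrightarrow> 0 < e \<Longrightarrow> \<exists>d>0. \<forall>h. 0 < h \<and> h < d \<longrightarrow>
        norm (integral {x..x+h} f / h - f x) < e"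
    using integrable_ccontinuous_explicit[of f] int
    by (auto simp: divide_inverse mult.commute)
  obtain N2 where N2: "negligible N2"
    "\<And>x e. x \<notin> N2 \<Longrightarrow> 0 < e \<Longrightarrow> \<exists>d>0. \<forall>h. 0 < h \<and> h < d \<longrightarrow>
        norm (integral {x..x+h} (\<lambda>x. f (-x)) / h - f (-x)) < e"
    using integrable_ccontinuous_explicit[of "\<lambda>x. f (-x)"] int'
    by (auto simp: divide_inverse mult.commute)
  have neg: "negligible (N1 \<union> uminus ` N2)"
    using N1(1) negligible_differentiable_image_negligible[OF _ N2(1), of uminus]
      differentiable_on_minus[OF differentiable_on_ident, of N2]
    by (simp add: negligible_Un)
  have deriv: "((\<lambda>y. integral {a..y} f) has_real_derivative f x) (at x)"
    if x: "x \<notin> N1 \<union> uminus ` N2" and a: "a < x" for a x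
    unfolding has_field_derivative_iff LIM_eq
  proof (intro allI impI)
    fix e :: real assume e: "0 < e"
    have "x \<notin> N1" using x by auto
    then obtain d1 where d1: "d1 > 0" "\<And>h. 0 < h \<Longrightarrow> h < d1 \<Longrightarrow>
        norm (integral {x..x+h} f / h - f x) < e" using N1(2)[OF _ e, of x] by auto
    have "-x \<notin> N2" using x by (metis UnCI imageI minus_minus)
    then obtain d2 where d2: "d2 > 0" "\<And>h. 0 < h \<Longrightarrow> h < d2 \<Longrightarrow>
        norm (integral {-x..-x+h} (\<lambda>x. f (-x)) / h - f x) < e" using N2(2)[of "-x" e] e by auto
    show "\<exists>s>0. \<forall>y. y \<noteq> x \<and> norm (y - x) < s \<longrightarrow>
         norm ((integral {a..y} f - integral {a..x} f) / (y - x) - f x) < e"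
    proof (intro exI conjI allI impI)
      show "min (x - a) (min d1 d2) > 0" using d1 d2 a by auto
      fix y assume y: "y \<noteq> x \<and> norm (y - x) < min (x - a) (min d1 d2)"
      show "norm ((integral {a..y} f - integral {a..x} f) / (y - x) - f x) < e"
      proof (cases "x < y")
        case True
        have "integral {a..y} f = integral {a..x} f + integral {x..y} f"
          using Henstock_Kurzweil_Integration.integral_combine[of a x y f] True a int by auto
        then show ?thesis using d1(2)[of "y - x"] y True by auto
      next
        case False
        then have yx: "y < x" using y by auto
        have *: "integral {a..x} f = integral {a..y} f + integral {y..x} f"
          using Henstock_Kurzweil_Integration.integral_combine[of a y x f] yx y a int by auto
        have "integral {-x..-y} (\<lambda>x. f (-x)) = integral {y..x} f"
          by (rule Henstock_Kurzweil_Integration.integral_reflect_real)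
        then have "norm (integral {y..x} f / (x - y) - f x) < e"
          using d2(2)[of "x - y"] y yx by auto
        moreover have "(integral {a..y} f - integral {a..x} f) / (y - x) = integral {y..x} f / (x - y)"
          using * yx by (simp add: divide_simps algebra_simps)
        ultimately show ?thesis by simp
      qed
    qed
  qed
  show ?thesis
    by (rule AE_I'[OF neg[unfolded negligible_iff_null_sets]]) (use deriv in blast)
qed

section \<open>Absolutely continuous functions\<close>

text \<open>
  The families of intervals over which the definition of absolute continuity quantifies.
\<close>

definition interval_family :: "real \<Rightarrow> real \<Rightarrow> (real \<times> real) set \<Rightarrow> bool" where
  "interval_family a b D \<longleftrightarrow> finite D \<and> (\<forall>(u, v)\<in>D. a \<le> u \<and> u \<le> v \<and> v \<le> b)
     \<and> pairwise (\<lambda>I J. {fst I<..<snd I} \<inter> {fst J<..<snd J} = {}) D"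

abbreviation increments :: "(real \<Rightarrow> real) \<Rightarrow> (real \<times> real) set \<Rightarrow> real" where
  "increments g D \<equiv> (\<Sum>(u, v)\<in>D. \<bar>g v - g u\<bar>)"

abbreviation total_length :: "(real \<times> real) set \<Rightarrow> real" where
  "total_length D \<equiv> (\<Sum>(u, v)\<in>D. v - u)"

lemma abs_continuous_on_interval_iff:
  "abs_continuous_on_interval a b g \<longleftrightarrow>
    (\<forall>\<epsilon>>0. \<exists>\<delta>>0. \<forall>D. interval_family a b D \<longrightarrow> total_length D < \<delta> \<longrightarrow> increments g D < \<epsilon>)"
  unfolding abs_continuous_on_interval_def interval_family_def by (simp only: conj_assoc imp_conjL)

text \<open>
  Operations such as clamping all endpoints to a subinterval can make distinct intervals coincide, so
  they are described by index sets. Only degenerate intervals can coincide, because nonempty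
  intervals are disjoint; dropping them changes neither lengths nor increments.
\<close>

lemma interval_family_of_indexed:
  fixes x y :: "'i \<Rightarrow> real"
  assumes fin: "finite I" and xy: "\<And>i. i \<in> I \<Longrightarrow> a \<le> x i \<and> x i \<le> y i \<and> y i \<le> b"
    and disj: "\<And>i j. i \<in> I \<Longrightarrow> j \<in> I \<Longrightarrow> i \<noteq> j \<Longrightarrow> {x i<..<y i} \<inter> {x j<..<y j} = {}"
  obtains D where "interval_family a b D" "total_length D = (\<Sum>i\<in>I. y i - x i)"
    "\<And>g. increments g D = (\<Sum>i\<in>I. \<bar>g (y i) - g (x i)\<bar>)"
proof -
  define J where "J = {i\<in>I. x i < y i}"
  define D where "D = (\<lambda>i. (x i, y i)) ` J"
  have inj: "inj_on (\<lambda>i. (x i, y i)) J"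
  proof (rule inj_onI)
    fix i j assume ij: "i \<in> J" "j \<in> J" "(x i, y i) = (x j, y j)"
    then have "(x i + y i) / 2 \<in> {x i<..<y i} \<inter> {x j<..<y j}" by (auto simp: J_def field_simps)
    then show "i = j" using disj ij by (force simp: J_def)
  qed
  have "interval_family a b D"
    unfolding interval_family_def D_def pairwise_def using fin xy disj
    by (fastforce simp: J_def)
  moreover have "total_length D = (\<Sum>i\<in>I. y i - x i)"
    unfolding D_def sum.reindex[OF inj] comp_def split_conv
    by (rule sum.mono_neutral_left) (use fin xy in \<open>force simp: J_def\<close>)+
  moreover have "increments g D = (\<Sum>i\<in>I. \<bar>g (y i) - g (x i)\<bar>)" for g
  proof -
    have "x i = y i" if "i \<in> I - J" for i using that xy[of i] by (auto simp: J_def)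
    then have "\<forall>i\<in>I - J. \<bar>g (y i) - g (x i)\<bar> = 0" by simp
    then show ?thesis
      unfolding D_def sum.reindex[OF inj] comp_def split_conv
      by (intro sum.mono_neutral_left) (use fin in \<open>simp_all add: J_def Collect_restrict\<close>)
  qed
  ultimately show thesis by (rule that)
qed

lemma sum_lengths_le_measure:
  fixes x y :: "'i \<Rightarrow> real"
  assumes fin: "finite I" and xy: "\<And>i. i \<in> I \<Longrightarrow> x i \<le> y i"
    and disj: "\<And>i j. i \<in> I \<Longrightarrow> j \<in> I \<Longrightarrow> i \<noteq> j \<Longrightarrow> {x i<..<y i} \<inter> {x j<..<y j} = {}"
    and sub: "\<And>i. i \<in> I \<Longrightarrow> {x i<..<y i} \<subseteq> S" and S: "S \<in> sets lborel"
  shows "ennreal (\<Sum>i\<in>I. y i - x i) \<le> emeasure lborel S"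
proof -
  have "ennreal (\<Sum>i\<in>I. y i - x i) = (\<Sum>i\<in>I. ennreal (y i - x i))"
    using xy by (subst sum_ennreal) auto
  also have "\<dots> = (\<Sum>i\<in>I. emeasure lborel {x i<..<y i})"
    using xy by (intro sum.cong) auto
  also have "\<dots> = emeasure lborel (\<Union>i\<in>I. {x i<..<y i})"
    using fin disj by (intro sum_emeasure) (auto simp: disjoint_family_on_def)
  also have "\<dots> \<le> emeasure lborel S" using sub S by (intro emeasure_mono) auto
  finally show ?thesis .
qed

lemma total_length_le:
  assumes D: "interval_family a b D" and "a \<le> b"
  shows "total_length D \<le> b - a"
proof -
  have "ennreal (\<Sum>i\<in>D. snd i - fst i) \<le> emeasure lborel {a..b}"
    by (rule sum_lengths_le_measure) (use D in \<open>auto simp: interval_family_def pairwise_def\<close>)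
  then show ?thesis using \<open>a \<le> b\<close> by (simp add: case_prod_beta)
qed

lemma abs_continuous_imp_continuous_on:
  assumes "abs_continuous_on_interval a b g"
  shows "continuous_on {a..b} g"
  unfolding continuous_on_iff
proof (intro ballI allI impI)
  fix x e :: real assume x: "x \<in> {a..b}" and e: "e > 0"
  obtain d where d: "d > 0" "\<And>D. interval_family a b D \<Longrightarrow> total_length D < d \<Longrightarrow> increments g D < e"
    using assms e unfolding abs_continuous_on_interval_iff by blast
  show "\<exists>d>0. \<forall>x'\<in>{a..b}. dist x' x < d \<longrightarrow> dist (g x') (g x) < e"
  proof (intro exI conjI ballI impI)
    fix y assume y: "y \<in> {a..b}" "dist y x < d"
    have "increments g {(min x y, max x y)} < e"
      by (rule d(2)) (use x y in \<open>auto simp: interval_family_def dist_real_def\<close>)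
    then show "dist (g y) (g x) < e" by (auto simp: dist_real_def min_def max_def split: if_splits)
  qed (rule d)
qed

text \<open>
  Families with gaps give the same supremum as partitions and
  avoid having to order the intervals.
\<close>

definition variation :: "(real \<Rightarrow> real) \<Rightarrow> real \<Rightarrow> real \<Rightarrow> real" where
  "variation g a b = (SUP D\<in>Collect (interval_family a b). increments g D)"

text \<open>
  Cut every interval at \<open>c\<close>; the only interval that is really cut contributes by the triangle
  inequality.
\<close>

lemma interval_family_split:
  assumes D: "interval_family a b D" and c: "a \<le> c" "c \<le> b"
  obtains D1 D2 where "interval_family a c D1" "interval_family c b D2"
    "\<And>g. increments g D \<le> increments g D1 + increments g D2"
proof -
  have fin: "finite D" and mem: "\<And>i. i \<in> D \<Longrightarrow> a \<le> fst i \<and> fst i \<le> snd i \<and> snd i \<le> b"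
    and disj: "\<And>i j. i \<in> D \<Longrightarrow> j \<in> D \<Longrightarrow> i \<noteq> j \<Longrightarrow> {fst i<..<snd i} \<inter> {fst j<..<snd j} = {}"
    using D by (auto simp: interval_family_def pairwise_def)
  have disj1: "{min (fst i) c<..<min (snd i) c} \<inter> {min (fst j) c<..<min (snd j) c} = {}"
    if "i \<in> D" "j \<in> D" "i \<noteq> j" for i j
  proof -
    have "{min (fst i) c<..<min (snd i) c} \<subseteq> {fst i<..<snd i}"
      "{min (fst j) c<..<min (snd j) c} \<subseteq> {fst j<..<snd j}" by auto
    then show ?thesis using disj[OF that] by blast
  qed
  have disj2: "{max (fst i) c<..<max (snd i) c} \<inter> {max (fst j) c<..<max (snd j) c} = {}"
    if "i \<in> D" "j \<in> D" "i \<noteq> j" for i j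
  proof -
    have "{max (fst i) c<..<max (snd i) c} \<subseteq> {fst i<..<snd i}"
      "{max (fst j) c<..<max (snd j) c} \<subseteq> {fst j<..<snd j}" by auto
    then show ?thesis using disj[OF that] by blast
  qed
  obtain D1 where D1: "interval_family a c D1"
    "\<And>g. increments g D1 = (\<Sum>i\<in>D. \<bar>g (min (snd i) c) - g (min (fst i) c)\<bar>)"
  proof (rule interval_family_of_indexed[where a = a and b = c, OF fin _ disj1])
    show "a \<le> min (fst i) c \<and> min (fst i) c \<le> min (snd i) c \<and> min (snd i) c \<le> c" if "i \<in> D" for i
      using mem[OF that] c by auto
  qed auto
  obtain D2 where D2: "interval_family c b D2"
    "\<And>g. increments g D2 = (\<Sum>i\<in>D. \<bar>g (max (snd i) c) - g (max (fst i) c)\<bar>)"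
  proof (rule interval_family_of_indexed[where a = c and b = b, OF fin _ disj2])
    show "c \<le> max (fst i) c \<and> max (fst i) c \<le> max (snd i) c \<and> max (snd i) c \<le> b" if "i \<in> D" for i
      using mem[OF that] c by auto
  qed auto
  have "increments g D \<le> increments g D1 + increments g D2" for g
    unfolding D1(2) D2(2) sum.distrib[symmetric] case_prod_beta
  proof (rule sum_mono)
    fix i assume "i \<in> D"
    then have "fst i \<le> snd i" using mem by auto
    then show "\<bar>g (snd i) - g (fst i)\<bar> \<le> \<bar>g (min (snd i) c) - g (min (fst i) c)\<bar>
        + \<bar>g (max (snd i) c) - g (max (fst i) c)\<bar>"
      by (cases "snd i \<le> c"; cases "fst i \<le> c") (auto simp: min_def max_def)
  qed
  then show thesis using D1(1) D2(1) that by blast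
qed

lemma interval_family_mono:
  "interval_family a b D \<Longrightarrow> a' \<le> a \<Longrightarrow> b \<le> b' \<Longrightarrow> interval_family a' b' D"
  by (force simp: interval_family_def)

lemma abs_continuous_subinterval:
  "abs_continuous_on_interval a b g \<Longrightarrow> a \<le> a' \<Longrightarrow> b' \<le> b \<Longrightarrow> abs_continuous_on_interval a' b' g"
  unfolding abs_continuous_on_interval_iff by (meson interval_family_mono)

text \<open>
  An interval shorter than the \<open>\<delta>\<close> that belongs to \<open>\<epsilon> = 1\<close> carries variation at most \<open>1\<close>. Peeling
  off pieces of length \<open>\<delta> / 2\<close> bounds the variation by the number of pieces.
\<close>

lemma abs_continuous_bounded_variation:
  assumes ac: "abs_continuous_on_interval a b g"
  shows "bdd_above (increments g ` Collect (interval_family a b))"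
proof (cases "a \<le> b")
  case True
  obtain d where d: "d > 0" "\<And>D. interval_family a b D \<Longrightarrow> total_length D < d \<Longrightarrow> increments g D < 1"
    using ac unfolding abs_continuous_on_interval_iff by (metis zero_less_one)
  have *: "increments g D \<le> real n"
    if "a \<le> a'" "a' \<le> b'" "b' \<le> b" "b' - a' \<le> real n * (d / 2)" "interval_family a' b' D" for a' b' D n
    using that
  proof (induction n arbitrary: a' b' D)
    case 0
    then have "\<forall>(u, v)\<in>D. u = v" by (force simp: interval_family_def)
    then have "increments g D = 0" by (intro sum.neutral) auto
    then show ?case by simp
  next
    case (Suc n)
    define c where "c = max a' (b' - d / 2)"
    have c: "a' \<le> c" "c \<le> b'" "b' - c < d" "c - a' \<le> real n * (d / 2)"
      using Suc.prems d(1) by (auto simp: c_def max_def algebra_simps split: if_splits)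
    obtain D1 D2 where D12: "interval_family a' c D1" "interval_family c b' D2"
      "increments g D \<le> increments g D1 + increments g D2"
      using interval_family_split[OF Suc.prems(5) c(1,2)] by metis
    have "increments g D1 \<le> real n" using Suc.IH[of a' c D1] Suc.prems c D12 by auto
    moreover have "increments g D2 < 1"
    proof (rule d(2))
      show "interval_family a b D2" using interval_family_mono[OF D12(2)] Suc.prems c by auto
      show "total_length D2 < d" using total_length_le[OF D12(2)] c by auto
    qed
    ultimately show ?case using D12(3) by simp
  qed
  obtain n where "(b - a) / (d / 2) \<le> real n" using real_arch_simple by blast
  then have "b - a \<le> real n * (d / 2)" using d(1) by (simp add: field_simps)
  then show ?thesis using *[of a b n] True by (intro bdd_aboveI2[of _ _ "real n"]) auto
next
  case False
  then have "D = {}" if "interval_family a b D" for D using that by (force simp: interval_family_def)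
  then have "Collect (interval_family a b) \<subseteq> {{}}" by blast
  then have "increments g ` Collect (interval_family a b) \<subseteq> increments g ` {{}}" by (rule image_mono)
  then show ?thesis by (rule bdd_above_mono[rotated]) simp
qed

lemma increments_le_variation:
  assumes "abs_continuous_on_interval a b g" "interval_family a b D"
  shows "increments g D \<le> variation g a b"
  unfolding variation_def using assms by (intro cSUP_upper abs_continuous_bounded_variation) auto

lemma interval_family_empty: "interval_family a b {}" by (simp add: interval_family_def)

lemma variation_le:
  assumes "\<And>D. interval_family a b D \<Longrightarrow> increments g D \<le> B"
  shows "variation g a b \<le> B"
  unfolding variation_def using assms interval_family_empty by (intro cSUP_least) auto

lemma variation_add_le:
  assumes ac: "abs_continuous_on_interval a b g" and c: "a \<le> c" "c \<le> b"
  shows "variation g a b \<le> variation g a c + variation g c b"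
proof (rule variation_le)
  fix D assume D: "interval_family a b D"
  obtain D1 D2 where "interval_family a c D1" "interval_family c b D2"
      "increments g D \<le> increments g D1 + increments g D2"
    using interval_family_split[OF D c] by metis
  moreover have "increments g D1 \<le> variation g a c" "increments g D2 \<le> variation g c b"
    using calculation abs_continuous_subinterval[OF ac] c by (auto intro!: increments_le_variation)
  ultimately show "increments g D \<le> variation g a c + variation g c b" by linarith
qed

lemma variation_superadditive:
  assumes ac: "abs_continuous_on_interval a b g" and c: "a \<le> c" "c \<le> b"
  shows "variation g a c + \<bar>g b - g c\<bar> \<le> variation g a b"
proof -
  have "variation g a c \<le> variation g a b - \<bar>g b - g c\<bar>"
  proof (rule variation_le)
    fix D assume D: "interval_family a c D"
    show "increments g D \<le> variation g a b - \<bar>g b - g c\<bar>"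
    proof (cases "c = b")
      case True
      then show ?thesis using increments_le_variation[OF ac] D by auto
    next
      case False
      have nin: "(c, b) \<notin> D" using D c False by (auto simp: interval_family_def)
      have disj: "{u<..<v} \<inter> {c<..<b} = {}" if "(u, v) \<in> D" for u v
        using D that by (force simp: interval_family_def)
      have "interval_family a b (insert (c, b) D)"
        using D c disj by (force simp: interval_family_def pairwise_insert)
      then have "increments g (insert (c, b) D) \<le> variation g a b"
        by (rule increments_le_variation[OF ac])
      then show ?thesis using nin D by (simp add: interval_family_def)
    qed
  qed
  then show ?thesis by simp
qed

text \<open>
  The variation inherits absolute continuity: near-optimal families inside the intervals of a short
  family together again form a short family.
\<close>

lemma variation_abs_continuous:
  assumes ac: "abs_continuous_on_interval a b g" and e: "\<epsilon> > 0"
  obtains \<delta> where "\<delta> > 0" "\<And>D. interval_family a b D \<Longrightarrow> total_length D < \<delta> \<Longrightarrow>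
      (\<Sum>(u, v)\<in>D. variation g u v) < \<epsilon>"
proof -
  obtain \<delta> where d: "\<delta> > 0" "\<And>D. interval_family a b D \<Longrightarrow> total_length D < \<delta> \<Longrightarrow> increments g D < \<epsilon> / 2"
    using ac e unfolding abs_continuous_on_interval_iff by (meson half_gt_zero)
  have "(\<Sum>(u, v)\<in>D. variation g u v) < \<epsilon>" if D: "interval_family a b D" and len: "total_length D < \<delta>" for D
  proof -
    \<comment> \<open>The loss in choosing near-optimal families, small enough for all members of \<open>D\<close> together.\<close>
    define \<eta> where "\<eta> = \<epsilon> / (2 * (real (card D) + 1))"
    have eta: "\<eta> > 0" using e by (simp add: \<eta>_def)
    have fin: "finite D" using D by (simp add: interval_family_def)
    have mem: "a \<le> fst i" "fst i \<le> snd i" "snd i \<le> b" if "i \<in> D" for i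
      using D that by (auto simp: interval_family_def)
    have "\<exists>E. interval_family (fst i) (snd i) E \<and> variation g (fst i) (snd i) - \<eta> < increments g E" if "i \<in> D" for i
    proof (rule ccontr)
      assume "\<not> ?thesis"
      then have "variation g (fst i) (snd i) \<le> variation g (fst i) (snd i) - \<eta>"
        by (intro variation_le) (meson not_le)
      then show False using eta by simp
    qed
    then obtain E where E: "\<And>i. i \<in> D \<Longrightarrow> interval_family (fst i) (snd i) (E i)"
        "\<And>i. i \<in> D \<Longrightarrow> variation g (fst i) (snd i) - \<eta> < increments g (E i)" by metis
    have finE: "finite (E i)" if "i \<in> D" for i using E(1)[OF that] by (simp add: interval_family_def)
    define S where "S = Sigma D E"
    have finS: "finite S" unfolding S_def using fin finE by auto
    have memS: "fst i \<le> fst j \<and> fst j \<le> snd j \<and> snd j \<le> snd i" if "i \<in> D" "j \<in> E i" for i j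
      using E(1)[OF that(1)] that(2) by (auto simp: interval_family_def)
    have disj: "{fst (snd k)<..<snd (snd k)} \<inter> {fst (snd l)<..<snd (snd l)} = {}"
      if kl: "k \<in> S" "l \<in> S" "k \<noteq> l" for k l
    proof (cases "fst k = fst l")
      case True
      then have "snd k \<noteq> snd l" using kl by (auto simp: prod_eq_iff)
      moreover have "fst k \<in> D" "snd k \<in> E (fst k)" "snd l \<in> E (fst k)"
        using kl True by (auto simp: S_def)
      moreover have "pairwise (\<lambda>I J. {fst I<..<snd I} \<inter> {fst J<..<snd J} = {}) (E (fst k))"
        using E(1) \<open>fst k \<in> D\<close> unfolding interval_family_def by blast
      ultimately show ?thesis unfolding pairwise_def by blast
    next
      case False
      have "{fst (fst k)<..<snd (fst k)} \<inter> {fst (fst l)<..<snd (fst l)} = {}"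
      proof -
        have "fst k \<in> D" "fst l \<in> D" using kl by (auto simp: S_def)
        moreover have "pairwise (\<lambda>I J. {fst I<..<snd I} \<inter> {fst J<..<snd J} = {}) D"
          using D unfolding interval_family_def by blast
        ultimately show ?thesis using False unfolding pairwise_def by blast
      qed
      moreover have "{fst (snd k)<..<snd (snd k)} \<subseteq> {fst (fst k)<..<snd (fst k)}"
        "{fst (snd l)<..<snd (snd l)} \<subseteq> {fst (fst l)<..<snd (fst l)}"
      proof -
        have "fst k \<in> D" "snd k \<in> E (fst k)" "fst l \<in> D" "snd l \<in> E (fst l)"
          using kl by (auto simp: S_def)
        then show "{fst (snd k)<..<snd (snd k)} \<subseteq> {fst (fst k)<..<snd (fst k)}"
          "{fst (snd l)<..<snd (snd l)} \<subseteq> {fst (fst l)<..<snd (fst l)}"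
          using memS[of "fst k" "snd k"] memS[of "fst l" "snd l"] by auto
      qed
      ultimately show ?thesis by blast
    qed
    obtain D' where D': "interval_family a b D'"
      "total_length D' = (\<Sum>k\<in>S. snd (snd k) - fst (snd k))"
      "\<And>g. increments g D' = (\<Sum>k\<in>S. \<bar>g (snd (snd k)) - g (fst (snd k))\<bar>)"
    proof (rule interval_family_of_indexed[where a = a and b = b, OF finS _ disj])
      fix k assume "k \<in> S"
      then have "fst k \<in> D" "snd k \<in> E (fst k)" by (auto simp: S_def)
      then show "a \<le> fst (snd k) \<and> fst (snd k) \<le> snd (snd k) \<and> snd (snd k) \<le> b"
        using memS[of "fst k" "snd k"] mem[of "fst k"] by auto
    qed auto
    have Sg: "(\<Sum>k\<in>S. F (snd k)) = (\<Sum>i\<in>D. \<Sum>j\<in>E i. F j)" for F :: "real \<times> real \<Rightarrow> real"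
      unfolding S_def using sum.Sigma[of D E "\<lambda>_. F"] fin finE by (simp add: case_prod_beta)
    have "total_length D' = (\<Sum>i\<in>D. total_length (E i))"
      unfolding D'(2) using Sg[of "\<lambda>j. snd j - fst j"] by (simp add: case_prod_beta)
    also have "\<dots> \<le> (\<Sum>i\<in>D. snd i - fst i)"
      by (intro sum_mono total_length_le) (use E mem in auto)
    also have "\<dots> < \<delta>" using len by (simp add: case_prod_beta)
    finally have "increments g D' < \<epsilon> / 2" using d(2) D'(1) by blast
    moreover have "increments g D' = (\<Sum>i\<in>D. increments g (E i))"
      unfolding D'(3) using Sg[of "\<lambda>j. \<bar>g (snd j) - g (fst j)\<bar>"] by (simp add: case_prod_beta)
    moreover have "(\<Sum>i\<in>D. variation g (fst i) (snd i)) \<le> (\<Sum>i\<in>D. increments g (E i) + \<eta>)"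
      by (intro sum_mono) (use E(2) in \<open>simp add: less_imp_le diff_le_eq[symmetric]\<close>)
    moreover have "real (card D) * \<eta> < \<epsilon> / 2"
      using e by (simp add: \<eta>_def field_simps)
    ultimately show ?thesis by (simp add: sum.distrib case_prod_beta)
  qed
  then show thesis using d(1) that by blast
qed

text \<open>
  Clamping to \<open>[a, b]\<close> extends a function on \<open>[a, b]\<close> by constants to the whole line, which is the
  domain on which interval measures live. The extension is again absolutely continuous.
\<close>

lemma interval_family_clamp:
  assumes D: "interval_family c d D" and ab: "a \<le> b"
  obtains D' where "interval_family a b D'" "total_length D' \<le> total_length D"
    "\<And>g. increments (\<lambda>x. g (max a (min b x))) D = increments g D'"
proof -
  let ?cl = "\<lambda>x. max a (min b x)"
  have fin: "finite D" and mem: "\<And>i. i \<in> D \<Longrightarrow> fst i \<le> snd i"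
    and disj: "\<And>i j. i \<in> D \<Longrightarrow> j \<in> D \<Longrightarrow> i \<noteq> j \<Longrightarrow> {fst i<..<snd i} \<inter> {fst j<..<snd j} = {}"
    using D by (auto simp: interval_family_def pairwise_def)
  have disj': "{?cl (fst i)<..<?cl (snd i)} \<inter> {?cl (fst j)<..<?cl (snd j)} = {}"
    if "i \<in> D" "j \<in> D" "i \<noteq> j" for i j
  proof -
    have "{?cl (fst i)<..<?cl (snd i)} \<subseteq> {fst i<..<snd i}"
      "{?cl (fst j)<..<?cl (snd j)} \<subseteq> {fst j<..<snd j}" by auto
    then show ?thesis using disj[OF that] by blast
  qed
  obtain D' where D': "interval_family a b D'"
    "total_length D' = (\<Sum>i\<in>D. ?cl (snd i) - ?cl (fst i))"
    "\<And>g. increments g D' = (\<Sum>i\<in>D. \<bar>g (?cl (snd i)) - g (?cl (fst i))\<bar>)"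
  proof (rule interval_family_of_indexed[where a = a and b = b, OF fin _ disj'])
    show "a \<le> ?cl (fst i) \<and> ?cl (fst i) \<le> ?cl (snd i) \<and> ?cl (snd i) \<le> b" if "i \<in> D" for i
      using mem[OF that] ab by auto
  qed auto
  have "total_length D' \<le> (\<Sum>i\<in>D. snd i - fst i)"
    unfolding D'(2) by (rule sum_mono) (use mem in fastforce)
  then show thesis using that[OF D'(1)] D'(3) by (simp add: case_prod_beta)
qed

text \<open>
  By inner regularity only compact null sets \<open>K\<close> have to be considered. Such a set has an open
  neighbourhood of small measure, hence is covered by finitely many cells of a fine grid of small
  total length, and the measure of these cells is a sum of increments of \<open>F\<close>.
\<close>

lemma null_set_interval_measure:
  fixes F :: "real \<Rightarrow> real"
  assumes F: "mono F" "continuous_on UNIV F"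
    and fin: "emeasure (interval_measure F) UNIV < \<infinity>"
    and ac: "\<And>\<epsilon>. \<epsilon> > 0 \<Longrightarrow> \<exists>\<delta>>0. \<forall>c d D. interval_family c d D \<longrightarrow> total_length D < \<delta> \<longrightarrow> increments F D < \<epsilon>"
    and N: "N \<in> null_sets lborel"
  shows "emeasure (interval_measure F) N = 0"
proof -
  let ?M = "interval_measure F"
  have compact0: "emeasure ?M K \<le> 0" if K: "compact K" "K \<subseteq> N" for K
  proof (rule ennreal_le_epsilon)
    fix e :: real assume "0 < e"
    obtain \<delta> where d: "\<delta> > 0"
      "\<And>c d D. interval_family c d D \<Longrightarrow> total_length D < \<delta> \<Longrightarrow> increments F D < e"
      using ac[OF \<open>0 < e\<close>] by metis
    have Kb: "K \<in> sets borel" using K(1) by (simp add: borel_compact)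
    have "emeasure lborel K = 0"
      using null_sets_subset[OF N _ K(2)] Kb by auto
    moreover obtain U where U: "open U" "K \<subseteq> U" "emeasure lborel (U - K) < \<delta>"
      using outer_regular_lborel[OF Kb d(1)] by blast
    ultimately have Ud: "emeasure lborel U < \<delta>"
      using Kb emeasure_Diff_null_set[of K lborel U] by (simp add: null_sets_def)
    obtain \<epsilon> where eps: "\<epsilon> > 0" "(\<Union>x\<in>K. ball x \<epsilon>) \<subseteq> U"
      using compact_subset_open_imp_ball_epsilon_subset[OF K(1) U(1,2)] by metis
    define \<eta> where "\<eta> = \<epsilon> / 2"
    have eta: "\<eta> > 0" "\<eta> < \<epsilon>" using eps by (auto simp: \<eta>_def)
    \<comment> \<open>The cells \<open>]u k, u (k + 1)]\<close> of mesh \<open>\<eta>\<close> that contain a point of \<open>K\<close>; the mesh is smaller than the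
      distance from \<open>K\<close> to the complement of \<open>U\<close>.\<close>
    define I where "I = (\<lambda>x. \<lceil>x / \<eta>\<rceil> - 1) ` K"
    define u where "u k = of_int k * \<eta>" for k :: int
    have cell: "u k \<le> u (k + 1)" for k using eta by (simp add: u_def)
    obtain B where B: "\<And>x. x \<in> K \<Longrightarrow> \<bar>x\<bar> \<le> B"
      using compact_imp_bounded[OF K(1)] unfolding bounded_iff by auto
    have inI: "x \<in> {u (\<lceil>x / \<eta>\<rceil> - 1)<..u (\<lceil>x / \<eta>\<rceil> - 1 + 1)}" for x
    proof -
      have "of_int \<lceil>x / \<eta>\<rceil> - 1 < x / \<eta>" "x / \<eta> \<le> of_int \<lceil>x / \<eta>\<rceil>" by linarith+
      then have "(of_int \<lceil>x / \<eta>\<rceil> - 1) * \<eta> < x" "x \<le> of_int \<lceil>x / \<eta>\<rceil> * \<eta>"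
        using eta(1) by (simp_all only: pos_less_divide_eq pos_divide_le_eq)
      then show ?thesis by (simp add: u_def)
    qed
    have finI: "finite I"
    proof (rule finite_subset)
      show "I \<subseteq> {\<lfloor>- B / \<eta>\<rfloor> - 2..\<lceil>B / \<eta>\<rceil>}"
      proof
        fix k assume "k \<in> I"
        then obtain x where x: "x \<in> K" "k = \<lceil>x / \<eta>\<rceil> - 1" by (auto simp: I_def)
        have "- B / \<eta> \<le> x / \<eta>" "x / \<eta> \<le> B / \<eta>"
          using B[OF x(1)] eta(1) by (intro divide_right_mono; simp)+
        then show "k \<in> {\<lfloor>- B / \<eta>\<rfloor> - 2..\<lceil>B / \<eta>\<rceil>}" unfolding x(2) by (simp; linarith)
      qed
    qed simp
    have subU: "{u k..u (k + 1)} \<subseteq> U" if "k \<in> I" for k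
    proof -
      obtain x where x: "x \<in> K" "k = \<lceil>x / \<eta>\<rceil> - 1" using \<open>k \<in> I\<close> by (auto simp: I_def)
      have "u (k + 1) - u k = \<eta>" by (simp add: u_def algebra_simps)
      then have "{u k..u (k + 1)} \<subseteq> ball x \<epsilon>"
        using inI[of x] eta unfolding x(2)[symmetric] by (auto simp: dist_real_def)
      then show ?thesis using eps(2) x(1) by blast
    qed
    have disj: "{u k<..<u (k + 1)} \<inter> {u l<..<u (l + 1)} = {}" if "k \<noteq> l" for k l
    proof -
      have u_mono: "u i \<le> u j" if "i \<le> j" for i j
        unfolding u_def using that eta(1) by (intro mult_right_mono) auto
      have "k + 1 \<le> l \<or> l + 1 \<le> k" using that by linarith
      then have "u (k + 1) \<le> u l \<or> u (l + 1) \<le> u k" using u_mono by blast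
      then show ?thesis by auto
    qed
    obtain c where c: "\<And>k. k \<in> I \<Longrightarrow> c \<le> u k"
      using bdd_below_finite[OF finite_imageI[OF finI, of u]] by (auto simp: bdd_below_def)
    obtain d where d': "\<And>k. k \<in> I \<Longrightarrow> u (k + 1) \<le> d"
      using bdd_above_finite[OF finite_imageI[OF finI, of "\<lambda>k. u (k + 1)"]] by (auto simp: bdd_above_def)
    obtain D where D: "interval_family c d D" "total_length D = (\<Sum>k\<in>I. u (k + 1) - u k)"
      "\<And>g. increments g D = (\<Sum>k\<in>I. \<bar>g (u (k + 1)) - g (u k)\<bar>)"
    proof (rule interval_family_of_indexed[where a = c and b = d and x = u and y = "\<lambda>k. u (k + 1)", OF finI])
      show "c \<le> u k \<and> u k \<le> u (k + 1) \<and> u (k + 1) \<le> d" if "k \<in> I" for k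
        using c[OF that] d'[OF that] cell by simp
      show "{u k<..<u (k + 1)} \<inter> {u l<..<u (l + 1)} = {}" if "k \<noteq> l" for k l
        by (rule disj[OF that])
    qed auto
    have "ennreal (total_length D) \<le> emeasure lborel U"
      unfolding D(2)
    proof (rule sum_lengths_le_measure[OF finI cell disj])
      show "{u k<..<u (k + 1)} \<subseteq> U" if "k \<in> I" for k
        using subU[OF that] by (rule order_trans[rotated]) auto
    qed (use U(1) in auto)
    then have "total_length D < \<delta>"
      using Ud by (meson ennreal_leI leD le_less_trans not_le)
    then have small: "increments F D < e" using d(2) D(1) by blast
    have "K \<subseteq> (\<Union>k\<in>I. {u k<..u (k + 1)})"
    proof
      fix x assume "x \<in> K"
      then have "\<lceil>x / \<eta>\<rceil> - 1 \<in> I" by (simp add: I_def)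
      then show "x \<in> (\<Union>k\<in>I. {u k<..u (k + 1)})" using inI by blast
    qed
    then have "emeasure ?M K \<le> emeasure ?M (\<Union>k\<in>I. {u k<..u (k + 1)})"
      by (intro emeasure_mono) (auto simp: finI)
    also have "\<dots> \<le> (\<Sum>k\<in>I. emeasure ?M {u k<..u (k + 1)})"
      by (intro emeasure_subadditive_finite finI) auto
    also have "\<dots> = (\<Sum>k\<in>I. ennreal (F (u (k + 1)) - F (u k)))"
      using F cell by (intro sum.cong refl emeasure_interval_measure_Ioc)
        (auto simp: mono_def continuous_on_eq_continuous_at continuous_at_imp_continuous_at_within)
    also have "\<dots> = ennreal (increments F D)"
      unfolding D(3) using F(1) cell by (subst sum_ennreal) (auto simp: mono_def)
    also have "\<dots> \<le> ennreal e" using small by (intro ennreal_leI) simp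
    finally show "emeasure ?M K \<le> 0 + ennreal e" by simp
  qed
  have "emeasure ?M N = (SUP K\<in>{K. K \<subseteq> N \<and> compact K}. emeasure ?M K)"
    by (rule inner_regular) (use N fin in \<open>auto simp: null_sets_def\<close>)
  also have "\<dots> \<le> 0" by (rule SUP_least) (use compact0 in auto)
  finally show ?thesis by simp
qed

text \<open>
  An increasing function whose increments are dominated by those of the variation generates a measure
  that is absolutely continuous with respect to Lebesgue measure; its Radon-Nikodym density is the
  required \<open>w\<close>. The factor 2 makes the lemma cover both the variation \<open>V\<close> and \<open>V - g\<close>.
\<close>

lemma density_of_variation_dominated:
  assumes ac: "abs_continuous_on_interval a b g" and ab: "a \<le> b"
    and h: "\<And>u v. a \<le> u \<Longrightarrow> u \<le> v \<Longrightarrow> v \<le> b \<Longrightarrow> h u \<le> h v"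
    and hv: "\<And>u v. a \<le> u \<Longrightarrow> u \<le> v \<Longrightarrow> v \<le> b \<Longrightarrow> h v - h u \<le> 2 * variation g u v"
  obtains w :: "real \<Rightarrow> real"
  where "\<And>c d. a \<le> c \<Longrightarrow> c \<le> d \<Longrightarrow> d \<le> b \<Longrightarrow>
      w absolutely_integrable_on {c..d} \<and> integral {c..d} w = h d - h c"
proof -
  define F where "F x = h (max a (min b x))" for x
  have Fh: "F x = h x" if "a \<le> x" "x \<le> b" for x using that by (simp add: F_def)
  have mono: "mono F" unfolding F_def by (rule monoI, rule h) (use ab in auto)
  have Fac: "\<exists>\<delta>>0. \<forall>c d D. interval_family c d D \<longrightarrow> total_length D < \<delta> \<longrightarrow> increments F D < \<epsilon>"
    if "\<epsilon> > 0" for \<epsilon>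
  proof -
    note half = half_gt_zero[OF that]
    obtain \<delta> where d: "\<delta> > 0" "\<And>D. interval_family a b D \<Longrightarrow> total_length D < \<delta> \<Longrightarrow>
      (\<Sum>(u, v)\<in>D. variation g u v) < \<epsilon> / 2"
      by (rule variation_abs_continuous[OF ac half]) blast
    have "increments F D < \<epsilon>" if D: "interval_family c d D" "total_length D < \<delta>" for c d D
    proof -
      obtain D' where D': "interval_family a b D'" "total_length D' \<le> total_length D"
        "\<And>g. increments (\<lambda>x. g (max a (min b x))) D = increments g D'"
        using interval_family_clamp[OF D(1) ab] by metis
      have "increments F D = increments h D'" unfolding F_def by (rule D'(3))
      also have "\<dots> \<le> (\<Sum>(u, v)\<in>D'. 2 * variation g u v)"
      proof (rule sum_mono, clarify)
        fix u v assume "(u, v) \<in> D'"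
        then have "a \<le> u" "u \<le> v" "v \<le> b" using D'(1) by (auto simp: interval_family_def)
        then show "\<bar>h v - h u\<bar> \<le> 2 * variation g u v" using h[of u v] hv[of u v] by simp
      qed
      also have "\<dots> = 2 * (\<Sum>(u, v)\<in>D'. variation g u v)"
        by (simp add: sum_distrib_left case_prod_beta)
      also have "\<dots> < \<epsilon>" using d(2)[OF D'(1)] D(2) D'(2) by simp
      finally show ?thesis .
    qed
    then show ?thesis using d(1) by blast
  qed
  have cont: "continuous_on UNIV F"
  proof -
    have "abs_continuous_on_interval c d F" for c d using Fac unfolding abs_continuous_on_interval_iff by meson
    then have "continuous_on {c<..<d} F" for c d
      by (rule continuous_on_subset[OF abs_continuous_imp_continuous_on[of c d]]) auto
    then have "isCont F x" for x
      using continuous_on_eq_continuous_at[of "{x - 1<..<x + 1}" F] by auto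
    then show ?thesis by (simp add: continuous_on_eq_continuous_at)
  qed
  let ?M = "interval_measure F"
  have mono': "x \<le> y \<Longrightarrow> F x \<le> F y" for x y using mono by (simp add: mono_def)
  have contr: "continuous (at_right x) F" for x
    using cont by (simp add: continuous_on_eq_continuous_at continuous_at_imp_continuous_at_within)
  have fin: "emeasure ?M UNIV < \<infinity>"
  proof -
    have "(SUP n::nat. emeasure ?M {- real n<..real n}) = emeasure ?M (\<Union>n::nat. {- real n<..real n})"
      by (rule SUP_emeasure_incseq) (auto simp: incseq_def)
    moreover have "(\<Union>n::nat. {- real n<..real n}) = UNIV"
    proof (intro equalityI subsetI UNIV_I)
      fix x :: real
      obtain n :: nat where "\<bar>x\<bar> < real n" using reals_Archimedean2 by blast
      then show "x \<in> (\<Union>n::nat. {- real n<..real n})" by (intro UN_I[of n]) auto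
    qed
    moreover have "emeasure ?M {- real n<..real n} \<le> ennreal (F b - F a)" for n
    proof -
      have "emeasure ?M {- real n<..real n} = ennreal (F (real n) - F (- real n))"
        by (rule emeasure_interval_measure_Ioc) (use mono' contr in auto)
      also have "\<dots> \<le> ennreal (F b - F a)"
        unfolding F_def using ab by (intro ennreal_leI diff_mono h) auto
      finally show ?thesis .
    qed
    ultimately have "emeasure ?M UNIV \<le> ennreal (F b - F a)"
      using SUP_least[of UNIV "\<lambda>n::nat. emeasure ?M {- real n<..real n}" "ennreal (F b - F a)"] by simp
    then show ?thesis using ennreal_less_top le_less_trans by fastforce
  qed
  have "absolutely_continuous lborel ?M"
    unfolding absolutely_continuous_def
    using null_set_interval_measure[OF mono cont fin Fac] by (auto simp: null_sets_def)
  then obtain v where v: "v \<in> borel_measurable lborel" "density lborel v = ?M"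
    using sigma_finite_measure.Radon_Nikodym[OF sigma_finite_lborel, of ?M] by auto
  \<comment> \<open>The measure is finite, so the density is finite almost everywhere.\<close>
  define w where "w x = enn2real (v x)" for x
  have w0: "0 \<le> w x" for x by (simp add: w_def)
  have w: "w \<in> borel_measurable borel" unfolding w_def using v(1) by simp
  have "(\<integral>\<^sup>+x. v x \<partial>lborel) = emeasure ?M UNIV"
    unfolding v(2)[symmetric] using v(1) by (simp add: emeasure_density)
  then have vfin: "AE x in lborel. v x \<noteq> \<infinity>"
    using fin v(1) by (intro nn_integral_PInf_AE) auto
  have "w absolutely_integrable_on {c..d} \<and> integral {c..d} w = h d - h c"
    if cd: "a \<le> c" "c \<le> d" "d \<le> b" for c d
  proof -
    have "(\<integral>\<^sup>+x. ennreal (indicator {c..d} x *\<^sub>R w x) \<partial>lborel) = (\<integral>\<^sup>+x. v x * indicator {c..d} x \<partial>lborel)"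
      using vfin by (intro nn_integral_cong_AE, eventually_elim)
        (auto simp: w_def indicator_def ennreal_enn2real_if)
    also have "\<dots> = emeasure ?M {c..d}"
      unfolding v(2)[symmetric] using v(1) by (simp add: emeasure_density)
    also have "\<dots> = ennreal (F d - F c)"
      by (rule emeasure_interval_measure_Icc) (use mono' cont cd in auto)
    finally have "has_bochner_integral lborel (\<lambda>x. indicator {c..d} x *\<^sub>R w x) (F d - F c)"
      using w mono' cd by (intro has_bochner_integral_nn_integral) (simp_all add: w0)
    then have *: "has_bochner_integral lebesgue (\<lambda>x. indicator {c..d} x *\<^sub>R w x) (F d - F c)"
      using w by (simp add: has_bochner_integral_iff integrable_completion integral_completion)
    then have "w absolutely_integrable_on {c..d}"
      unfolding set_integrable_def by (simp add: has_bochner_integral_iff)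
    moreover have "integral {c..d} w = F d - F c"
      using * set_lebesgue_integral_eq_integral(2)[OF calculation]
      by (simp add: has_bochner_integral_iff set_lebesgue_integral_def)
    ultimately show ?thesis using Fh cd by auto
  qed
  then show thesis using that by blast
qed

lemma increment_le_variation:
  assumes "abs_continuous_on_interval a b g" "a \<le> u" "u \<le> v" "v \<le> b"
  shows "\<bar>g v - g u\<bar> \<le> variation g u v"
  using variation_superadditive[OF abs_continuous_subinterval[OF assms(1), of u v] order_refl assms(3)] assms
    increments_le_variation[OF abs_continuous_subinterval[OF assms(1), of u u] interval_family_empty]
  by simp

text \<open>
  Write \<open>g = V - (V - g)\<close> with the variation \<open>V\<close>. Both parts are increasing, so both have densities,
  and the difference \<open>w\<close> of the densities integrates to \<open>g\<close>. Lebesgue's differentiation theorem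
  identifies \<open>w\<close> with the derivative of \<open>g\<close> almost everywhere, which is what makes the total function
  \<open>deriv g\<close> usable even though it has arbitrary values at exceptional points.
\<close>

lemma locally_abs_continuous_fundamental_theorem:
  assumes lac: "locally_abs_continuous g" and ab: "a \<le> b"
  shows "deriv g absolutely_integrable_on {a..b}" "integral {a..b} (deriv g) = g b - g a"
proof -
  have ac: "abs_continuous_on_interval a b g" using lac ab by (simp add: locally_abs_continuous_def)
  define V where "V x = variation g a x" for x
  have Vsup: "V u + \<bar>g v - g u\<bar> \<le> V v" and Vadd: "V v \<le> V u + variation g u v"
    if "a \<le> u" "u \<le> v" "v \<le> b" for u v
    unfolding V_def using that abs_continuous_subinterval[OF ac, of a v]
    by (auto intro!: variation_superadditive variation_add_le)
  have inc: "\<bar>g v - g u\<bar> \<le> variation g u v" if "a \<le> u" "u \<le> v" "v \<le> b" for u v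
    using increment_le_variation[OF ac that] .
  obtain w1 :: "real \<Rightarrow> real" where w1: "\<And>c d. a \<le> c \<Longrightarrow> c \<le> d \<Longrightarrow> d \<le> b \<Longrightarrow>
      w1 absolutely_integrable_on {c..d} \<and> integral {c..d} w1 = V d - V c"
  proof (rule density_of_variation_dominated[OF ac ab, of V])
    fix u v assume uv: "a \<le> u" "u \<le> v" "v \<le> b"
    show "V u \<le> V v" using Vsup[OF uv] by simp
    show "V v - V u \<le> 2 * variation g u v" using Vadd[OF uv] inc[OF uv] by simp
  qed blast
  obtain w2 :: "real \<Rightarrow> real" where w2: "\<And>c d. a \<le> c \<Longrightarrow> c \<le> d \<Longrightarrow> d \<le> b \<Longrightarrow>
      w2 absolutely_integrable_on {c..d} \<and> integral {c..d} w2 = (V d - g d) - (V c - g c)"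
  proof (rule density_of_variation_dominated[OF ac ab, of "\<lambda>x. V x - g x"])
    fix u v assume uv: "a \<le> u" "u \<le> v" "v \<le> b"
    show "V u - g u \<le> V v - g v" using Vsup[OF uv] by simp
    show "V v - g v - (V u - g u) \<le> 2 * variation g u v" using Vadd[OF uv] inc[OF uv] by simp
  qed blast
  \<comment> \<open>The value 0 outside \<open>[a, b]\<close> makes \<open>w\<close> integrable on every interval.\<close>
  define w where "w x = (if x \<in> {a..b} then w1 x - w2 x else 0)" for x
  have w: "w absolutely_integrable_on {c..d}" "integral {c..d} w = g d - g c"
    if "a \<le> c" "c \<le> d" "d \<le> b" for c d
  proof -
    have 1: "(\<lambda>x. w1 x - w2 x) absolutely_integrable_on {c..d}"
      using w1[OF that] w2[OF that] by (auto intro: set_integral_diff)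
    then show "w absolutely_integrable_on {c..d}"
      by (rule absolutely_integrable_spike[OF _ negligible_empty]) (use that in \<open>auto simp: w_def\<close>)
    have "integral {c..d} w = integral {c..d} (\<lambda>x. w1 x - w2 x)"
      by (rule integral_cong) (use that in \<open>auto simp: w_def\<close>)
    also have "\<dots> = g d - g c"
      using w1[OF that] w2[OF that]
      by (subst Henstock_Kurzweil_Integration.integral_diff) (auto intro: set_lebesgue_integral_eq_integral)
    finally show "integral {c..d} w = g d - g c" .
  qed
  have "w integrable_on {c..d}" for c d
  proof -
    have "w integrable_on {a..b}" using w(1)[OF order_refl ab order_refl] set_lebesgue_integral_eq_integral by blast
    then have "(\<lambda>x. if x \<in> {a..b} then w x else 0) integrable_on UNIV"
      by (simp only: Henstock_Kurzweil_Integration.integrable_restrict_UNIV)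
    moreover have "(\<lambda>x. if x \<in> {a..b} then w x else 0) = w" by (auto simp: w_def)
    ultimately show ?thesis by (metis integrable_on_subcbox subset_UNIV box_real(2))
  qed
  then have "AE x in lebesgue. \<forall>a<x. ((\<lambda>y. integral {a..y} w) has_real_derivative w x) (at x)"
    by (rule lebesgue_differentiation)
  then obtain N where N: "negligible N"
    "\<And>x a. x \<notin> N \<Longrightarrow> a < x \<Longrightarrow> ((\<lambda>y. integral {a..y} w) has_real_derivative w x) (at x)"
    by (elim AE_E3) (auto simp: negligible_iff_null_sets)
  have deriv: "deriv g x = w x" if x: "x \<in> {a..b} - (N \<union> {a, b})" for x
  proof -
    have "((\<lambda>y. g a + integral {a..y} w) has_real_derivative w x) (at x)"
      using N(2)[of x a] x by (auto intro!: derivative_eq_intros)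
    moreover have "eventually (\<lambda>y. y \<in> {a<..<b}) (nhds x)"
      using x by (intro eventually_nhds_in_open) auto
    then have "eventually (\<lambda>y. g a + integral {a..y} w = g y) (nhds x)"
      by eventually_elim (auto simp: w(2))
    ultimately have "(g has_real_derivative w x) (at x)"
      using DERIV_cong_ev[of x x "\<lambda>y. g a + integral {a..y} w" g "w x" "w x"] by simp
    then show ?thesis by (rule DERIV_imp_deriv)
  qed
  have neg: "negligible (N \<union> {a, b})" using N(1) by simp
  show "deriv g absolutely_integrable_on {a..b}"
    using absolutely_integrable_spike[OF w(1)[OF order_refl ab order_refl] neg] deriv by auto
  show "integral {a..b} (deriv g) = g b - g a"
    using integral_spike[OF neg, of "{a..b}" w "deriv g"] deriv w(2)[OF order_refl ab order_refl] by auto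
qed

section \<open>Balls of the Lebesgue spaces\<close>

text \<open>
  Estimates always come with membership in the space, without which the norm has no meaning; a
  ball carries both at once.
\<close>

definition Lp_ball :: "real \<Rightarrow> real \<Rightarrow> (real \<Rightarrow> real) set" where
  "Lp_ball p M = {g \<in> Lp_space p. Lp_norm p g \<le> M}"

lemma Lp_norm_nonneg: "0 \<le> Lp_norm p g" by (simp add: Lp_norm_def)

lemma nn_integral_powr_Lp:
  assumes "0 < p" "g \<in> Lp_space p"
  shows "(\<integral>\<^sup>+x. ennreal (\<bar>g x\<bar> powr p) \<partial>lebesgue) = ennreal (Lp_norm p g powr p)"
proof -
  have "Lp_norm p g powr p = (\<integral>x. \<bar>g x\<bar> powr p \<partial>lebesgue)"
    using assms(1) by (simp add: Lp_norm_def powr_powr)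
  then show ?thesis using assms(2) by (simp add: Lp_space_def nn_integral_eq_integral)
qed

text \<open>
  The passage to extended nonnegative integrals: bounds proved there, for instance by Tonelli's
  theorem, yield integrability for free.
\<close>

lemma Lp_ball_iff:
  assumes "0 < p" "0 \<le> M"
  shows "g \<in> Lp_ball p M \<longleftrightarrow> g \<in> borel_measurable lebesgue \<and>
    (\<integral>\<^sup>+x. ennreal (\<bar>g x\<bar> powr p) \<partial>lebesgue) \<le> ennreal (M powr p)"
proof
  assume g: "g \<in> Lp_ball p M"
  then have "Lp_norm p g powr p \<le> M powr p"
    using assms by (intro powr_mono2) (auto simp: Lp_ball_def Lp_norm_nonneg)
  then show "g \<in> borel_measurable lebesgue \<and>
    (\<integral>\<^sup>+x. ennreal (\<bar>g x\<bar> powr p) \<partial>lebesgue) \<le> ennreal (M powr p)"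
    using g nn_integral_powr_Lp[OF assms(1), of g] by (auto simp: Lp_ball_def Lp_space_def ennreal_leI)
next
  assume g: "g \<in> borel_measurable lebesgue \<and>
    (\<integral>\<^sup>+x. ennreal (\<bar>g x\<bar> powr p) \<partial>lebesgue) \<le> ennreal (M powr p)"
  then have [measurable]: "g \<in> borel_measurable lebesgue" by simp
  have "(\<lambda>x. \<bar>g x\<bar> powr p) \<in> borel_measurable lebesgue" by measurable
  moreover have "(\<integral>\<^sup>+x. ennreal (\<bar>g x\<bar> powr p) \<partial>lebesgue) < \<infinity>"
    using g ennreal_less_top le_less_trans by fastforce
  ultimately have int: "integrable lebesgue (\<lambda>x. \<bar>g x\<bar> powr p)"
    by (intro integrableI_bounded) auto
  then have sp: "g \<in> Lp_space p" using g by (simp add: Lp_space_def)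
  have "ennreal (Lp_norm p g powr p) \<le> ennreal (M powr p)"
    using g nn_integral_powr_Lp[OF assms(1) sp] by simp
  then have "Lp_norm p g powr p \<le> M powr p" by simp
  then have "Lp_norm p g \<le> M"
    using assms Lp_norm_nonneg powr_less_mono2[of p M "Lp_norm p g"] by (meson not_le)
  then show "g \<in> Lp_ball p M" using sp by (simp add: Lp_ball_def)
qed

lemma Lp_ballD: "g \<in> Lp_ball p M \<Longrightarrow> g \<in> Lp_space p" "g \<in> Lp_ball p M \<Longrightarrow> Lp_norm p g \<le> M"
  by (auto simp: Lp_ball_def)

lemma Lp_ball_norm: "g \<in> Lp_space p \<Longrightarrow> g \<in> Lp_ball p (Lp_norm p g)"
  by (auto simp: Lp_ball_def)

lemma Lp_ball_mono: "g \<in> Lp_ball p M \<Longrightarrow> M \<le> M' \<Longrightarrow> g \<in> Lp_ball p M'"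
  by (auto simp: Lp_ball_def)

lemma Lp_ball_nonneg: "g \<in> Lp_ball p M \<Longrightarrow> 0 \<le> M"
  using Lp_norm_nonneg[of p g] by (simp add: Lp_ball_def)

lemma borel_measurable_lebesgue_AE:
  fixes f g :: "real \<Rightarrow> real"
  assumes f: "f \<in> borel_measurable lebesgue" and ae: "AE x in lebesgue. f x = g x"
  shows "g \<in> borel_measurable lebesgue"
proof (rule measurableI)
  fix A :: "real set" assume A: "A \<in> sets borel"
  have "f -` A \<inter> space lebesgue \<in> sets lebesgue" using f A by (rule measurable_sets)
  then show "g -` A \<inter> space lebesgue \<in> sets lebesgue"
    by (rule completion.in_sets_AE[rotated]) (use ae in \<open>auto elim!: eventually_mono\<close>)
qed auto

lemma Lp_ball_cong_AE:
  assumes f: "f \<in> Lp_ball p M" and ae: "AE x in lebesgue. f x = g x" and p: "0 < p"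
  shows "g \<in> Lp_ball p M"
proof -
  have "(\<integral>\<^sup>+x. ennreal (\<bar>g x\<bar> powr p) \<partial>lebesgue) = (\<integral>\<^sup>+x. ennreal (\<bar>f x\<bar> powr p) \<partial>lebesgue)"
    using ae by (intro nn_integral_cong_AE) (auto elim!: eventually_mono)
  then show ?thesis using f Lp_ball_nonneg[OF f] p borel_measurable_lebesgue_AE[OF _ ae]
    by (simp add: Lp_ball_iff)
qed

lemma borel_measurable_lebesgue_affine:
  fixes f :: "real \<Rightarrow> real"
  assumes "f \<in> borel_measurable lebesgue" "c \<noteq> 0"
  shows "(\<lambda>x. f (t + c * x)) \<in> borel_measurable lebesgue"
proof -
  have "(\<lambda>x. t + c * x) \<in> lebesgue \<rightarrow>\<^sub>M lebesgue"
    using lebesgue_affine_measurable[of "\<lambda>_. c" t] assms(2) by simp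
  from measurable_compose[OF this assms(1)] show ?thesis .
qed

lemma AE_lebesgue_affine:
  fixes P :: "real \<Rightarrow> bool"
  assumes "AE x in lebesgue. P x" "c \<noteq> 0"
  shows "AE x in lebesgue. P (t + c * x)"
proof -
  have "(\<lambda>x. t + c * x) \<in> lebesgue \<rightarrow>\<^sub>M lebesgue"
    using lebesgue_affine_measurable[of "\<lambda>_. c" t] assms(2) by simp
  moreover have "AE x in distr lebesgue lebesgue (\<lambda>x. t + c * x). P x"
    using assms by (subst (asm) lebesgue_real_affine[OF assms(2), of t])
      (subst (asm) AE_density, auto elim!: eventually_mono)
  ultimately show ?thesis by (rule AE_distrD)
qed

lemma Lp_ball_translate:
  assumes f: "f \<in> Lp_ball p M" and p: "0 < p"
  shows "(\<lambda>x. f (x + h)) \<in> Lp_ball p M"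
proof -
  have M: "0 \<le> M" by (rule Lp_ball_nonneg[OF f])
  have m: "f \<in> borel_measurable lebesgue" using f M p by (simp add: Lp_ball_iff)
  have "(\<integral>\<^sup>+x. ennreal (\<bar>f (h + 1 * x)\<bar> powr p) \<partial>lebesgue) = (\<integral>\<^sup>+x. ennreal (\<bar>f x\<bar> powr p) \<partial>lebesgue)"
    using m by (subst nn_integral_real_affine_lebesgue[of _ 1 h]) auto
  then show ?thesis
    using f M p borel_measurable_lebesgue_affine[OF m, of 1 h] by (simp add: Lp_ball_iff add.commute)
qed

lemma Lp_ball_cmult:
  assumes f: "f \<in> Lp_ball p M" and p: "0 < p"
  shows "(\<lambda>x. c * f x) \<in> Lp_ball p (\<bar>c\<bar> * M)"
proof -
  have M: "0 \<le> M" by (rule Lp_ball_nonneg[OF f])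
  have m: "f \<in> borel_measurable lebesgue" using f M p by (simp add: Lp_ball_iff)
  have "(\<integral>\<^sup>+x. ennreal (\<bar>c * f x\<bar> powr p) \<partial>lebesgue) = ennreal (\<bar>c\<bar> powr p) * (\<integral>\<^sup>+x. ennreal (\<bar>f x\<bar> powr p) \<partial>lebesgue)"
    using m by (subst nn_integral_cmult[symmetric]) (auto simp: abs_mult powr_mult ennreal_mult)
  also have "\<dots> \<le> ennreal (\<bar>c\<bar> powr p) * ennreal (M powr p)"
    using f M p by (intro mult_left_mono) (auto simp: Lp_ball_iff)
  also have "\<dots> = ennreal ((\<bar>c\<bar> * M) powr p)" using M by (simp add: powr_mult ennreal_mult)
  finally show ?thesis using M p m by (simp add: Lp_ball_iff)
qed

text \<open>
  Convexity of the \<open>p\<close>-th power, applied to \<open>u + v\<close> as the convex combination of \<open>(a + b) u / a\<close> and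
  \<open>(a + b) v / b\<close> with weights proportional to \<open>a\<close> and \<open>b\<close>. With \<open>a\<close>, \<open>b\<close> the norms of two functions, its
  integral is Minkowski's inequality.
\<close>

lemma powr_add_convex:
  fixes p a b u v :: real
  assumes p: "1 \<le> p" and ab: "0 < a" "0 < b" and uv: "0 \<le> u" "0 \<le> v"
  shows "(u + v) powr p \<le> (a + b) powr (p - 1) * (u powr p / a powr (p - 1) + v powr p / b powr (p - 1))"
proof -
  have cvx: "((a / (a + b)) * x + (b / (a + b)) * y) powr p \<le> (a / (a + b)) * x powr p + (b / (a + b)) * y powr p"
    if "0 \<le> x" "0 \<le> y" for x y
  proof -
    have "0 < a + b" using ab by simp
    then have ab1: "0 < a / (a + b)" "0 < b / (a + b)" "a / (a + b) \<le> 1" "b / (a + b) \<le> 1"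
      "a / (a + b) + b / (a + b) = 1"
      using ab by (auto simp: add_divide_distrib[symmetric])
    have shrink: "(t * z) powr p \<le> t * z powr p" if "0 < t" "t \<le> 1" "0 \<le> z" for t z :: real
    proof -
      have "t powr p \<le> t powr 1" using that p by (intro powr_mono') auto
      then show ?thesis using that by (simp add: powr_mult mult_right_mono)
    qed
    show ?thesis
    proof (cases "x = 0 \<or> y = 0")
      case True
      then show ?thesis using shrink[OF ab1(1,3) that(1)] shrink[OF ab1(2,4) that(2)] p by auto
    next
      case False
      then have "x \<in> {0<..}" "y \<in> {0<..}" using that by auto
      moreover note powr_convex[OF p] ab1(5) less_imp_le[OF ab1(1)] less_imp_le[OF ab1(2)]
      ultimately show ?thesis unfolding convex_on_def real_scaleR_def by blast
    qed
  qed
  have "(a / (a + b)) * (u / a) + (b / (a + b)) * (v / b) = (u + v) / (a + b)"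
    using ab by (simp add: add_divide_distrib)
  then have "(u + v) powr p = ((a + b) * ((a / (a + b)) * (u / a) + (b / (a + b)) * (v / b))) powr p"
    using ab by simp
  also have "\<dots> = (a + b) powr p * ((a / (a + b)) * (u / a) + (b / (a + b)) * (v / b)) powr p"
    using ab uv by (intro powr_mult) 
  also have "\<dots> \<le> (a + b) powr p * ((a / (a + b)) * (u / a) powr p + (b / (a + b)) * (v / b) powr p)"
    using ab uv by (intro mult_left_mono cvx) auto
  also have "\<dots> = ((a + b) powr p / (a + b)) * (u powr p / (a powr p / a) + v powr p / (b powr p / b))"
    using ab uv by (simp add: powr_divide distrib_left mult_ac)
  also have "\<dots> = (a + b) powr (p - 1) * (u powr p / a powr (p - 1) + v powr p / b powr (p - 1))"
    using ab by (simp add: powr_diff)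
  finally show ?thesis .
qed

text \<open>
  The weights in \<open>powr_add_convex\<close> must be positive, so the radii are first enlarged slightly.
\<close>

lemma Lp_ball_add:
  assumes f: "f \<in> Lp_ball p A" and g: "g \<in> Lp_ball p B" and p: "1 \<le> p"
  shows "(\<lambda>x. f x + g x) \<in> Lp_ball p (A + B)"
proof -
  have p0: "0 < p" using p by simp
  have A: "0 \<le> A" and B: "0 \<le> B" using f g Lp_ball_nonneg by auto
  have mf: "f \<in> borel_measurable lebesgue" and mg: "g \<in> borel_measurable lebesgue"
    using f g A B p by (auto simp: Lp_ball_iff)
  have *: "(\<lambda>x. f x + g x) \<in> Lp_ball p (a + b)" if ab: "A < a" "B < b" for a b
  proof -
    have pos: "0 < a" "0 < b" using ab A B by auto
    define \<alpha> \<beta> where "\<alpha> = (a + b) powr (p - 1) / a powr (p - 1)"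
      and "\<beta> = (a + b) powr (p - 1) / b powr (p - 1)"
    have nn: "0 \<le> \<alpha>" "0 \<le> \<beta>" by (auto simp: \<alpha>_def \<beta>_def)
    have fa: "f \<in> Lp_ball p a" "g \<in> Lp_ball p b" using f g ab Lp_ball_mono less_imp_le by blast+
    have pw: "\<bar>f x + g x\<bar> powr p \<le> \<alpha> * \<bar>f x\<bar> powr p + \<beta> * \<bar>g x\<bar> powr p" for x
    proof -
      have "\<bar>f x + g x\<bar> powr p \<le> (\<bar>f x\<bar> + \<bar>g x\<bar>) powr p" using p by (intro powr_mono2) auto
      also have "\<dots> \<le> \<alpha> * \<bar>f x\<bar> powr p + \<beta> * \<bar>g x\<bar> powr p"
        using powr_add_convex[OF p pos, of "\<bar>f x\<bar>" "\<bar>g x\<bar>"] by (simp add: \<alpha>_def \<beta>_def field_simps)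
      finally show ?thesis .
    qed
    have "(\<integral>\<^sup>+x. ennreal (\<bar>f x + g x\<bar> powr p) \<partial>lebesgue)
      \<le> (\<integral>\<^sup>+x. ennreal \<alpha> * ennreal (\<bar>f x\<bar> powr p) + ennreal \<beta> * ennreal (\<bar>g x\<bar> powr p) \<partial>lebesgue)"
      using pw nn by (intro nn_integral_mono) (simp add: ennreal_leI flip: ennreal_mult ennreal_plus)
    also have "\<dots> = ennreal \<alpha> * (\<integral>\<^sup>+x. ennreal (\<bar>f x\<bar> powr p) \<partial>lebesgue)
        + ennreal \<beta> * (\<integral>\<^sup>+x. ennreal (\<bar>g x\<bar> powr p) \<partial>lebesgue)"
      using mf mg by (simp add: nn_integral_add nn_integral_cmult)
    also have "\<dots> \<le> ennreal \<alpha> * ennreal (a powr p) + ennreal \<beta> * ennreal (b powr p)"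
      using fa pos p0 by (intro add_mono mult_left_mono) (auto simp: Lp_ball_iff)
    also have "\<dots> = ennreal (\<alpha> * a powr p + \<beta> * b powr p)"
      using nn by (simp add: ennreal_mult ennreal_plus)
    also have "\<alpha> * a powr p + \<beta> * b powr p = (a + b) powr p"
    proof -
      have pp: "z powr p = z powr (p - 1) * z" if "0 < z" for z using that by (simp add: powr_diff)
      show ?thesis using pos by (simp add: \<alpha>_def \<beta>_def pp distrib_left)
    qed
    finally show ?thesis using mf mg pos p0 by (simp add: Lp_ball_iff)
  qed
  have sp: "(\<lambda>x. f x + g x) \<in> Lp_space p" using *[of "A + 1" "B + 1"] by (simp add: Lp_ball_def)
  have "Lp_norm p (\<lambda>x. f x + g x) \<le> A + B"
  proof (rule field_le_epsilon)
    fix e :: real assume "0 < e"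
    then show "Lp_norm p (\<lambda>x. f x + g x) \<le> A + B + e"
      using *[of "A + e / 2" "B + e / 2"] by (simp add: Lp_ball_def)
  qed
  then show ?thesis using sp by (simp add: Lp_ball_def)
qed

lemma Lp_ball_diff:
  assumes f: "f \<in> Lp_ball p A" and g: "g \<in> Lp_ball p B" and p: "1 \<le> p"
  shows "(\<lambda>x. f x - g x) \<in> Lp_ball p (A + B)"
  using Lp_ball_add[OF f Lp_ball_cmult[OF g, of "-1"] p] p by simp

lemma Lp_ball_sum:
  assumes "finite I" "\<And>i. i \<in> I \<Longrightarrow> f i \<in> Lp_ball p (B i)" "1 \<le> p"
  shows "(\<lambda>x. \<Sum>i\<in>I. f i x) \<in> Lp_ball p (\<Sum>i\<in>I. B i)"
  using assms
proof (induction I rule: finite_induct)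
  case empty
  then show ?case by (simp add: Lp_ball_iff)
next
  case (insert i I)
  then show ?case by (simp add: Lp_ball_add)
qed

section \<open>Jensen and Minkowski inequalities for averages\<close>

text \<open>
  The graph of the \<open>p\<close>-th power lies above its tangent at \<open>y\<close>, in a form that makes sense at \<open>y = 0\<close>.
\<close>

lemma young_tangent:
  fixes p y q :: real
  assumes p: "1 \<le> p" and "0 \<le> y" "0 \<le> q"
  shows "p * (y powr (p - 1) * q) \<le> q powr p + (p - 1) * y powr p"
proof (cases "p = 1")
  case True
  then show ?thesis using assms by (cases "y = 0") simp_all
next
  case False
  then have p1: "1 < p" using p by simp
  define p' where "p' = p / (p - 1)"
  have "1 < p'" "1 / p + 1 / p' = 1" using p1 by (auto simp: p'_def field_simps)
  then have "q * y powr (p - 1) \<le> q powr p / p + (y powr (p - 1)) powr p' / p'"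
    using assms p1 by (intro Youngs_inequality) auto
  also have "(y powr (p - 1)) powr p' = y powr p" using p1 by (simp add: powr_powr p'_def)
  also have "q powr p / p + y powr p / p' = (q powr p + (p - 1) * y powr p) / p"
    using p1 by (simp add: p'_def field_simps)
  finally show ?thesis using p1 by (simp add: field_simps)
qed

text \<open>
  Integrate the tangent inequality at the mean. If \<open>k\<close> or its \<open>p\<close>-th power fails to be integrable, then
  the left-hand side vanishes by convention or the right-hand side is infinite.
\<close>

lemma jensen_average:
  fixes k :: "real \<Rightarrow> real"
  assumes \<delta>: "0 < \<delta>" and p: "1 \<le> p" and k[measurable]: "k \<in> borel_measurable borel"
  shows "ennreal (\<bar>1 / \<delta> * (LINT t:{0..\<delta>}|lborel. k t)\<bar> powr p)
    \<le> ennreal (1 / \<delta>) * (\<integral>\<^sup>+t\<in>{0..\<delta>}. ennreal (\<bar>k t\<bar> powr p) \<partial>lborel)"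
proof (cases "set_integrable lborel {0..\<delta>} k \<and> set_integrable lborel {0..\<delta>} (\<lambda>t. \<bar>k t\<bar> powr p)")
  case False
  then consider "\<not> set_integrable lborel {0..\<delta>} k" | "\<not> set_integrable lborel {0..\<delta>} (\<lambda>t. \<bar>k t\<bar> powr p)" by blast
  then show ?thesis
  proof cases
    case 1
    then have "(LINT t:{0..\<delta>}|lborel. k t) = 0"
      by (simp add: set_integrable_def set_lebesgue_integral_def not_integrable_integral_eq)
    then show ?thesis by simp
  next
    case 2
    have "(\<integral>\<^sup>+t\<in>{0..\<delta>}. ennreal (\<bar>k t\<bar> powr p) \<partial>lborel) = \<infinity>"
    proof (rule ccontr)
      assume "\<not> ?thesis"
      moreover have "(\<integral>\<^sup>+t. ennreal (norm (indicator {0..\<delta>} t *\<^sub>R \<bar>k t\<bar> powr p)) \<partial>lborel)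
          = (\<integral>\<^sup>+t\<in>{0..\<delta>}. ennreal (\<bar>k t\<bar> powr p) \<partial>lborel)"
        by (intro nn_integral_cong) (auto simp: indicator_def)
      ultimately have "set_integrable lborel {0..\<delta>} (\<lambda>t. \<bar>k t\<bar> powr p)"
        unfolding set_integrable_def by (intro integrableI_bounded) (auto simp: top.not_eq_extremum)
      then show False using 2 by simp
    qed
    then show ?thesis using \<delta> by (simp add: ennreal_mult_top)
  qed
next
  case True
  then have ki: "set_integrable lborel {0..\<delta>} k" and kp: "set_integrable lborel {0..\<delta>} (\<lambda>t. \<bar>k t\<bar> powr p)" by auto
  define A where "A = (LINT t:{0..\<delta>}|lborel. \<bar>k t\<bar>)"
  define Q where "Q = (LINT t:{0..\<delta>}|lborel. \<bar>k t\<bar> powr p)"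
  define y where "y = A / \<delta>"
  have A0: "0 \<le> A" unfolding A_def set_lebesgue_integral_def by (rule integral_nonneg_AE) auto
  have y0: "0 \<le> y" using A0 \<delta> by (simp add: y_def)
  have le: "\<bar>1 / \<delta> * (LINT t:{0..\<delta>}|lborel. k t)\<bar> \<le> y"
  proof -
    have "norm (LINT t:{0..\<delta>}|lborel. k t) \<le> (LINT t:{0..\<delta>}|lborel. norm (k t))"
      by (rule set_integral_norm_bound[OF ki])
    then show ?thesis using \<delta> by (simp add: abs_mult y_def A_def divide_right_mono)
  qed
  have ci: "set_integrable lborel {0..\<delta>} (\<lambda>t. c::real)" for c
    unfolding set_integrable_def using \<delta>
    by (intro integrable_scaleR_left integrable_real_indicator) auto
  have cint: "(LINT t:{0..\<delta>}|lborel. c) = \<delta> * c" for c :: real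
    using \<delta> by (simp add: set_lebesgue_integral_def)
  have ka: "set_integrable lborel {0..\<delta>} (\<lambda>t. \<bar>k t\<bar>)" by (rule set_integrable_abs[OF ki])
  have "(LINT t:{0..\<delta>}|lborel. p * (y powr (p - 1) * \<bar>k t\<bar>)) \<le> (LINT t:{0..\<delta>}|lborel. \<bar>k t\<bar> powr p + (p - 1) * y powr p)"
    using ka kp y0 p
    by (intro set_integral_mono set_integral_add set_integrable_mult_right ci young_tangent) auto
  also have "\<dots> = Q + \<delta> * ((p - 1) * y powr p)"
    unfolding Q_def using kp ci by (simp add: set_integral_add cint)
  finally have "p * (y powr (p - 1) * A) \<le> Q + \<delta> * ((p - 1) * y powr p)"
    by (simp add: A_def)
  moreover have "y powr (p - 1) * A = \<delta> * y powr p"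
    using \<delta> A0 by (cases "A = 0") (auto simp: y_def powr_diff)
  ultimately have "p * (\<delta> * y powr p) \<le> Q + \<delta> * ((p - 1) * y powr p)" by simp
  then have "\<delta> * y powr p \<le> Q" by (simp add: algebra_simps)
  then have "y powr p \<le> 1 / \<delta> * Q" using \<delta> by (simp add: field_simps)
  moreover have "\<bar>1 / \<delta> * (LINT t:{0..\<delta>}|lborel. k t)\<bar> powr p \<le> y powr p"
    using le p by (intro powr_mono2) auto
  ultimately have "ennreal (\<bar>1 / \<delta> * (LINT t:{0..\<delta>}|lborel. k t)\<bar> powr p) \<le> ennreal (1 / \<delta> * Q)"
    by (intro ennreal_leI) simp
  also have "\<dots> = ennreal (1 / \<delta>) * ennreal Q" using \<delta> by (intro ennreal_mult') simp
  also have "ennreal Q = (\<integral>\<^sup>+t\<in>{0..\<delta>}. ennreal (\<bar>k t\<bar> powr p) \<partial>lborel)"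
  proof -
    have "ennreal Q = (\<integral>\<^sup>+t. ennreal (indicator {0..\<delta>} t *\<^sub>R \<bar>k t\<bar> powr p) \<partial>lborel)"
      unfolding Q_def set_lebesgue_integral_def
      by (rule nn_integral_eq_integral[symmetric, OF kp[unfolded set_integrable_def]]) auto
    also have "\<dots> = (\<integral>\<^sup>+t\<in>{0..\<delta>}. ennreal (\<bar>k t\<bar> powr p) \<partial>lborel)"
      by (intro nn_integral_cong) (auto simp: indicator_def)
    finally show ?thesis .
  qed
  finally show ?thesis .
qed

lemma set_integral_lebesgue_borel:
  fixes k :: "real \<Rightarrow> real"
  assumes "k \<in> borel_measurable borel" "A \<in> sets borel"
  shows "(LINT t:A|lebesgue. k t) = (LINT t:A|lborel. k t)"
  unfolding set_lebesgue_integral_def using assms by (intro integral_completion) auto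

text \<open>
  Minkowski's integral inequality for a mean over an interval, from Jensen's inequality for each \<open>x\<close>
  and Tonelli's theorem. Tonelli's theorem is the reason for joint Borel measurability; Lebesgue
  measurable functions are replaced by Borel representatives before the lemma is applied.
\<close>

lemma Lp_ball_parametric_average:
  fixes K :: "real \<Rightarrow> real \<Rightarrow> real"
  assumes \<delta>: "0 < \<delta>" and p: "1 \<le> p"
    and K: "case_prod K \<in> borel_measurable (borel \<Otimes>\<^sub>M borel)"
    and M: "\<And>t. 0 \<le> t \<Longrightarrow> t \<le> \<delta> \<Longrightarrow> (\<lambda>x. K x t) \<in> Lp_ball p M"
  shows "(\<lambda>x. 1 / \<delta> * (LINT t:{0..\<delta>}|lebesgue. K x t)) \<in> Lp_ball p M"
proof -
  have M0: "0 \<le> M" using Lp_ball_nonneg[OF M, of 0] \<delta> by simp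
  have p0: "0 < p" using p by simp
  have Kx: "K x \<in> borel_measurable borel" for x
    using measurable_compose[OF measurable_Pair1' K, of x] by simp
  have K'[measurable]: "(\<lambda>z. K (fst z) (snd z)) \<in> borel_measurable (borel \<Otimes>\<^sub>M borel)"
    using K by (simp add: case_prod_beta')
  have meas: "(\<lambda>x. 1 / \<delta> * (LINT t:{0..\<delta>}|lborel. K x t)) \<in> borel_measurable borel"
  proof -
    have "(\<lambda>x. \<integral>t. indicator {0..\<delta>} t *\<^sub>R K x t \<partial>lborel) \<in> borel_measurable borel"
      by (rule lborel.borel_measurable_lebesgue_integral)
        (use K' in \<open>simp add: case_prod_beta' cong: measurable_cong_sets\<close>)
    then show ?thesis by (simp add: set_lebesgue_integral_def)
  qed
  have K2: "(\<lambda>(x, t). ennreal (1 / \<delta>) * (ennreal (\<bar>K x t\<bar> powr p) * indicator {0..\<delta>} t))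
      \<in> borel_measurable (lborel \<Otimes>\<^sub>M lborel)"
    using K' by (simp add: case_prod_beta' cong: measurable_cong_sets)
  have "(\<integral>\<^sup>+x. ennreal (\<bar>1 / \<delta> * (LINT t:{0..\<delta>}|lborel. K x t)\<bar> powr p) \<partial>lborel)
      \<le> (\<integral>\<^sup>+x. ennreal (1 / \<delta>) * (\<integral>\<^sup>+t\<in>{0..\<delta>}. ennreal (\<bar>K x t\<bar> powr p) \<partial>lborel) \<partial>lborel)"
    using Kx by (intro nn_integral_mono jensen_average \<delta> p)
  also have "\<dots> = (\<integral>\<^sup>+x. (\<integral>\<^sup>+t. ennreal (1 / \<delta>) * (ennreal (\<bar>K x t\<bar> powr p) * indicator {0..\<delta>} t) \<partial>lborel) \<partial>lborel)"
    using Kx by (intro nn_integral_cong nn_integral_cmult[symmetric]) auto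
  also have "\<dots> = (\<integral>\<^sup>+t. (\<integral>\<^sup>+x. ennreal (1 / \<delta>) * (ennreal (\<bar>K x t\<bar> powr p) * indicator {0..\<delta>} t) \<partial>lborel) \<partial>lborel)"
    using lborel_pair.Fubini'[OF K2] by simp
  also have "\<dots> \<le> (\<integral>\<^sup>+t. ennreal (1 / \<delta>) * ennreal (M powr p) * indicator {0..\<delta>} t \<partial>lborel)"
  proof (intro nn_integral_mono)
    fix t :: real
    show "(\<integral>\<^sup>+x. ennreal (1 / \<delta>) * (ennreal (\<bar>K x t\<bar> powr p) * indicator {0..\<delta>} t) \<partial>lborel)
        \<le> ennreal (1 / \<delta>) * ennreal (M powr p) * indicator {0..\<delta>} t"
    proof (cases "t \<in> {0..\<delta>}")
      case True
      have "(\<lambda>x. K x t) \<in> borel_measurable borel"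
        using measurable_compose[OF measurable_Pair2' K, of t] by simp
      then have "(\<integral>\<^sup>+x. ennreal (1 / \<delta>) * ennreal (\<bar>K x t\<bar> powr p) \<partial>lborel)
         = ennreal (1 / \<delta>) * (\<integral>\<^sup>+x. ennreal (\<bar>K x t\<bar> powr p) \<partial>lebesgue)"
        by (subst nn_integral_cmult) (auto simp: nn_integral_completion)
      also have "\<dots> \<le> ennreal (1 / \<delta>) * ennreal (M powr p)"
        using M[of t] True M0 p0 by (intro mult_left_mono) (auto simp: Lp_ball_iff)
      finally show ?thesis using True by simp
    qed simp
  qed
  also have "\<dots> = ennreal (1 / \<delta>) * ennreal (M powr p) * ennreal \<delta>"
    using \<delta> by (simp add: nn_integral_cmult_indicator)
  also have "\<dots> = ennreal (M powr p)"
    using \<delta> by (simp add: ennreal_mult[symmetric])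
  finally have "(\<lambda>x. 1 / \<delta> * (LINT t:{0..\<delta>}|lborel. K x t)) \<in> Lp_ball p M"
    using meas by (simp add: Lp_ball_iff[OF p0 M0] nn_integral_completion measurable_completion)
  then show ?thesis using Kx by (simp add: set_integral_lebesgue_borel)
qed

section \<open>Differences and one-dimensional averages\<close>

definition avg :: "real \<Rightarrow> (real \<Rightarrow> real) \<Rightarrow> real \<Rightarrow> real" where
  "avg \<delta> f x = 1 / \<delta> * (LINT t:{0..\<delta>}|lebesgue. f (x + t))"

definition fdiff :: "real \<Rightarrow> (real \<Rightarrow> real) \<Rightarrow> real \<Rightarrow> real" where
  "fdiff h f x = f (x + h) - f x"

lemma pascal_sum:
  fixes a :: "nat \<Rightarrow> real"
  shows "(\<Sum>k=0..Suc s. real (Suc s choose k) * a k)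
    = (\<Sum>k=0..s. real (s choose k) * a (Suc k)) + (\<Sum>k=0..s. real (s choose k) * a k)"
proof -
  have "(\<Sum>k=0..s. real (s choose k) * a k) = (\<Sum>k=0..Suc s. real (s choose k) * a k)"
    by simp
  also have "\<dots> = a 0 + (\<Sum>k=0..s. real (s choose Suc k) * a (Suc k))"
    by (subst sum.atLeast0_atMost_Suc_shift) simp
  finally show ?thesis
    by (subst sum.atLeast0_atMost_Suc_shift) (simp add: sum.distrib algebra_simps)
qed

lemma fin_diff_Suc: "fin_diff (Suc s) h f = fdiff h (fin_diff s h f)"
proof
  fix x
  let ?a = "\<lambda>k. (-1) ^ (Suc s - k) * f (x + real k * h)"
  have "fin_diff (Suc s) h f x = (\<Sum>k=0..Suc s. real (Suc s choose k) * ?a k)"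
    by (simp only: fin_diff_def mult.assoc)
  also have "\<dots> = (\<Sum>k=0..s. real (s choose k) * ?a (Suc k)) + (\<Sum>k=0..s. real (s choose k) * ?a k)"
    by (rule pascal_sum)
  also have "(\<Sum>k=0..s. real (s choose k) * ?a (Suc k)) = fin_diff s h f (x + h)"
    unfolding fin_diff_def by (intro sum.cong) (auto simp: algebra_simps)
  also have "(\<Sum>k=0..s. real (s choose k) * ?a k) = - fin_diff s h f x"
    unfolding fin_diff_def sum_negf[symmetric] by (intro sum.cong) (auto simp: Suc_diff_le)
  finally show "fin_diff (Suc s) h f x = fdiff h (fin_diff s h f) x" by (simp add: fdiff_def)
qed

text \<open>
  Iterating the first difference makes the induction on the order available.
\<close>

lemma fin_diff_funpow: "fin_diff s h f = (fdiff h ^^ s) f"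
proof (induction s)
  case 0
  show ?case by (simp add: fin_diff_def fun_eq_iff)
qed (simp add: fin_diff_Suc)

lemma fin_diff_zero_step: "0 < s \<Longrightarrow> fin_diff s 0 f x = 0"
  by (cases s) (auto simp: fin_diff_Suc fdiff_def)

lemma fin_diff_diff: "fin_diff s h (\<lambda>x. f x - g x) x = fin_diff s h f x - fin_diff s h g x"
  by (simp add: fin_diff_def sum_subtractf algebra_simps)

lemma bounded_measurable_iff:
  "f \<in> bounded_measurable \<longleftrightarrow> f \<in> borel_measurable lebesgue \<and> (\<exists>M. \<forall>x. \<bar>f x\<bar> \<le> M)"
  by (auto simp: bounded_measurable_def bounded_iff)

lemma bounded_measurable_bound:
  assumes "f \<in> bounded_measurable"
  obtains M where "0 < M" "\<And>x. \<bar>f x\<bar> \<le> M"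
proof -
  obtain M where M: "\<And>x. \<bar>f x\<bar> \<le> M" using assms by (auto simp: bounded_measurable_iff)
  then have "\<bar>f x\<bar> \<le> \<bar>M\<bar> + 1" for x using M[of x] by linarith
  then show thesis by (rule that[rotated]) simp
qed

lemma bounded_measurable_affine:
  assumes "f \<in> bounded_measurable" "c \<noteq> 0"
  shows "(\<lambda>x. f (t + c * x)) \<in> bounded_measurable"
  using assms borel_measurable_lebesgue_affine[of f c t] by (auto simp: bounded_measurable_iff)

lemma bounded_measurable_shift:
  "f \<in> bounded_measurable \<Longrightarrow> (\<lambda>x. f (x + h)) \<in> bounded_measurable"
  using bounded_measurable_affine[of f 1 h] by (simp add: add.commute)

lemma bounded_measurable_const: "(\<lambda>x. c) \<in> bounded_measurable"
  by (auto simp: bounded_measurable_iff)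

lemma bounded_measurable_add:
  assumes "f \<in> bounded_measurable" "g \<in> bounded_measurable"
  shows "(\<lambda>x. f x + g x) \<in> bounded_measurable"
proof -
  obtain A B where "\<And>x. \<bar>f x\<bar> \<le> A" "\<And>x. \<bar>g x\<bar> \<le> B"
    using assms by (metis bounded_measurable_bound)
  then have "\<bar>f x + g x\<bar> \<le> A + B" for x by (meson abs_triangle_ineq add_mono order_trans)
  then show ?thesis using assms by (auto simp: bounded_measurable_iff)
qed

lemma bounded_measurable_cmult:
  assumes "f \<in> bounded_measurable"
  shows "(\<lambda>x. c * f x) \<in> bounded_measurable"
proof -
  obtain A where "\<And>x. \<bar>f x\<bar> \<le> A" using assms by (metis bounded_measurable_bound)
  then have "\<bar>c * f x\<bar> \<le> \<bar>c\<bar> * A" for x by (simp add: abs_mult mult_left_mono)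
  then show ?thesis using assms by (auto simp: bounded_measurable_iff)
qed

lemma bounded_measurable_diff:
  "f \<in> bounded_measurable \<Longrightarrow> g \<in> bounded_measurable \<Longrightarrow> (\<lambda>x. f x - g x) \<in> bounded_measurable"
  using bounded_measurable_add[of f "\<lambda>x. -1 * g x"] bounded_measurable_cmult[of g "-1"] by simp

lemma bounded_measurable_sum:
  "(\<And>i. i \<in> I \<Longrightarrow> f i \<in> bounded_measurable) \<Longrightarrow> (\<lambda>x. \<Sum>i\<in>I. f i x) \<in> bounded_measurable"
  by (induction I rule: infinite_finite_induct)
    (auto intro: bounded_measurable_const bounded_measurable_add)

lemma bounded_measurable_fdiff: "f \<in> bounded_measurable \<Longrightarrow> fdiff h f \<in> bounded_measurable"
  unfolding fdiff_def[abs_def] by (intro bounded_measurable_diff bounded_measurable_shift)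

lemma bounded_measurable_fdiff_iterate:
  "f \<in> bounded_measurable \<Longrightarrow> (fdiff h ^^ n) f \<in> bounded_measurable"
  by (induction n) (auto intro: bounded_measurable_fdiff)

lemma absolutely_integrable_bounded_measurable:
  assumes "f \<in> bounded_measurable"
  shows "f absolutely_integrable_on {a..b}"
proof -
  obtain M where M: "\<And>x. \<bar>f x\<bar> \<le> M" using assms by (metis bounded_measurable_bound)
  show ?thesis
    by (rule measurable_bounded_by_integrable_imp_absolutely_integrable[where g = "\<lambda>_. M"])
      (use assms M in \<open>auto simp: bounded_measurable_iff intro: measurable_restrict_space1\<close>)
qed

lemma integrable_bounded_measurable: "f \<in> bounded_measurable \<Longrightarrow> f integrable_on {a..b}"
  by (rule set_lebesgue_integral_eq_integral(1)[OF absolutely_integrable_bounded_measurable])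

text \<open>
  The form that allows one to add and differentiate integrals with variable endpoints.
\<close>

lemma avg_eq_integral_of_absolutely_integrable:
  assumes "f absolutely_integrable_on {x..x + \<delta>}"
  shows "avg \<delta> f x = integral {x..x + \<delta>} f / \<delta>"
proof -
  have shift: "(\<lambda>t. g (x + t)) integrable_on {0..\<delta>}" if "g integrable_on {x..x + \<delta>}" for g :: "real \<Rightarrow> real"
    using that has_integral_shift_Icc_real[of g x _ 0 \<delta>]
    unfolding integrable_on_def by (auto simp: comp_def add.commute)
  have "(\<lambda>t. f (x + t)) absolutely_integrable_on {0..\<delta>}"
    using assms shift[of f] shift[of "\<lambda>x. norm (f x)"] unfolding absolutely_integrable_on_def by blast
  then have "(LINT t:{0..\<delta>}|lebesgue. f (x + t)) = integral {0..\<delta>} (\<lambda>t. f (x + t))"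
    by (rule set_lebesgue_integral_eq_integral(2))
  also have "\<dots> = integral {x..x + \<delta>} f"
    using integral_shift_Icc_real[of 0 \<delta> f x] by (simp add: comp_def add.commute)
  finally show ?thesis by (simp add: avg_def)
qed

lemma avg_eq_integral:
  assumes "f \<in> bounded_measurable"
  shows "avg \<delta> f x = integral {x..x + \<delta>} f / \<delta>"
  by (rule avg_eq_integral_of_absolutely_integrable[OF absolutely_integrable_bounded_measurable[OF assms]])

lemma avg_add:
  assumes "f \<in> bounded_measurable" "g \<in> bounded_measurable"
  shows "avg \<delta> (\<lambda>x. f x + g x) x = avg \<delta> f x + avg \<delta> g x"
  using assms
  by (simp add: avg_eq_integral bounded_measurable_add Henstock_Kurzweil_Integration.integral_add
      integrable_bounded_measurable add_divide_distrib)

lemma avg_cmult: "avg \<delta> (\<lambda>x. c * f x) x = c * avg \<delta> f x"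
  by (simp add: avg_def)

lemma avg_diff:
  assumes "f \<in> bounded_measurable" "g \<in> bounded_measurable"
  shows "avg \<delta> (\<lambda>x. f x - g x) x = avg \<delta> f x - avg \<delta> g x"
  using avg_add[OF assms(1) bounded_measurable_cmult[OF assms(2), of "-1"], of \<delta> x]
    avg_cmult[of \<delta> "-1" g x] by simp

lemma avg_const: "0 < \<delta> \<Longrightarrow> avg \<delta> (\<lambda>x. c) x = c"
  by (simp add: avg_eq_integral bounded_measurable_const)

lemma avg_translate: "avg \<delta> (\<lambda>x. f (x + h)) x = avg \<delta> f (x + h)"
  by (simp add: avg_def algebra_simps)

lemma avg_fdiff: "f \<in> bounded_measurable \<Longrightarrow> avg \<delta> (fdiff h f) = fdiff h (avg \<delta> f)"
  by (rule ext) (simp add: fdiff_def[abs_def] avg_diff avg_translate bounded_measurable_shift)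

lemma integral_bound_interval:
  assumes "f \<in> bounded_measurable" "\<And>t. t \<in> {a..b} \<Longrightarrow> \<bar>f t\<bar> \<le> M" "a \<le> b"
  shows "\<bar>integral {a..b} f\<bar> \<le> M * (b - a)"
proof -
  have "norm (integral {a..b} f) \<le> integral {a..b} (\<lambda>_. M)"
    by (rule integral_norm_bound_integral) (use assms integrable_bounded_measurable in auto)
  then show ?thesis using assms(3) by (simp add: mult.commute)
qed

lemma avg_bound:
  assumes "f \<in> bounded_measurable" "\<And>t. t \<in> {x..x + \<delta>} \<Longrightarrow> \<bar>f t\<bar> \<le> M" "0 < \<delta>"
  shows "\<bar>avg \<delta> f x\<bar> \<le> M"
proof -
  have "\<bar>integral {x..x + \<delta>} f\<bar> \<le> M * (x + \<delta> - x)"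
    by (rule integral_bound_interval[OF assms(1,2)]) (use assms(3) in auto)
  then show ?thesis using assms(3) by (simp add: avg_eq_integral[OF assms(1)] field_simps)
qed

text \<open>
  Shifting the interval of integration changes the integral only by the integrals over two intervals
  of length \<open>\<bar>y - x\<bar>\<close>.
\<close>

lemma avg_lipschitz:
  assumes f: "f \<in> bounded_measurable" and \<delta>: "0 < \<delta>" and M: "\<And>t. \<bar>f t\<bar> \<le> M"
  shows "\<bar>avg \<delta> f y - avg \<delta> f x\<bar> \<le> 2 * M / \<delta> * \<bar>y - x\<bar>"
proof -
  have main: "\<bar>avg \<delta> f y - avg \<delta> f x\<bar> \<le> 2 * M / \<delta> * (y - x)" if "x \<le> y" for x y
  proof -
    have int: "f integrable_on {a..b}" for a b using integrable_bounded_measurable[OF f] .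
    have "integral {x..y} f + integral {y..y + \<delta>} f = integral {x..y + \<delta>} f"
      "integral {x..x + \<delta>} f + integral {x + \<delta>..y + \<delta>} f = integral {x..y + \<delta>} f"
      using that \<delta> int by (auto intro!: Henstock_Kurzweil_Integration.integral_combine)
    then have "integral {y..y + \<delta>} f - integral {x..x + \<delta>} f = integral {x + \<delta>..y + \<delta>} f - integral {x..y} f"
      by simp
    moreover have "\<bar>integral {x + \<delta>..y + \<delta>} f\<bar> \<le> M * (y - x)" "\<bar>integral {x..y} f\<bar> \<le> M * (y - x)"
      using integral_bound_interval[OF f, of "x + \<delta>" "y + \<delta>" M] integral_bound_interval[OF f, of x y M] that M
      by auto
    ultimately have "\<bar>integral {y..y + \<delta>} f - integral {x..x + \<delta>} f\<bar> \<le> 2 * M * (y - x)" by linarith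
    then show ?thesis using \<delta> by (simp add: avg_eq_integral[OF f] divide_right_mono flip: diff_divide_distrib)
  qed
  show ?thesis using main[of x y] main[of y x] by (cases "x \<le> y") (auto simp: abs_minus_commute)
qed

lemma continuous_avg:
  assumes f: "f \<in> bounded_measurable" and \<delta>: "0 < \<delta>"
  shows "continuous_on S (avg \<delta> f)"
proof -
  obtain M where M: "0 < M" "\<And>x. \<bar>f x\<bar> \<le> M" using f by (metis bounded_measurable_bound)
  have "lipschitz_on (2 * M / \<delta>) S (avg \<delta> f)"
    by (rule lipschitz_onI) (use avg_lipschitz[OF f \<delta> M(2)] M \<delta> in \<open>auto simp: dist_real_def abs_minus_commute\<close>)
  then show ?thesis by (rule lipschitz_on_continuous_on)
qed

lemma bounded_measurable_avg:
  assumes f: "f \<in> bounded_measurable" and \<delta>: "0 < \<delta>"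
  shows "avg \<delta> f \<in> bounded_measurable"
proof -
  obtain M where M: "\<And>x. \<bar>f x\<bar> \<le> M" using f by (metis bounded_measurable_bound)
  have "avg \<delta> f \<in> borel_measurable borel"
    by (rule borel_measurable_continuous_onI[OF continuous_avg[OF f \<delta>]])
  then show ?thesis using avg_bound[OF f _ \<delta>] M by (auto simp: bounded_measurable_iff measurable_completion)
qed

lemma bounded_measurable_avg_iterate:
  "f \<in> bounded_measurable \<Longrightarrow> 0 < \<delta> \<Longrightarrow> (avg \<delta> ^^ n) f \<in> bounded_measurable"
  by (induction n) (auto intro: bounded_measurable_avg)

lemma avg_iterate_fdiff:
  "f \<in> bounded_measurable \<Longrightarrow> 0 < \<delta> \<Longrightarrow> (avg \<delta> ^^ n) (fdiff h f) = fdiff h ((avg \<delta> ^^ n) f)"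
  by (induction n) (auto simp: avg_fdiff bounded_measurable_avg_iterate)

lemma avg_sum:
  assumes "\<And>i. i \<in> I \<Longrightarrow> f i \<in> bounded_measurable" "0 < \<delta>"
  shows "avg \<delta> (\<lambda>x. \<Sum>i\<in>I. f i x) = (\<lambda>x. \<Sum>i\<in>I. avg \<delta> (f i) x)"
  using assms(1)
proof (induction I rule: infinite_finite_induct)
  case (insert i I)
  then show ?case by (auto simp: avg_add bounded_measurable_sum fun_eq_iff)
qed (use assms(2) in \<open>auto simp: avg_const\<close>)

lemma avg_iterate_sum:
  assumes "\<And>i. i \<in> I \<Longrightarrow> f i \<in> bounded_measurable" "0 < \<delta>"
  shows "(avg \<delta> ^^ n) (\<lambda>x. \<Sum>i\<in>I. f i x) = (\<lambda>x. \<Sum>i\<in>I. (avg \<delta> ^^ n) (f i) x)"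
  by (induction n) (auto simp: avg_sum assms bounded_measurable_avg_iterate)

lemma avg_iterate_cmult: "(avg \<delta> ^^ n) (\<lambda>x. c * f x) = (\<lambda>x. c * (avg \<delta> ^^ n) f x)"
  by (induction n) (auto simp: avg_cmult)

text \<open>
  Averaging along \<open>c \<mapsto> x + \<kappa> c\<close> with step \<open>\<delta>\<close> is averaging in \<open>x\<close> with step \<open>\<kappa> \<delta>\<close>. This converts the integration
  variables of the Steklov average into translations of \<open>f\<close>.
\<close>

lemma avg_rescale:
  assumes f: "f \<in> bounded_measurable" and \<kappa>: "0 < \<kappa>" and \<delta>: "0 < \<delta>"
  shows "avg \<delta> (\<lambda>c. f (x + \<kappa> * c)) c = avg (\<kappa> * \<delta>) f (x + \<kappa> * c)"
proof -
  let ?a = "x + \<kappa> * c" and ?b = "x + \<kappa> * c + \<kappa> * \<delta>"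
  have "(f has_integral integral {?a..?b} f) (cbox ?a ?b)"
    using integrable_integral[OF integrable_bounded_measurable[OF f]] by simp
  from has_integral_affinity[OF this, of \<kappa> x]
  have "((\<lambda>c. f (\<kappa> * c + x)) has_integral integral {?a..?b} f / \<kappa>)
      ((\<lambda>z. (1 / \<kappa>) * z + - (x / \<kappa>)) ` {?a..?b})"
    using \<kappa> by simp
  also have "(\<lambda>z. (1 / \<kappa>) * z + - (x / \<kappa>)) ` {?a..?b} = {c..c + \<delta>}"
    using \<kappa> \<delta> by (subst image_affinity_atLeastAtMost) (auto simp: field_simps)
  finally have "integral {c..c + \<delta>} (\<lambda>c. f (x + \<kappa> * c)) = integral {?a..?b} f / \<kappa>"
    by (simp add: integral_unique add.commute)
  then show ?thesis
    using bounded_measurable_affine[OF f, of \<kappa> x] \<kappa> f by (simp add: avg_eq_integral)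
qed

lemma avg_iterate_rescale:
  assumes f: "f \<in> bounded_measurable" and \<kappa>: "0 < \<kappa>" and \<delta>: "0 < \<delta>"
  shows "(avg \<delta> ^^ n) (\<lambda>c. f (x + \<kappa> * c)) = (\<lambda>c. (avg (\<kappa> * \<delta>) ^^ n) f (x + \<kappa> * c))"
  by (induction n) (auto simp: avg_rescale \<kappa> \<delta> bounded_measurable_avg_iterate f)

text \<open>
  Each further integration variable adds to the same sum, so the iterated integral of a function of
  the sum is an iterate of one-dimensional averages.
\<close>

lemma iterated_integral_avg:
  assumes "0 < \<delta>"
  shows "iterated_integral n \<delta> (\<lambda>ts. \<psi> (c + sum_list ts)) = \<delta> ^ n * (avg \<delta> ^^ n) \<psi> c"
proof (induction n arbitrary: c)
  case (Suc n)
  have "iterated_integral (Suc n) \<delta> (\<lambda>ts. \<psi> (c + sum_list ts))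
      = (LINT t:{0..\<delta>}|lebesgue. iterated_integral n \<delta> (\<lambda>ts. \<psi> ((c + t) + sum_list ts)))"
    by (simp add: add.assoc)
  also have "\<dots> = (LINT t:{0..\<delta>}|lebesgue. \<delta> ^ n * (avg \<delta> ^^ n) \<psi> (c + t))"
    by (simp only: Suc.IH)
  also have "\<dots> = \<delta> ^ Suc n * avg \<delta> ((avg \<delta> ^^ n) \<psi>) c"
    using assms by (simp add: avg_def)
  finally show ?case by simp
qed simp

text \<open>
  Averages do not see null sets, at any point. Hence \<open>f\<close> can be replaced by a Borel representative
  without changing its Steklov average anywhere.
\<close>

lemma avg_cong_AE:
  assumes f: "f \<in> borel_measurable lebesgue" and g: "g \<in> borel_measurable lebesgue"
    and ae: "AE x in lebesgue. f x = g x"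
  shows "avg \<delta> f = avg \<delta> g"
proof
  fix x
  have [measurable]: "indicat_real {0..\<delta>} \<in> borel_measurable lebesgue"
    by (intro borel_measurable_indicator) auto
  have [measurable]: "(\<lambda>t. f (x + t)) \<in> borel_measurable lebesgue" "(\<lambda>t. g (x + t)) \<in> borel_measurable lebesgue"
    using borel_measurable_lebesgue_affine[OF f, of 1 x] borel_measurable_lebesgue_affine[OF g, of 1 x] by auto
  have "(LINT t:{0..\<delta>}|lebesgue. f (x + t)) = (LINT t:{0..\<delta>}|lebesgue. g (x + t))"
    unfolding set_lebesgue_integral_def
    using AE_lebesgue_affine[OF ae, of 1 x]
    by (intro integral_cong_AE borel_measurable_scaleR) (auto elim!: eventually_mono)
  then show "avg \<delta> f x = avg \<delta> g x" by (simp add: avg_def)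
qed

section \<open>Steklov averages as combinations of iterated averages\<close>

definition steklov_coeff :: "nat \<Rightarrow> nat \<Rightarrow> real" where
  "steklov_coeff r m = (-1) ^ r * ((-1) ^ (r - m + 1) * real (r choose m))"

lemma steklov_avg:
  assumes "0 < \<delta>"
  shows "steklov \<delta> r f x = (-1) ^ r * (avg \<delta> ^^ r)
    (\<lambda>c. \<Sum>m=1..r. (-1) ^ (r - m + 1) * real (r choose m) * f (x + real m / real r * c)) 0"
proof -
  have "1 / (- \<delta>) ^ r * \<delta> ^ r = (-1) ^ r"
    using assms by (cases "even r") (simp_all add: power_minus_even power_minus_odd)
  then have "1 / (- \<delta>) ^ r * (\<delta> ^ r * A) = (-1) ^ r * A" for A
    by (simp only: mult.assoc[symmetric])
  then show ?thesis
    using iterated_integral_avg[OF assms, of r "\<lambda>c. \<Sum>m=1..r. (-1) ^ (r - m + 1) * real (r choose m)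
        * f (x + real m / real r * c)" 0]
    unfolding steklov_def by (simp only: add_0)
qed

lemma steklov_eq_sum:
  assumes \<delta>: "0 < \<delta>" and f: "f \<in> bounded_measurable"
  shows "steklov \<delta> r f x = (\<Sum>m=1..r. steklov_coeff r m * (avg (real m / real r * \<delta>) ^^ r) f x)"
proof -
  have bm: "(\<lambda>c. f (x + real m / real r * c)) \<in> bounded_measurable" if "m \<in> {1..r}" for m
    using that by (intro bounded_measurable_affine f) auto
  have "steklov \<delta> r f x = (-1) ^ r * (\<Sum>m=1..r. (-1) ^ (r - m + 1) * real (r choose m)
      * (avg \<delta> ^^ r) (\<lambda>c. f (x + real m / real r * c)) 0)"
    unfolding steklov_avg[OF \<delta>]
    by (subst avg_iterate_sum[OF bounded_measurable_cmult[OF bm] \<delta>]) (simp_all only: avg_iterate_cmult)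
  also have "\<dots> = (\<Sum>m=1..r. steklov_coeff r m * (avg (real m / real r * \<delta>) ^^ r) f x)"
    unfolding sum_distrib_left steklov_coeff_def
  proof (intro sum.cong refl)
    fix m assume m: "m \<in> {1..r}"
    have "(avg \<delta> ^^ r) (\<lambda>c. f (x + real m / real r * c)) 0 = (avg (real m / real r * \<delta>) ^^ r) f x"
      by (subst avg_iterate_rescale[OF f _ \<delta>]) (use m in simp_all)
    then show "(- 1) ^ r * ((- 1) ^ (r - m + 1) * real (r choose m) * (avg \<delta> ^^ r) (\<lambda>c. f (x + real m / real r * c)) 0)
        = (- 1) ^ r * ((- 1) ^ (r - m + 1) * real (r choose m)) * (avg (real m / real r * \<delta>) ^^ r) f x"
      by (simp only: mult.assoc)
  qed
  finally show ?thesis .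
qed

text \<open>
  The sum in the Steklov average is the \<open>r\<close>-th difference with step \<open>c / r\<close>, where \<open>c\<close> is the sum of the
  integration variables, up to sign and up to the missing term \<open>m = 0\<close>, which is the constant \<open>f x\<close>.
\<close>

lemma steklov_minus_eq_avg_fin_diff:
  assumes \<delta>: "0 < \<delta>" and f: "f \<in> bounded_measurable" and r: "0 < r"
  shows "steklov \<delta> r f x - f x = - ((-1) ^ r) * (avg \<delta> ^^ r) (\<lambda>c. fin_diff r (c / real r) f x) 0"
proof -
  define S where "S c = (\<Sum>m=1..r. (-1) ^ (r - m + 1) * real (r choose m) * f (x + real m / real r * c))" for c
  have S: "S \<in> bounded_measurable"
    unfolding S_def using f r by (intro bounded_measurable_sum bounded_measurable_cmult bounded_measurable_affine) auto
  have fd: "fin_diff r (c / real r) f x = (-1) ^ r * f x - S c" for c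
  proof -
    have "fin_diff r (c / real r) f x = (-1) ^ r * f x
        + (\<Sum>k=1..r. real (r choose k) * (-1) ^ (r - k) * f (x + real k * (c / real r)))"
      unfolding fin_diff_def by (subst sum.atLeast_Suc_atMost) auto
    also have "(\<Sum>k=1..r. real (r choose k) * (-1) ^ (r - k) * f (x + real k * (c / real r))) = - S c"
      unfolding S_def sum_negf[symmetric] by (intro sum.cong) auto
    finally show ?thesis by simp
  qed
  have sub: "(avg \<delta> ^^ n) (\<lambda>c. a - S c) = (\<lambda>c. a - (avg \<delta> ^^ n) S c)" for n a
    by (induction n) (auto simp: avg_diff avg_const bounded_measurable_const
        bounded_measurable_avg_iterate S \<delta>)
  have "steklov \<delta> r f x = (-1) ^ r * (avg \<delta> ^^ r) S 0"
    using steklov_avg[OF \<delta>, of r f x] unfolding S_def .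
  moreover have "(- 1) ^ r * (- 1) ^ r = (1 :: real)" by (simp flip: power_mult_distrib)
  moreover have "- e * (e * y - A) = e * A - y" if "e * e = 1" for e A y :: real
  proof -
    have "- e * (e * y - A) = e * A - (e * e) * y" by (simp add: algebra_simps)
    then show ?thesis using that by simp
  qed
  ultimately show ?thesis unfolding fd sub by simp
qed

section \<open>Derivatives of averages\<close>

text \<open>
  The average is a difference quotient of an indefinite integral.
\<close>

lemma DERIV_avg:
  assumes f: "f \<in> bounded_measurable" and h: "0 < h" and a: "a < x"
    and d0: "((\<lambda>y. integral {a..y} f) has_real_derivative f x) (at x)"
    and dh: "((\<lambda>y. integral {a..y} f) has_real_derivative f (x + h)) (at (x + h))"
  shows "(avg h f has_real_derivative fdiff h f x / h) (at x)"
proof -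
  let ?I = "\<lambda>y. integral {a..y} f"
  have "((\<lambda>y. ?I (y + h)) has_real_derivative f (x + h)) (at x)"
    using dh DERIV_shift[of ?I "f (x + h)" x h] by blast
  then have "((\<lambda>y. (?I (y + h) - ?I y) / h) has_real_derivative (f (x + h) - f x) / h) (at x)"
    using d0 h by (intro DERIV_cdivide DERIV_diff)
  moreover have "eventually (\<lambda>y. y \<in> {a<..}) (nhds x)"
    using a by (intro eventually_nhds_in_open) auto
  then have "eventually (\<lambda>y. (?I (y + h) - ?I y) / h = avg h f y) (nhds x)"
  proof eventually_elim
    case (elim y)
    have "?I y + integral {y..y + h} f = ?I (y + h)"
      using elim h f by (intro Henstock_Kurzweil_Integration.integral_combine integrable_bounded_measurable) auto
    then show ?case by (simp add: avg_eq_integral[OF f] diff_eq_eq add.commute flip: eq_diff_eq)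
  qed
  ultimately show ?thesis
    using DERIV_cong_ev[of x x "\<lambda>y. (?I (y + h) - ?I y) / h" "avg h f"] by (simp add: fdiff_def)
qed

lemma DERIV_avg_continuous:
  assumes f: "f \<in> bounded_measurable" and h: "0 < h" and cont: "continuous_on UNIV f"
  shows "(avg h f has_real_derivative fdiff h f x / h) (at x)"
proof -
  have D: "((\<lambda>y. integral {x - 1..y} f) has_real_derivative f z) (at z)" if "x - 1 < z" for z
  proof -
    have "((\<lambda>y. integral {x - 1..y} f) has_real_derivative f z) (at z within {x - 1..z + 1})"
      by (rule integral_has_real_derivative) (use cont that in \<open>auto intro: continuous_on_subset\<close>)
    then show ?thesis using that by (simp add: at_within_Icc_at)
  qed
  show ?thesis by (rule DERIV_avg[OF f h, of "x - 1"]) (use D h in auto)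
qed

lemma DERIV_avg_AE:
  assumes f: "f \<in> bounded_measurable" and h: "0 < h"
  shows "AE x in lebesgue. (avg h f has_real_derivative fdiff h f x / h) (at x)"
proof -
  have *: "AE x in lebesgue. \<forall>a<x. ((\<lambda>y. integral {a..y} f) has_real_derivative f x) (at x)"
    by (rule lebesgue_differentiation) (rule integrable_bounded_measurable[OF f])
  from AE_lebesgue_affine[OF *, of 1 h]
  have "AE x in lebesgue. \<forall>a<h + x. ((\<lambda>y. integral {a..y} f) has_real_derivative f (h + x)) (at (h + x))"
    by simp
  with * show ?thesis
  proof eventually_elim
    case (elim x)
    show ?case by (rule DERIV_avg[OF f h, of "x - 1"]) (use elim h in \<open>auto simp: add.commute\<close>)
  qed
qed

text \<open>
  Differentiation removes one average and replaces it by a difference quotient. Two averages give a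
  continuous inner function, hence a derivative everywhere; a single one is differentiable only
  almost everywhere.
\<close>

lemma DERIV_avg_iterate:
  assumes f: "f \<in> bounded_measurable" and h: "0 < h"
  shows "0 < n \<Longrightarrow> ((avg h ^^ Suc n) f has_real_derivative (avg h ^^ n) (fdiff h f) x / h) (at x)"
    and "AE x in lebesgue. ((avg h ^^ Suc 0) f has_real_derivative fdiff h f x / h) (at x)"
proof -
  show "((avg h ^^ Suc n) f has_real_derivative (avg h ^^ n) (fdiff h f) x / h) (at x)" if "0 < n"
  proof -
    from gr0_implies_Suc[OF that] obtain k where k: "n = Suc k" ..
    have "continuous_on UNIV ((avg h ^^ n) f)"
      unfolding k using continuous_avg[OF bounded_measurable_avg_iterate[OF f h] h] by simp
    from DERIV_avg_continuous[OF bounded_measurable_avg_iterate[OF f h] h this]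
    show ?thesis by (simp add: avg_iterate_fdiff[OF f h])
  qed
  show "AE x in lebesgue. ((avg h ^^ Suc 0) f has_real_derivative fdiff h f x / h) (at x)"
    using DERIV_avg_AE[OF f h] by simp
qed

section \<open>Moduli of smoothness\<close>

lemma Lp_ball_fdiff:
  assumes "f \<in> Lp_ball p M" "1 \<le> p"
  shows "fdiff h f \<in> Lp_ball p (2 * M)"
  using Lp_ball_diff[OF Lp_ball_translate[OF assms(1), of h] assms(1)] assms(2)
  by (simp add: fdiff_def[abs_def])

lemma Lp_ball_fin_diff_iterate:
  assumes "fin_diff s h f \<in> Lp_ball p M" "1 \<le> p"
  shows "fin_diff (n + s) h f \<in> Lp_ball p (2 ^ n * M)"
proof (induction n)
  case (Suc n)
  then show ?case using Lp_ball_fdiff[OF Suc assms(2), of h] by (simp add: fin_diff_Suc mult.assoc)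
qed (use assms in simp)

lemma Lp_ball_fin_diff:
  assumes "f \<in> Lp_ball p M" "1 \<le> p"
  shows "fin_diff s h f \<in> Lp_ball p (2 ^ s * M)"
  using Lp_ball_fin_diff_iterate[of 0 h f p M s] assms by (simp add: fin_diff_funpow)

lemma bdd_above_fin_diff_norms:
  assumes "f \<in> Lp_space p" "1 \<le> p"
  shows "bdd_above ((\<lambda>h. Lp_norm p (fin_diff s h f)) ` A)"
  using Lp_ballD(2)[OF Lp_ball_fin_diff[OF Lp_ball_norm[OF assms(1)] assms(2)]]
  by (intro bdd_aboveI2)

lemma Lp_ball_fin_diff_modulus:
  assumes "f \<in> Lp_space p" "1 \<le> p" "0 < h" "h \<le> \<delta>"
  shows "fin_diff s h f \<in> Lp_ball p (modulus s p f \<delta>)"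
proof -
  have "Lp_norm p (fin_diff s h f) \<le> modulus s p f \<delta>"
    unfolding modulus_def using assms bdd_above_fin_diff_norms[OF assms(1,2)] by (intro cSUP_upper) auto
  then show ?thesis
    using Lp_ballD(1)[OF Lp_ball_fin_diff[OF Lp_ball_norm[OF assms(1)] assms(2)]] by (simp add: Lp_ball_def)
qed

lemma modulus_le:
  assumes "0 < \<delta>" "\<And>h. 0 < h \<Longrightarrow> h \<le> \<delta> \<Longrightarrow> fin_diff s h f \<in> Lp_ball p B"
  shows "modulus s p f \<delta> \<le> B"
  unfolding modulus_def using assms Lp_ballD(2) by (intro cSUP_least) auto

lemma modulus_nonneg:
  assumes "f \<in> Lp_space p" "1 \<le> p" "0 < \<delta>"
  shows "0 \<le> modulus s p f \<delta>"
  using Lp_ball_nonneg[OF Lp_ball_fin_diff_modulus[OF assms(1,2,3) order_refl]] .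

text \<open>
  Each additional difference at most doubles the norm.
\<close>

lemma modulus_le_lower_order:
  assumes "f \<in> Lp_space p" "1 \<le> p" "0 < \<delta>" "s \<le> r"
  shows "modulus r p f \<delta> \<le> 2 ^ (r - s) * modulus s p f \<delta>"
proof (rule modulus_le[OF assms(3)])
  fix h assume h: "0 < h" "h \<le> \<delta>"
  show "fin_diff r h f \<in> Lp_ball p (2 ^ (r - s) * modulus s p f \<delta>)"
    using Lp_ball_fin_diff_iterate[OF Lp_ball_fin_diff_modulus[OF assms(1,2) h, of s] assms(2), where n = "r - s"] assms(4)
    by simp
qed

lemma modulus_perturbation:
  assumes f: "f \<in> Lp_space p" and g: "g \<in> Lp_space p" and p: "1 \<le> p" and \<delta>: "0 < \<delta>"
  shows "modulus s p f \<delta> \<le> modulus s p g \<delta> + 2 ^ s * Lp_norm p (\<lambda>x. f x - g x)"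
proof (rule modulus_le[OF \<delta>])
  fix h assume h: "0 < h" "h \<le> \<delta>"
  have "(\<lambda>x. f x - g x) \<in> Lp_space p"
    using Lp_ballD(1)[OF Lp_ball_diff[OF Lp_ball_norm[OF f] Lp_ball_norm[OF g] p]] .
  then have "fin_diff s h (\<lambda>x. f x - g x) \<in> Lp_ball p (2 ^ s * Lp_norm p (\<lambda>x. f x - g x))"
    by (intro Lp_ball_fin_diff Lp_ball_norm p)
  from Lp_ball_add[OF Lp_ball_fin_diff_modulus[OF g p h, of s] this p]
  show "fin_diff s h f \<in> Lp_ball p (modulus s p g \<delta> + 2 ^ s * Lp_norm p (\<lambda>x. f x - g x))"
    by (simp add: fin_diff_diff)
qed

section \<open>Approximation by Steklov averages\<close>

lemma borel_representative:
  fixes f :: "real \<Rightarrow> real"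
  assumes "f \<in> borel_measurable lebesgue"
  obtains f0 where "f0 \<in> borel_measurable borel" "AE x in lebesgue. f x = f0 x"
  using completion_ex_borel_measurable_real[OF assms] by (auto intro: AE_completion)

lemma Lp_space_measurable: "f \<in> Lp_space p \<Longrightarrow> f \<in> borel_measurable lebesgue"
  by (simp add: Lp_space_def)

lemma Lp_ball_avg:
  assumes f: "f \<in> Lp_ball p M" and p: "1 \<le> p" and \<delta>: "0 < \<delta>"
  shows "avg \<delta> f \<in> Lp_ball p M"
proof -
  have m: "f \<in> borel_measurable lebesgue" using Lp_space_measurable Lp_ballD(1)[OF f] .
  obtain f0 where f0[measurable]: "f0 \<in> borel_measurable borel" and ae: "AE x in lebesgue. f x = f0 x"
    using borel_representative[OF m] .
  have "f0 \<in> Lp_ball p M" using Lp_ball_cong_AE[OF f ae] p by simp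
  then have "(\<lambda>x. f0 (x + t)) \<in> Lp_ball p M" for t using p by (intro Lp_ball_translate) auto
  moreover have "(\<lambda>(x, t). f0 (x + t)) \<in> borel_measurable (borel \<Otimes>\<^sub>M borel)" by measurable
  ultimately have "(\<lambda>x. 1 / \<delta> * (LINT t:{0..\<delta>}|lebesgue. f0 (x + t))) \<in> Lp_ball p M"
    using Lp_ball_parametric_average[OF \<delta> p, of "\<lambda>x t. f0 (x + t)" M] by simp
  then have "avg \<delta> f0 \<in> Lp_ball p M" by (simp add: avg_def[abs_def])
  then show ?thesis using avg_cong_AE[OF m _ ae] f0 by (simp add: measurable_completion)
qed

lemma Lp_ball_avg_iterate:
  assumes "f \<in> Lp_ball p M" "1 \<le> p" "0 < \<delta>"
  shows "(avg \<delta> ^^ n) f \<in> Lp_ball p M"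
  by (induction n) (use assms in \<open>auto intro: Lp_ball_avg\<close>)

text \<open>
  The averages act on the second argument of \<open>K\<close> while the norm is taken in the first one. An \<open>n\<close>-fold
  average at \<open>c\<close> uses the arguments between \<open>c\<close> and \<open>c + n \<delta>\<close>, so only these have to satisfy the bound.
\<close>

lemma parametric_avg_iterate:
  fixes K :: "real \<Rightarrow> real \<Rightarrow> real"
  assumes \<delta>: "0 < \<delta>" and p: "1 \<le> p"
    and K: "case_prod K \<in> borel_measurable (borel \<Otimes>\<^sub>M borel)"
    and M: "\<And>c. 0 \<le> c \<Longrightarrow> c \<le> L \<Longrightarrow> (\<lambda>x. K x c) \<in> Lp_ball p M"
  shows "case_prod (\<lambda>x. (avg \<delta> ^^ n) (K x)) \<in> borel_measurable (borel \<Otimes>\<^sub>M borel)"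
    and "0 \<le> c \<Longrightarrow> c + real n * \<delta> \<le> L \<Longrightarrow> (\<lambda>x. (avg \<delta> ^^ n) (K x) c) \<in> Lp_ball p M"
proof (induction n arbitrary: c)
  case 0
  { case 1 show ?case using K by simp }
  { case 2 then show ?case using M by simp }
next
  case (Suc n)
  define H where "H = (\<lambda>x. (avg \<delta> ^^ n) (K x))"
  have H: "case_prod H \<in> borel_measurable (borel \<Otimes>\<^sub>M borel)" unfolding H_def by (rule Suc(1))
  have Hc: "(\<lambda>z. H (fst (fst z)) (snd (fst z) + snd z)) \<in> borel_measurable ((borel \<Otimes>\<^sub>M borel) \<Otimes>\<^sub>M borel)"
    using measurable_compose[OF _ H, of "\<lambda>z. (fst (fst z), snd (fst z) + snd z)" "(borel \<Otimes>\<^sub>M borel) \<Otimes>\<^sub>M borel"]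
    by simp
  have Hx: "H x \<in> borel_measurable borel" for x
    using measurable_compose[OF measurable_Pair1' H, of x] by simp
  have eq: "(avg \<delta> ^^ Suc n) (K x) c = 1 / \<delta> * (LINT t:{0..\<delta>}|lebesgue. H x (c + t))" for x c
    by (simp add: H_def avg_def)
  { case 1
    have "(\<lambda>z. \<integral>t. indicator {0..\<delta>} t *\<^sub>R H (fst z) (snd z + t) \<partial>lborel) \<in> borel_measurable (borel \<Otimes>\<^sub>M borel)"
      by (rule lborel.borel_measurable_lebesgue_integral)
        (use Hc in \<open>simp add: case_prod_beta' cong: measurable_cong_sets\<close>)
    then have "(\<lambda>z. 1 / \<delta> * (LINT t:{0..\<delta>}|lborel. H (fst z) (snd z + t))) \<in> borel_measurable (borel \<Otimes>\<^sub>M borel)"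
      unfolding set_lebesgue_integral_def by simp
    moreover have "(LINT t:{0..\<delta>}|lebesgue. H x (c + t)) = (LINT t:{0..\<delta>}|lborel. H x (c + t))" for x c
      by (rule set_integral_lebesgue_borel) (use Hx[of x] in measurable)
    ultimately show ?case unfolding case_prod_beta' eq by simp
  }
  { case 2
    have "(\<lambda>x. 1 / \<delta> * (LINT t:{0..\<delta>}|lebesgue. H x (c + t))) \<in> Lp_ball p M"
    proof (rule Lp_ball_parametric_average[OF \<delta> p])
      show "(\<lambda>(x, t). H x (c + t)) \<in> borel_measurable (borel \<Otimes>\<^sub>M borel)"
        using measurable_compose[OF _ H, of "\<lambda>z. (fst z, c + snd z)" "borel \<Otimes>\<^sub>M borel"]
        by (simp add: case_prod_beta')
      show "(\<lambda>x. H x (c + t)) \<in> Lp_ball p M" if "0 \<le> t" "t \<le> \<delta>" for t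
        unfolding H_def using that 2 by (intro Suc(2)) (auto simp: algebra_simps)
    qed
    then show ?case by (simp only: eq)
  }
qed

text \<open>
  By \<open>steklov_minus_eq_avg_fin_diff\<close>, \<open>g - f\<close> is up to sign an average over \<open>0 \<le> c \<le> r \<delta>\<close> of the
  \<open>r\<close>-th differences of \<open>f\<close> with step \<open>c / r \<le> \<delta>\<close>, all of which are bounded by the modulus.
\<close>

lemma Lp_ball_steklov_minus:
  assumes f: "f \<in> bounded_measurable" "f \<in> Lp_space p" and p: "1 \<le> p" and \<delta>: "0 < \<delta>" and r: "0 < r"
  shows "(\<lambda>x. steklov \<delta> r f x - f x) \<in> Lp_ball p (modulus r p f \<delta>)"
proof -
  let ?M = "modulus r p f \<delta>"
  have p0: "0 < p" using p by simp
  have M0: "0 \<le> ?M" using modulus_nonneg[OF f(2) p \<delta>] .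
  have m: "f \<in> borel_measurable lebesgue" using Lp_space_measurable f(2) .
  obtain f0 where f0[measurable]: "f0 \<in> borel_measurable borel" and ae: "AE x in lebesgue. f x = f0 x"
    using borel_representative[OF m] .
  have m0: "f0 \<in> borel_measurable lebesgue" using f0 by (simp add: measurable_completion)
  \<comment> \<open>Tonelli's theorem needs the Borel representative.\<close>
  define K where "K x c = fin_diff r (c / real r) f0 x" for x c
  have Kball: "(\<lambda>x. K x c) \<in> Lp_ball p ?M" if c: "0 \<le> c" "c \<le> real r * \<delta>" for c
  proof (cases "c = 0")
    case True
    then show ?thesis using r M0 p0 by (simp add: K_def fin_diff_zero_step Lp_ball_iff)
  next
    case False
    then have "fin_diff r (c / real r) f \<in> Lp_ball p ?M"
      using c r by (intro Lp_ball_fin_diff_modulus f p) (auto simp: field_simps)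
    moreover have "AE x in lebesgue. fin_diff r (c / real r) f x = fin_diff r (c / real r) f0 x"
    proof -
      have "AE x in lebesgue. \<forall>k\<in>{0..r}. f (x + real k * (c / real r)) = f0 (x + real k * (c / real r))"
      proof (rule AE_finite_allI)
        show "AE x in lebesgue. f (x + real k * (c / real r)) = f0 (x + real k * (c / real r))" for k
          using AE_lebesgue_affine[OF ae, of 1 "real k * (c / real r)"] by (simp add: add.commute)
      qed simp
      then show ?thesis by eventually_elim (auto simp: fin_diff_def intro!: sum.cong)
    qed
    ultimately show ?thesis unfolding K_def by (rule Lp_ball_cong_AE[OF _ _ p0])
  qed
  have "case_prod K \<in> borel_measurable (borel \<Otimes>\<^sub>M borel)"
    unfolding K_def[abs_def] fin_diff_def case_prod_beta' by measurable
  from parametric_avg_iterate(2)[OF \<delta> p this Kball, where n = r and c = 0]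
  have "(\<lambda>x. (avg \<delta> ^^ r) (K x) 0) \<in> Lp_ball p ?M" by simp
  then have "(\<lambda>x. - ((-1) ^ r) * (avg \<delta> ^^ r) (K x) 0) \<in> Lp_ball p ?M"
    using Lp_ball_cmult[OF _ p0, of _ ?M "- ((-1) ^ r)"] by (simp add: power_abs)
  moreover have "AE x in lebesgue. - ((-1) ^ r) * (avg \<delta> ^^ r) (K x) 0 = steklov \<delta> r f x - f x"
    using ae
  proof eventually_elim
    case (elim x)
    have "AE c in lebesgue. \<forall>k\<in>{1..r}. f (x + real k / real r * c) = f0 (x + real k / real r * c)"
    proof (rule AE_finite_allI)
      fix k assume "k \<in> {1..r}"
      then show "AE c in lebesgue. f (x + real k / real r * c) = f0 (x + real k / real r * c)"
        by (intro AE_lebesgue_affine[OF ae]) auto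
    qed simp
    \<comment> \<open>The term \<open>k = 0\<close> does not move with \<open>c\<close>, so it has to agree at the point \<open>x\<close> itself.\<close>
    then have ae': "AE c in lebesgue. fin_diff r (c / real r) f x = K x c"
    proof eventually_elim
      case (elim c)
      have "f (x + real k * (c / real r)) = f0 (x + real k * (c / real r))" if "k \<in> {0..r}" for k
        using elim that \<open>f x = f0 x\<close> by (cases "k = 0") (auto dest: bspec[where x = k])
      then show ?case unfolding K_def fin_diff_def by (auto intro!: sum.cong)
    qed
    have meas: "(\<lambda>c. fin_diff r (c / real r) g x) \<in> borel_measurable lebesgue"
      if "g \<in> borel_measurable lebesgue" for g
    proof -
      have "(\<lambda>c. g (x + real k * (c / real r))) \<in> borel_measurable lebesgue" for k
        using borel_measurable_lebesgue_affine[OF that, of "real k / real r" x] r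
        by (cases "k = 0") auto
      then show ?thesis unfolding fin_diff_def by measurable
    qed
    have "avg \<delta> (\<lambda>c. fin_diff r (c / real r) f x) = avg \<delta> (K x)"
      using avg_cong_AE[OF meas[OF m] _ ae'] meas[OF m0] by (simp add: K_def[abs_def])
    moreover obtain n where n: "r = Suc n" using gr0_implies_Suc[OF r] by blast
    have "(avg \<delta> ^^ r) g = (avg \<delta> ^^ n) (avg \<delta> g)" for g
      by (simp only: n funpow_Suc_right comp_def)
    ultimately have "(avg \<delta> ^^ r) (\<lambda>c. fin_diff r (c / real r) f x) = (avg \<delta> ^^ r) (K x)"
      by simp
    then show ?case using steklov_minus_eq_avg_fin_diff[OF \<delta> f(1) r, of x] by simp
  qed
  ultimately show ?thesis by (rule Lp_ball_cong_AE[OF _ _ p0])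
qed

section \<open>Sobolev functions\<close>

lemma DERIV_fin_diff:
  assumes "\<And>x. (g has_real_derivative g' x) (at x)"
  shows "(fin_diff s h g has_real_derivative fin_diff s h g' x) (at x)"
proof (induction s arbitrary: x)
  case 0
  show ?case using assms by (simp add: fin_diff_funpow)
next
  case (Suc s)
  have "((\<lambda>x. fin_diff s h g (x + h)) has_real_derivative fin_diff s h g' (x + h)) (at x)"
    using Suc[of "x + h"] DERIV_shift by blast
  then show ?case
    unfolding fin_diff_Suc fdiff_def[abs_def] by (intro DERIV_diff Suc)
qed

lemma continuous_on_fin_diff:
  assumes "continuous_on UNIV g"
  shows "continuous_on UNIV (fin_diff s h g)"
proof (induction s)
  case (Suc s)
  have "continuous_on UNIV (\<lambda>x. fin_diff s h g (x + h))"
    by (rule continuous_on_compose2[OF Suc]) (auto intro: continuous_intros)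
  then show ?case unfolding fin_diff_Suc fdiff_def[abs_def] by (intro continuous_on_diff Suc)
qed (use assms in \<open>simp add: fin_diff_funpow\<close>)

lemma locally_abs_continuous_imp_continuous_on:
  assumes "locally_abs_continuous g"
  shows "continuous_on UNIV g"
proof -
  have "continuous_on {x - 1<..<x + 1} g" for x
    by (rule continuous_on_subset[OF abs_continuous_imp_continuous_on[of "x - 1" "x + 1"]])
      (use assms in \<open>auto simp: locally_abs_continuous_def\<close>)
  then have "isCont g x" for x
    using continuous_on_eq_continuous_at[of "{x - 1<..<x + 1}" g] by auto
  then show ?thesis by (simp add: continuous_on_eq_continuous_at)
qed

text \<open>
  A first difference with step \<open>h\<close> is \<open>h\<close> times an average of the derivative.
\<close>

lemma Lp_ball_fdiff_of_integral:
  assumes w: "w \<in> Lp_ball p M" and p: "1 \<le> p" and h: "0 < h"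
    and int: "\<And>x. w absolutely_integrable_on {x..x + h}" "\<And>x. integral {x..x + h} w = g (x + h) - g x"
  shows "fdiff h g \<in> Lp_ball p (h * M)"
proof -
  have "fdiff h g = (\<lambda>x. h * avg h w x)"
    using h by (simp add: fun_eq_iff fdiff_def int avg_eq_integral_of_absolutely_integrable)
  then show ?thesis using Lp_ball_cmult[OF Lp_ball_avg[OF w p h], of h] p h by simp
qed

text \<open>
  Each difference is traded for a derivative and a factor \<open>h\<close>. As long as derivatives of order at
  least two remain, the ordinary fundamental theorem applies; the last step is the one for
  absolutely continuous functions.
\<close>

lemma fin_diff_bound_of_derivative:
  assumes "\<forall>j. j + 1 < Suc n \<longrightarrow> (\<forall>x. (deriv ^^ j) g field_differentiable at x)"
    and "\<forall>j<Suc n. locally_abs_continuous ((deriv ^^ j) g)"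
    and "(deriv ^^ Suc n) g \<in> Lp_ball p M" and p: "1 \<le> p" and h: "0 < h"
  shows "fin_diff (Suc n) h g \<in> Lp_ball p (h ^ Suc n * M)"
  using assms(1-3)
proof (induction n arbitrary: g)
  case 0
  then have "locally_abs_continuous g" "deriv g \<in> Lp_ball p M" by auto
  then have "fdiff h g \<in> Lp_ball p (h * M)"
    using locally_abs_continuous_fundamental_theorem[of g] h by (intro Lp_ball_fdiff_of_integral p h) auto
  then show ?case by (simp add: fin_diff_funpow)
next
  case (Suc n)
  define g' where "g' = deriv g"
  have shift: "(deriv ^^ j) g' = (deriv ^^ Suc j) g" for j
    unfolding g'_def by (simp add: funpow_swap1)
  have IH: "fin_diff (Suc n) h g' \<in> Lp_ball p (h ^ Suc n * M)"
  proof (rule Suc.IH)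
    show "\<forall>j. j + 1 < Suc n \<longrightarrow> (\<forall>x. (deriv ^^ j) g' field_differentiable at x)"
      unfolding shift
    proof (intro allI impI)
      fix j x assume "j + 1 < Suc n"
      then have "Suc j + 1 < Suc (Suc n)" by simp
      then show "(deriv ^^ Suc j) g field_differentiable at x" using Suc.prems(1) by blast
    qed
    show "\<forall>j<Suc n. locally_abs_continuous ((deriv ^^ j) g')"
      unfolding shift using Suc.prems(2) by blast
    show "(deriv ^^ Suc n) g' \<in> Lp_ball p M" unfolding shift by (rule Suc.prems(3))
  qed
  have "(g has_real_derivative g' x) (at x)" for x
    using Suc.prems(1)[rule_format, of 0 x] by (simp add: g'_def DERIV_deriv_iff_field_differentiable)
  then have D: "(fin_diff (Suc n) h g has_real_derivative fin_diff (Suc n) h g' x) (at x)" for x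
    by (rule DERIV_fin_diff)
  have "continuous_on UNIV g'"
    using locally_abs_continuous_imp_continuous_on Suc.prems(2)[rule_format, of 1] by (simp add: g'_def)
  then have cont: "continuous_on S (fin_diff (Suc n) h g')" for S
    by (rule continuous_on_subset[OF continuous_on_fin_diff subset_UNIV])
  have "fdiff h (fin_diff (Suc n) h g) \<in> Lp_ball p (h * (h ^ Suc n * M))"
  proof (rule Lp_ball_fdiff_of_integral[OF IH p h])
    fix x
    show "fin_diff (Suc n) h g' absolutely_integrable_on {x..x + h}"
      by (rule absolutely_integrable_continuous_real[OF cont])
    show "integral {x..x + h} (fin_diff (Suc n) h g') = fin_diff (Suc n) h g (x + h) - fin_diff (Suc n) h g x"
      using D h by (intro integral_unique fundamental_theorem_of_calculus)
        (auto simp flip: has_real_derivative_iff_has_vector_derivative intro: has_field_derivative_at_within)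
  qed
  then show ?case by (simp add: fin_diff_Suc[of "Suc n"] mult.assoc)
qed

lemma modulus_le_sobolev:
  assumes g: "g \<in> sobolev s p" and p: "1 \<le> p" and \<delta>: "0 < \<delta>" and s: "1 \<le> s"
  shows "modulus s p g \<delta> \<le> \<delta> ^ s * Lp_norm p ((deriv ^^ s) g)"
proof (rule modulus_le[OF \<delta>])
  fix h assume h: "0 < h" "h \<le> \<delta>"
  obtain n where n: "s = Suc n" using s by (cases s) auto
  have "fin_diff s h g \<in> Lp_ball p (h ^ s * Lp_norm p ((deriv ^^ s) g))"
    unfolding n using g p h(1)
    by (intro fin_diff_bound_of_derivative Lp_ball_norm) (auto simp: sobolev_def n)
  moreover have "h ^ s * Lp_norm p ((deriv ^^ s) g) \<le> \<delta> ^ s * Lp_norm p ((deriv ^^ s) g)"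
    using h by (intro mult_right_mono power_mono Lp_norm_nonneg) auto
  ultimately show "fin_diff s h g \<in> Lp_ball p (\<delta> ^ s * Lp_norm p ((deriv ^^ s) g))"
    by (rule Lp_ball_mono)
qed

lemma locally_abs_continuous_of_lipschitz:
  assumes "\<And>x y. \<bar>g y - g x\<bar> \<le> C * \<bar>y - x\<bar>"
  shows "locally_abs_continuous g"
  unfolding locally_abs_continuous_def abs_continuous_on_interval_iff
proof (intro allI impI)
  fix a b \<epsilon> :: real assume e: "\<epsilon> > 0"
  define C' where "C' = \<bar>C\<bar> + 1"
  have C': "C' > 0" by (simp add: C'_def)
  show "\<exists>\<delta>>0. \<forall>D. interval_family a b D \<longrightarrow> total_length D < \<delta> \<longrightarrow> increments g D < \<epsilon>"
  proof (intro exI conjI allI impI)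
    show "\<epsilon> / C' > 0" using e C' by simp
    fix D assume D: "interval_family a b D" "total_length D < \<epsilon> / C'"
    have "increments g D \<le> (\<Sum>(u, v)\<in>D. C' * (v - u))"
    proof (rule sum_mono, clarify)
      fix u v assume "(u, v) \<in> D"
      then have "u \<le> v" using D(1) by (auto simp: interval_family_def)
      have "\<bar>g v - g u\<bar> \<le> C * \<bar>v - u\<bar>" by (rule assms)
      also have "\<dots> \<le> C' * \<bar>v - u\<bar>" unfolding C'_def by (intro mult_right_mono) auto
      finally show "\<bar>g v - g u\<bar> \<le> C' * (v - u)" using \<open>u \<le> v\<close> by simp
    qed
    also have "\<dots> = C' * total_length D" by (simp add: sum_distrib_left case_prod_beta)
    also have "\<dots> < \<epsilon>" using D(2) C' by (simp add: field_simps)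
    finally show "increments g D < \<epsilon>" .
  qed
qed

text \<open>
  Put \<open>h\<^sub>m = m \<delta> / r\<close>. The \<open>j\<close>-th derivative is the function \<open>w j\<close> below, a combination of \<open>(r - j)\<close>-fold
  averages of \<open>j\<close>-th differences of \<open>f\<close> with steps \<open>h\<^sub>m \<le> \<delta>\<close>, divided by the \<open>j\<close>-th power of \<open>h\<^sub>m\<close>. For
  \<open>j < r\<close> at least one average is left, so that \<open>w j\<close> is Lipschitz; the step to \<open>j = r\<close> holds almost everywhere.
\<close>

lemma steklov_sobolev:
  assumes f: "f \<in> bounded_measurable" "f \<in> Lp_space p" and p: "1 \<le> p" and \<delta>: "0 < \<delta>"
    and s: "1 \<le> s" "s \<le> r"
  shows "steklov \<delta> r f \<in> sobolev s p"
    and "Lp_norm p ((deriv ^^ s) (steklov \<delta> r f))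
      \<le> (\<Sum>m=1..r. \<bar>steklov_coeff r m\<bar> * (real r / real m) ^ s) * \<delta> powr (- real s) * modulus s p f \<delta>"
proof -
  define h where "h m = real m / real r * \<delta>" for m
  have h0: "0 < h m" if "m \<in> {1..r}" for m using that \<delta> by (auto simp: h_def)
  define w where "w j x = (\<Sum>m=1..r. steklov_coeff r m *
      ((avg (h m) ^^ (r - j)) ((fdiff (h m) ^^ j) f) x / h m ^ j))" for j x
  have bm: "(fdiff (h m) ^^ j) f \<in> bounded_measurable" for m j
    by (rule bounded_measurable_fdiff_iterate[OF f(1)])
  have w0: "steklov \<delta> r f = w 0"
    by (simp add: fun_eq_iff w_def steklov_eq_sum[OF \<delta> f(1)] h_def)
  have Dw: "(w j has_real_derivative w (Suc j) x) (at x)" if "Suc j < r" for j x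
  proof -
    have e: "r - j = Suc (r - Suc j)" "0 < r - Suc j" using that by auto
    have "((avg (h m) ^^ (r - j)) ((fdiff (h m) ^^ j) f) has_real_derivative
        (avg (h m) ^^ (r - Suc j)) ((fdiff (h m) ^^ Suc j) f) x / h m) (at x)" if "m \<in> {1..r}" for m
      using DERIV_avg_iterate(1)[OF bm h0[OF that] e(2)] unfolding e(1) by simp
    then show ?thesis unfolding w_def[abs_def]
      by (intro DERIV_sum DERIV_cmult) (auto intro!: DERIV_cdivide[THEN DERIV_cong])
  qed
  have DwAE: "AE x in lebesgue. (w (r - 1) has_real_derivative w r x) (at x)"
  proof -
    have e: "r - (r - 1) = Suc 0" "r = Suc (r - 1)" using s by auto
    have "AE x in lebesgue. \<forall>m\<in>{1..r}. ((avg (h m) ^^ (r - (r - 1))) ((fdiff (h m) ^^ (r - 1)) f) has_real_derivative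
        (fdiff (h m) ^^ r) f x / h m) (at x)"
    proof (rule AE_finite_allI)
      fix m assume m: "m \<in> {1..r}"
      have "fdiff (h m) ((fdiff (h m) ^^ (r - 1)) f) = (fdiff (h m) ^^ r) f" by (subst (2) e(2)) simp
      then show "AE x in lebesgue. ((avg (h m) ^^ (r - (r - 1))) ((fdiff (h m) ^^ (r - 1)) f) has_real_derivative
        (fdiff (h m) ^^ r) f x / h m) (at x)"
        using DERIV_avg_iterate(2)[OF bm[of "r - 1" m] h0[OF m]] unfolding e(1) by simp
    qed simp
    then show ?thesis
    proof eventually_elim
      case (elim x)
      have "h m ^ r = h m * h m ^ (r - 1)" for m by (subst e(2)) simp
      then show ?case unfolding w_def[abs_def]
        using elim by (intro DERIV_sum DERIV_cmult) (auto intro!: DERIV_cdivide[THEN DERIV_cong])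
    qed
  qed
  have lac: "locally_abs_continuous (w j)" if "j < r" for j
  proof -
    have "\<exists>C. \<forall>x y. \<bar>(avg (h m) ^^ (r - j)) ((fdiff (h m) ^^ j) f) y - (avg (h m) ^^ (r - j)) ((fdiff (h m) ^^ j) f) x\<bar> \<le> C * \<bar>y - x\<bar>"
      if m: "m \<in> {1..r}" for m
    proof -
      have e: "r - j = Suc (r - Suc j)" using \<open>j < r\<close> by auto
      let ?u = "(avg (h m) ^^ (r - Suc j)) ((fdiff (h m) ^^ j) f)"
      have u: "?u \<in> bounded_measurable" by (rule bounded_measurable_avg_iterate[OF bm h0[OF m]])
      then obtain M where "\<And>x. \<bar>?u x\<bar> \<le> M" by (metis bounded_measurable_bound)
      from avg_lipschitz[OF u h0[OF m] this]
      show ?thesis unfolding e funpow.simps comp_def by blast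
    qed
    then obtain C where C: "\<And>m x y. m \<in> {1..r} \<Longrightarrow> \<bar>(avg (h m) ^^ (r - j)) ((fdiff (h m) ^^ j) f) y
        - (avg (h m) ^^ (r - j)) ((fdiff (h m) ^^ j) f) x\<bar> \<le> C m * \<bar>y - x\<bar>" by metis
    have "\<bar>w j y - w j x\<bar> \<le> (\<Sum>m=1..r. \<bar>steklov_coeff r m\<bar> * (C m / h m ^ j)) * \<bar>y - x\<bar>" for x y
    proof -
      have "\<bar>w j y - w j x\<bar> \<le> (\<Sum>m=1..r. \<bar>steklov_coeff r m * ((avg (h m) ^^ (r - j)) ((fdiff (h m) ^^ j) f) y / h m ^ j)
          - steklov_coeff r m * ((avg (h m) ^^ (r - j)) ((fdiff (h m) ^^ j) f) x / h m ^ j)\<bar>)"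
        unfolding w_def sum_subtractf[symmetric] by (rule sum_abs)
      also have "\<dots> \<le> (\<Sum>m=1..r. \<bar>steklov_coeff r m\<bar> * (C m / h m ^ j) * \<bar>y - x\<bar>)"
      proof (rule sum_mono)
        fix m assume m: "m \<in> {1..r}"
        have "\<bar>((avg (h m) ^^ (r - j)) ((fdiff (h m) ^^ j) f) y
            - (avg (h m) ^^ (r - j)) ((fdiff (h m) ^^ j) f) x) / h m ^ j\<bar> \<le> C m * \<bar>y - x\<bar> / h m ^ j"
          using C[OF m, of y x] h0[OF m] by (simp add: divide_right_mono)
        then have "\<bar>steklov_coeff r m\<bar> * \<bar>((avg (h m) ^^ (r - j)) ((fdiff (h m) ^^ j) f) y
            - (avg (h m) ^^ (r - j)) ((fdiff (h m) ^^ j) f) x) / h m ^ j\<bar> \<le> \<bar>steklov_coeff r m\<bar> * (C m * \<bar>y - x\<bar> / h m ^ j)"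
          by (intro mult_left_mono) auto
        then show "\<bar>steklov_coeff r m * ((avg (h m) ^^ (r - j)) ((fdiff (h m) ^^ j) f) y / h m ^ j)
          - steklov_coeff r m * ((avg (h m) ^^ (r - j)) ((fdiff (h m) ^^ j) f) x / h m ^ j)\<bar>
          \<le> \<bar>steklov_coeff r m\<bar> * (C m / h m ^ j) * \<bar>y - x\<bar>"
          by (simp add: abs_mult[symmetric] right_diff_distrib diff_divide_distrib mult_ac)
      qed
      finally show ?thesis by (simp only: sum_distrib_right)
    qed
    then show ?thesis by (rule locally_abs_continuous_of_lipschitz)
  qed
  have derw: "(deriv ^^ j) (w 0) = w j" if "j < r" for j
    using that
  proof (induction j)
    case (Suc j)
    then have "(deriv ^^ Suc j) (w 0) = deriv (w j)" by simp
    also have "\<dots> = w (Suc j)" using Dw[OF Suc.prems] by (intro ext DERIV_imp_deriv)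
    finally show ?case .
  qed simp
  have derAE: "AE x in lebesgue. w s x = (deriv ^^ s) (w 0) x"
  proof (cases "s < r")
    case True
    then show ?thesis by (simp add: derw)
  next
    case False
    then have sr: "s = r" using s by simp
    have "(deriv ^^ r) (w 0) = deriv (w (r - 1))"
      using derw[of "r - 1"] s by (cases r) auto
    then show ?thesis unfolding sr using DwAE by (auto elim!: eventually_mono dest: DERIV_imp_deriv)
  qed
  let ?N = "\<Sum>m=1..r. \<bar>steklov_coeff r m\<bar> * (modulus s p f \<delta> / h m ^ s)"
  have "w s \<in> Lp_ball p ?N"
    unfolding w_def[abs_def]
  proof (rule Lp_ball_sum)
    fix m assume m: "m \<in> {1..r}"
    have "h m \<le> \<delta>" using m \<delta> by (auto simp: h_def field_simps)
    then have "(fdiff (h m) ^^ s) f \<in> Lp_ball p (modulus s p f \<delta>)"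
      using Lp_ball_fin_diff_modulus[OF f(2) p h0[OF m]] by (simp add: fin_diff_funpow)
    then have "(avg (h m) ^^ (r - s)) ((fdiff (h m) ^^ s) f) \<in> Lp_ball p (modulus s p f \<delta>)"
      by (rule Lp_ball_avg_iterate[OF _ p h0[OF m]])
    from Lp_ball_cmult[OF this, of "steklov_coeff r m / h m ^ s"]
    show "(\<lambda>x. steklov_coeff r m * ((avg (h m) ^^ (r - s)) ((fdiff (h m) ^^ s) f) x / h m ^ s))
        \<in> Lp_ball p (\<bar>steklov_coeff r m\<bar> * (modulus s p f \<delta> / h m ^ s))"
      using p h0[OF m] by simp
  qed (use p in auto)
  then have ds: "(deriv ^^ s) (w 0) \<in> Lp_ball p ?N" by (rule Lp_ball_cong_AE[OF _ derAE]) (use p in simp)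
  have wLp: "w 0 \<in> Lp_space p"
  proof -
    have "(\<lambda>x. steklov \<delta> r f x - f x + f x) \<in> Lp_ball p (modulus r p f \<delta> + Lp_norm p f)"
      using s by (intro Lp_ball_add Lp_ball_steklov_minus f p \<delta> Lp_ball_norm) auto
    then show ?thesis using Lp_ballD(1) w0 by fastforce
  qed
  show "steklov \<delta> r f \<in> sobolev s p"
    unfolding sobolev_def w0
  proof (intro CollectI conjI allI impI)
    fix j x assume "j + 1 < s"
    then have "Suc j < r" using s by simp
    from Dw[OF this] show "(deriv ^^ j) (w 0) field_differentiable at x"
      using \<open>Suc j < r\<close> by (auto simp: derw field_differentiable_def)
  next
    fix j assume "j < s"
    then show "locally_abs_continuous ((deriv ^^ j) (w 0))" using s by (simp add: derw lac)
  qed (use wLp Lp_ballD(1)[OF ds] in auto)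
  have "?N = (\<Sum>m=1..r. \<bar>steklov_coeff r m\<bar> * (real r / real m) ^ s) * \<delta> powr (- real s) * modulus s p f \<delta>"
    unfolding sum_distrib_right
  proof (intro sum.cong refl)
    fix m assume "m \<in> {1..r}"
    then show "\<bar>steklov_coeff r m\<bar> * (modulus s p f \<delta> / h m ^ s)
        = \<bar>steklov_coeff r m\<bar> * (real r / real m) ^ s * \<delta> powr (- real s) * modulus s p f \<delta>"
      using \<delta> by (simp add: h_def powr_minus powr_realpow power_mult_distrib power_divide field_simps)
  qed
  then show "Lp_norm p ((deriv ^^ s) (steklov \<delta> r f))
      \<le> (\<Sum>m=1..r. \<bar>steklov_coeff r m\<bar> * (real r / real m) ^ s) * \<delta> powr (- real s) * modulus s p f \<delta>"
    unfolding w0 using Lp_ballD(2)[OF ds] by simp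
qed

section \<open>The space of functions summable over admissible nodes\<close>

lemma admissible_gaps:
  assumes "admissible x"
  obtains m M where "0 < m" "\<And>j. m \<le> x j - x (j - 1)" "\<And>j. x j - x (j - 1) \<le> M"
proof -
  obtain M where "\<And>j. x j - x (j - 1) \<le> M"
    using assms by (auto simp: admissible_def bdd_above_def)
  moreover have "(INF j. x j - x (j - 1)) \<le> x j - x (j - 1)" for j
    using assms by (intro cINF_lower) (auto simp: admissible_def)
  ultimately show thesis using assms that unfolding admissible_def by blast
qed

lemma admissibleI:
  assumes "0 < m" "\<And>j. m \<le> x j - x (j - 1)" "\<And>j. x j - x (j - 1) \<le> M"
  shows "admissible x"
proof -
  have "m \<le> (INF j. x j - x (j - 1))" by (rule cINF_greatest) (use assms in auto)
  then show ?thesis unfolding admissible_def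
    using assms by (auto intro!: bdd_belowI2[where m = m] bdd_aboveI2[where M = M])
qed

text \<open>
  The points \<open>y j\<close> need not be increasing. But if \<open>q\<close> is large enough for \<open>q\<close> gaps of \<open>x\<close> to exceed \<open>L + 1\<close>,
  then along each residue class of \<open>j\<close> modulo \<open>q\<close> they form an admissible sequence with gaps at least
  1, which drop out of the weighted sum.
\<close>

lemma summable_near_nodes:
  assumes f: "f \<in> Lambda_space p" and x: "admissible x"
    and y: "\<And>j. x j \<le> y j" "\<And>j. y j \<le> x j + L"
  shows "(\<lambda>j. \<bar>f (y j)\<bar> powr p) summable_on UNIV"
proof -
  obtain m M where m: "0 < m" "\<And>j. m \<le> x j - x (j - 1)" "\<And>j. x j - x (j - 1) \<le> M"
    using admissible_gaps[OF x] by metis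
  have gap: "real n * m \<le> x j - x (j - int n) \<and> x j - x (j - int n) \<le> real n * M" for n j
  proof (induction n)
    case (Suc n)
    have "j - int n - 1 = j - int (Suc n)" by simp
    then have "m \<le> x (j - int n) - x (j - int (Suc n))" "x (j - int n) - x (j - int (Suc n)) \<le> M"
      using m(2,3)[of "j - int n"] by metis+
    then show ?case using Suc by (simp add: algebra_simps)
  qed simp
  have L: "0 \<le> L" using y[of 0] by linarith
  \<comment> \<open>\<open>q\<close> consecutive gaps add up to at least \<open>L + 1\<close>, which survives moving both ends by at most \<open>L\<close>.\<close>
  obtain q :: nat where q: "(L + 1) / m \<le> real q" using real_arch_simple by blast
  then have qm: "L + 1 \<le> real q * m" using m(1) by (simp add: field_simps)
  then have q0: "0 < q" using L by (cases q) auto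
  define B where "B l = range (\<lambda>i. int q * i + int l)" for l
  have sumB: "(\<lambda>j. \<bar>f (y j)\<bar> powr p) summable_on B l" for l
  proof -
    define z where "z i = y (int q * i + int l)" for i
    have z: "1 \<le> z i - z (i - 1)" "z i - z (i - 1) \<le> real q * M + L" for i
    proof -
      let ?j = "int q * i + int l"
      have e: "int q * (i - 1) + int l = ?j - int q" by (simp add: algebra_simps)
      show "1 \<le> z i - z (i - 1)" "z i - z (i - 1) \<le> real q * M + L"
        unfolding z_def e using gap[where n = q and j = ?j] qm y[of ?j] y[of "?j - int q"] by linarith+
    qed
    have "admissible z"
      by (rule admissibleI[where m = 1 and M = "real q * M + L"]) (simp_all add: z)
    then have "(\<lambda>i. \<bar>f (z i)\<bar> powr p * (z i - z (i - 1))) summable_on UNIV"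
      using f by (simp add: Lambda_space_def)
    then have "(\<lambda>i. \<bar>f (z i)\<bar> powr p) summable_on UNIV"
    proof (rule summable_on_comparison_test)
      show "\<bar>f (z i)\<bar> powr p \<le> \<bar>f (z i)\<bar> powr p * (z i - z (i - 1))" for i
        using mult_left_mono[OF z(1), of "\<bar>f (z i)\<bar> powr p"] by simp
    qed simp
    moreover have "inj (\<lambda>i. int q * i + int l)" using q0 by (auto simp: inj_def)
    ultimately show ?thesis unfolding B_def by (subst summable_on_reindex) (auto simp: comp_def z_def)
  qed
  have "(\<lambda>j. \<bar>f (y j)\<bar> powr p) summable_on (\<Union>l\<in>{..<q}. B l)"
  proof (rule summable_on_finite_union_disjoint)
    show "B l \<inter> B l' = {}" if "l \<in> {..<q}" "l' \<in> {..<q}" "l \<noteq> l'" for l l'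
    proof -
      have "j mod int q = int k" if "j \<in> B k" "k < q" for j k using that by (auto simp: B_def)
      then show ?thesis using that by (metis disjoint_iff lessThan_iff of_nat_eq_iff)
    qed
  qed (use sumB in auto)
  moreover have "(\<Union>l\<in>{..<q}. B l) = UNIV"
  proof (intro equalityI subsetI UNIV_I)
    fix j :: int
    have "j = int q * (j div int q) + int (nat (j mod int q))" using q0 by simp
    then have "j \<in> B (nat (j mod int q))" unfolding B_def by blast
    moreover have "nat (j mod int q) < q" using q0 by (simp add: nat_less_iff)
    ultimately show "j \<in> (\<Union>l\<in>{..<q}. B l)" by blast
  qed
  ultimately show ?thesis by simp
qed

text \<open>
  The supremum over an interval need not be attained; half of it is.
\<close>

lemma near_maximum:
  assumes f: "f \<in> bounded_measurable" and L: "0 \<le> L"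
  obtains y where "x \<le> y" "y \<le> x + L" "\<And>t. t \<in> {x..x + L} \<Longrightarrow> \<bar>f t\<bar> \<le> 2 * \<bar>f y\<bar>"
proof -
  obtain M where M: "\<And>t. \<bar>f t\<bar> \<le> M" using f by (metis bounded_measurable_bound)
  define S where "S = (SUP t\<in>{x..x + L}. \<bar>f t\<bar>)"
  have S: "\<bar>f t\<bar> \<le> S" if "t \<in> {x..x + L}" for t
    unfolding S_def using that M by (intro cSUP_upper bdd_aboveI2[where M = M]) auto
  show thesis
  proof (cases "S \<le> 0")
    case True
    then show ?thesis using S L by (intro that[of x]) force+
  next
    case False
    then have "S / 2 < (SUP t\<in>{x..x + L}. \<bar>f t\<bar>)" by (simp add: S_def)
    then obtain y where y: "y \<in> {x..x + L}" "S / 2 < \<bar>f y\<bar>"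
      using L M by (subst (asm) less_cSUP_iff) (auto intro: bdd_aboveI2[where M = M])
    show ?thesis
    proof (rule that[of y])
      show "\<bar>f t\<bar> \<le> 2 * \<bar>f y\<bar>" if "t \<in> {x..x + L}" for t using S[OF that] y(2) by linarith
    qed (use y in auto)
  qed
qed

lemma Lambda_space_bounded_measurable: "f \<in> Lambda_space p \<Longrightarrow> f \<in> bounded_measurable"
  by (simp add: Lambda_space_def)

text \<open>
  The hypothesis says that \<open>\<bar>g x\<bar>\<close> is at most the supremum of \<open>\<bar>f\<bar>\<close> over \<open>[x, x + L]\<close>, so the values of \<open>g\<close> at
  admissible nodes are bounded by values of \<open>f\<close> at points near the nodes.
\<close>

lemma Lambda_space_dominated:
  assumes f: "f \<in> Lambda_space p" and g: "g \<in> bounded_measurable" and p: "0 < p" and L: "0 \<le> L"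
    and dom: "\<And>x M. (\<And>t. t \<in> {x..x + L} \<Longrightarrow> \<bar>f t\<bar> \<le> M) \<Longrightarrow> \<bar>g x\<bar> \<le> M"
  shows "g \<in> Lambda_space p"
  unfolding Lambda_space_def
proof (intro CollectI conjI allI impI g)
  fix x assume x: "admissible x"
  obtain m M where m: "0 < m" "\<And>j. m \<le> x j - x (j - 1)" "\<And>j. x j - x (j - 1) \<le> M"
    using admissible_gaps[OF x] by metis
  have "\<exists>y. x j \<le> y \<and> y \<le> x j + L \<and> (\<forall>t\<in>{x j..x j + L}. \<bar>f t\<bar> \<le> 2 * \<bar>f y\<bar>)" for j
    by (rule near_maximum[OF Lambda_space_bounded_measurable[OF f] L, of "x j"]) blast
  then obtain y where y: "\<And>j. x j \<le> y j" "\<And>j. y j \<le> x j + L"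
    "\<And>j t. t \<in> {x j..x j + L} \<Longrightarrow> \<bar>f t\<bar> \<le> 2 * \<bar>f (y j)\<bar>"
    by metis
  have gy: "\<bar>g (x j)\<bar> \<le> 2 * \<bar>f (y j)\<bar>" for j by (rule dom) (rule y(3))
  have "(\<lambda>j. 2 powr p * M * \<bar>f (y j)\<bar> powr p) summable_on UNIV"
    by (intro summable_on_cmult_right summable_near_nodes[OF f x y(1,2)])
  then show "(\<lambda>j. \<bar>g (x j)\<bar> powr p * (x j - x (j - 1))) summable_on UNIV"
  proof (rule summable_on_comparison_test)
    fix j
    have "\<bar>g (x j)\<bar> powr p \<le> (2 * \<bar>f (y j)\<bar>) powr p"
      using gy p by (intro powr_mono2) auto
    also have "\<dots> = 2 powr p * \<bar>f (y j)\<bar> powr p" by (simp add: powr_mult)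
    finally have "\<bar>g (x j)\<bar> powr p * (x j - x (j - 1)) \<le> (2 powr p * \<bar>f (y j)\<bar> powr p) * M"
      using m(1) m(2)[of j] m(3)[of j] by (intro mult_mono) auto
    then show "\<bar>g (x j)\<bar> powr p * (x j - x (j - 1)) \<le> 2 powr p * M * \<bar>f (y j)\<bar> powr p" by (simp add: mult_ac)
    show "0 \<le> \<bar>g (x j)\<bar> powr p * (x j - x (j - 1))" using m(1) m(2)[of j] by simp
  qed
qed

lemma Lambda_space_avg:
  assumes "f \<in> Lambda_space p" "0 < p" "0 < \<delta>"
  shows "avg \<delta> f \<in> Lambda_space p"
proof (rule Lambda_space_dominated[OF assms(1) _ assms(2)])
  have f: "f \<in> bounded_measurable" using assms(1) by (rule Lambda_space_bounded_measurable)
  show "avg \<delta> f \<in> bounded_measurable" by (rule bounded_measurable_avg[OF f assms(3)])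
  show "\<bar>avg \<delta> f x\<bar> \<le> M" if "\<And>t. t \<in> {x..x + \<delta>} \<Longrightarrow> \<bar>f t\<bar> \<le> M" for x M
    by (rule avg_bound[OF f that assms(3)])
qed (use assms in simp)

lemma Lambda_space_avg_iterate:
  "f \<in> Lambda_space p \<Longrightarrow> 0 < p \<Longrightarrow> 0 < \<delta> \<Longrightarrow> (avg \<delta> ^^ n) f \<in> Lambda_space p"
  by (induction n) (auto intro: Lambda_space_avg)

lemma Lambda_space_add:
  assumes f: "f \<in> Lambda_space p" and g: "g \<in> Lambda_space p" and p: "0 < p"
  shows "(\<lambda>x. f x + g x) \<in> Lambda_space p"
  unfolding Lambda_space_def
proof (intro CollectI conjI allI impI bounded_measurable_add Lambda_space_bounded_measurable[OF f] Lambda_space_bounded_measurable[OF g])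
  fix x assume x: "admissible x"
  obtain m M where m: "0 < m" "\<And>j. m \<le> x j - x (j - 1)" "\<And>j. x j - x (j - 1) \<le> M"
    using admissible_gaps[OF x] by metis
  have nn: "0 \<le> x j - x (j - 1)" for j using m(1) m(2)[of j] by simp
  have "(\<lambda>j. 2 powr p * (\<bar>f (x j)\<bar> powr p * (x j - x (j - 1)) + \<bar>g (x j)\<bar> powr p * (x j - x (j - 1)))) summable_on UNIV"
    using f g x by (intro summable_on_cmult_right summable_on_add) (auto simp: Lambda_space_def)
  then show "(\<lambda>j. \<bar>f (x j) + g (x j)\<bar> powr p * (x j - x (j - 1))) summable_on UNIV"
  proof (rule summable_on_comparison_test)
    fix j
    have "\<bar>f (x j) + g (x j)\<bar> powr p \<le> (2 * max \<bar>f (x j)\<bar> \<bar>g (x j)\<bar>) powr p"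
      using p by (intro powr_mono2) auto
    also have "\<dots> = 2 powr p * max \<bar>f (x j)\<bar> \<bar>g (x j)\<bar> powr p" by (simp add: powr_mult)
    also have "\<dots> \<le> 2 powr p * (\<bar>f (x j)\<bar> powr p + \<bar>g (x j)\<bar> powr p)"
      by (intro mult_left_mono) (auto simp: max_def)
    finally have "\<bar>f (x j) + g (x j)\<bar> powr p * (x j - x (j - 1))
        \<le> 2 powr p * (\<bar>f (x j)\<bar> powr p + \<bar>g (x j)\<bar> powr p) * (x j - x (j - 1))"
      by (rule mult_right_mono[OF _ nn])
    then show "\<bar>f (x j) + g (x j)\<bar> powr p * (x j - x (j - 1))
        \<le> 2 powr p * (\<bar>f (x j)\<bar> powr p * (x j - x (j - 1)) + \<bar>g (x j)\<bar> powr p * (x j - x (j - 1)))"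
      by (simp only: mult.assoc distrib_right)
    show "0 \<le> \<bar>f (x j) + g (x j)\<bar> powr p * (x j - x (j - 1))" using nn by simp
  qed
qed

lemma Lambda_space_cmult:
  assumes f: "f \<in> Lambda_space p"
  shows "(\<lambda>x. c * f x) \<in> Lambda_space p"
  unfolding Lambda_space_def
proof (intro CollectI conjI allI impI bounded_measurable_cmult Lambda_space_bounded_measurable[OF f])
  fix x assume "admissible x"
  then have "(\<lambda>j. \<bar>c\<bar> powr p * (\<bar>f (x j)\<bar> powr p * (x j - x (j - 1)))) summable_on UNIV"
    using f by (intro summable_on_cmult_right) (auto simp: Lambda_space_def)
  then show "(\<lambda>j. \<bar>c * f (x j)\<bar> powr p * (x j - x (j - 1))) summable_on UNIV"
    by (simp add: abs_mult powr_mult mult.assoc)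
qed

lemma Lambda_space_diff:
  "f \<in> Lambda_space p \<Longrightarrow> g \<in> Lambda_space p \<Longrightarrow> 0 < p \<Longrightarrow> (\<lambda>x. f x - g x) \<in> Lambda_space p"
  using Lambda_space_add[of f p "\<lambda>x. -1 * g x"] Lambda_space_cmult[of g p "-1"] by simp

lemma Lambda_space_zero: "(\<lambda>x. 0) \<in> Lambda_space p"
  by (simp add: Lambda_space_def bounded_measurable_const)

lemma Lambda_space_sum:
  assumes "\<And>i. i \<in> I \<Longrightarrow> f i \<in> Lambda_space p" "0 < p"
  shows "(\<lambda>x. \<Sum>i\<in>I. f i x) \<in> Lambda_space p"
  using assms(1) by (induction I rule: infinite_finite_induct)
    (auto intro: Lambda_space_zero Lambda_space_add assms(2))

lemma Lambda_space_steklov: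
  assumes f: "f \<in> Lambda_space p" and p: "0 < p" and \<delta>: "0 < \<delta>"
  shows "steklov \<delta> r f \<in> Lambda_space p"
proof -
  have "steklov \<delta> r f = (\<lambda>x. \<Sum>m=1..r. steklov_coeff r m * (avg (real m / real r * \<delta>) ^^ r) f x)"
    using steklov_eq_sum[OF \<delta> Lambda_space_bounded_measurable[OF f]] by blast
  moreover have "\<dots> \<in> Lambda_space p"
    using \<delta> by (intro Lambda_space_sum Lambda_space_cmult Lambda_space_avg_iterate f p) auto
  ultimately show ?thesis by simp
qed

text \<open>
  On \<open>[j, j + 1]\<close> the function is dominated by twice its value at a near-maximal point, and these values
  are \<open>p\<close>-summable since the points are near the admissible sequence of the integers.
\<close>

lemma Lambda_space_subset_Lp:
  assumes f: "f \<in> Lambda_space p" and p: "0 < p"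
  shows "f \<in> Lp_space p"
proof -
  have bm: "f \<in> bounded_measurable" using f by (rule Lambda_space_bounded_measurable)
  then have meas: "f \<in> borel_measurable lebesgue" by (simp add: bounded_measurable_iff)
  have "\<exists>y. of_int j \<le> y \<and> y \<le> of_int j + 1 \<and> (\<forall>t\<in>{of_int j..of_int j + 1}. \<bar>f t\<bar> \<le> 2 * \<bar>f y\<bar>)" for j :: int
    by (rule near_maximum[OF bm zero_le_one, of "of_int j"]) blast
  then obtain y where y: "\<And>j :: int. of_int j \<le> y j" "\<And>j. y j \<le> of_int j + 1"
    "\<And>j t. t \<in> {of_int j..of_int j + 1} \<Longrightarrow> \<bar>f t\<bar> \<le> 2 * \<bar>f (y j)\<bar>"
    by metis
  have "admissible (of_int :: int \<Rightarrow> real)" by (rule admissibleI[of 1 _ 1]) auto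
  then have "(\<lambda>j. \<bar>f (y j)\<bar> powr p) summable_on UNIV"
    by (rule summable_near_nodes[OF f _ y(1,2)])
  then have "(\<lambda>j. 2 powr p * \<bar>f (y j)\<bar> powr p) summable_on UNIV" by (rule summable_on_cmult_right)
  then have "((\<lambda>j. 2 powr p * \<bar>f (y j)\<bar> powr p) \<circ> int_decode) summable_on UNIV"
    using summable_on_reindex[OF inj_int_decode[of UNIV], of "\<lambda>j. 2 powr p * \<bar>f (y j)\<bar> powr p"]
      surj_int_decode by simp
  then have sm: "summable (\<lambda>n. 2 powr p * \<bar>f (y (int_decode n))\<bar> powr p)"
    by (auto dest: summable_on_imp_summable simp: comp_def)
  define B where "B n = {real_of_int (int_decode n)..<real_of_int (int_decode n) + 1}" for n
  have Bm: "B n \<in> sets lebesgue" for n by (simp add: B_def)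
  have BU: "(\<Union>n. B n) = UNIV"
  proof (intro equalityI subsetI UNIV_I)
    fix x :: real
    have "x \<in> B (int_encode \<lfloor>x\<rfloor>)" by (simp add: B_def)
    then show "x \<in> (\<Union>n. B n)" by blast
  qed
  have "disjoint_family B"
    unfolding disjoint_family_on_def
  proof (intro ballI impI)
    fix a b :: nat assume "a \<noteq> b"
    then have "int_decode a \<noteq> int_decode b" by (simp add: int_decode_eq)
    then have "int_decode a + 1 \<le> int_decode b \<or> int_decode b + 1 \<le> int_decode a" by linarith
    then have "real_of_int (int_decode a) + 1 \<le> real_of_int (int_decode b)
        \<or> real_of_int (int_decode b) + 1 \<le> real_of_int (int_decode a)" by linarith
    then show "B a \<inter> B b = {}" by (auto simp: B_def)
  qed
  then have "(\<integral>\<^sup>+x\<in>(\<Union>n. B n). ennreal (\<bar>f x\<bar> powr p) \<partial>lebesgue)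
      = (\<Sum>n. \<integral>\<^sup>+x\<in>B n. ennreal (\<bar>f x\<bar> powr p) \<partial>lebesgue)"
    using meas Bm by (intro nn_integral_disjoint_family) auto
  also have "\<dots> \<le> (\<Sum>n. ennreal (2 powr p * \<bar>f (y (int_decode n))\<bar> powr p))"
  proof (intro suminf_le)
    fix n
    have "(\<integral>\<^sup>+x\<in>B n. ennreal (\<bar>f x\<bar> powr p) \<partial>lebesgue)
        \<le> (\<integral>\<^sup>+x. ennreal (2 powr p * \<bar>f (y (int_decode n))\<bar> powr p) * indicator (B n) x \<partial>lebesgue)"
    proof (intro nn_integral_mono)
      fix x
      show "ennreal (\<bar>f x\<bar> powr p) * indicator (B n) x
          \<le> ennreal (2 powr p * \<bar>f (y (int_decode n))\<bar> powr p) * indicator (B n) x"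
      proof (cases "x \<in> B n")
        case True
        then have "\<bar>f x\<bar> powr p \<le> (2 * \<bar>f (y (int_decode n))\<bar>) powr p"
          using y(3)[of x "int_decode n"] p by (intro powr_mono2) (auto simp: B_def)
        then show ?thesis using True by (simp add: powr_mult ennreal_leI)
      qed simp
    qed
    also have "\<dots> = ennreal (2 powr p * \<bar>f (y (int_decode n))\<bar> powr p)"
      by (subst nn_integral_cmult_indicator) (auto simp: B_def)
    finally show "(\<integral>\<^sup>+x\<in>B n. ennreal (\<bar>f x\<bar> powr p) \<partial>lebesgue)
        \<le> ennreal (2 powr p * \<bar>f (y (int_decode n))\<bar> powr p)" .
  qed auto
  also have "\<dots> < \<infinity>"
    unfolding infinity_ennreal_def less_top[symmetric] by (rule ennreal_suminf_neq_top[OF sm]) simp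
  finally have "(\<integral>\<^sup>+x. ennreal (\<bar>f x\<bar> powr p) \<partial>lebesgue) < \<infinity>" by (simp add: BU)
  moreover have "(\<lambda>x. \<bar>f x\<bar> powr p) \<in> borel_measurable lebesgue" using meas by measurable
  ultimately have "integrable lebesgue (\<lambda>x. \<bar>f x\<bar> powr p)"
    by (intro integrableI_bounded) auto
  then show ?thesis using meas by (simp add: Lp_space_def)
qed

section \<open>The equivalence\<close>

lemma sampling_operator_diff:
  assumes G: "sampling_operator_on S x \<phi> G"
    and S: "f \<in> S" "g \<in> S" "(\<lambda>t. f t - g t) \<in> S"
  shows "G (\<lambda>t. f t - g t) = (\<lambda>t. G f t - G g t)"
proof
  fix t
  have "(\<lambda>n. (\<Sum>k=-int n..int n. f (x k) * \<phi> k t) - (\<Sum>k=-int n..int n. g (x k) * \<phi> k t)) \<longlonglongrightarrow> G f t - G g t"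
    using G S by (intro tendsto_diff) (auto simp: sampling_operator_on_def)
  moreover have "(\<lambda>n. \<Sum>k=-int n..int n. (f (x k) - g (x k)) * \<phi> k t) \<longlonglongrightarrow> G (\<lambda>t. f t - g t) t"
    using bspec[OF G[unfolded sampling_operator_on_def] S(3)] by (rule spec)
  ultimately show "G (\<lambda>t. f t - g t) t = G f t - G g t"
    by (intro LIMSEQ_unique) (simp_all add: left_diff_distrib sum_subtractf)
qed

theorem theorem4p5:
  fixes r s :: nat and p :: real
    and x :: "real \<Rightarrow> int \<Rightarrow> real"
    and \<phi> :: "real \<Rightarrow> int \<Rightarrow> real \<Rightarrow> real"
    and G :: "real \<Rightarrow> (real \<Rightarrow> real) \<Rightarrow> real \<Rightarrow> real"
    and K\<^sub>1 K\<^sub>2 K\<^sub>3 K\<^sub>5 :: real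
  assumes "1 \<le> s" and "s \<le> r" and "1 \<le> p"
    and "\<And>W. 0 < W \<Longrightarrow> sampling_operator_on (Lambda_space p) (x W) (\<phi> W) (G W)"
    and "\<And>W f. 0 < W \<Longrightarrow> f \<in> Lambda_space p \<Longrightarrow> G W f \<in> sobolev s p"
    and "0 < K\<^sub>1" and "0 < K\<^sub>2" and "0 < K\<^sub>3" and "0 < K\<^sub>5"
    and "\<And>W f. 0 < W \<Longrightarrow> f \<in> Lambda_space p \<Longrightarrow>
           K\<^sub>2 * lp_norm p (uniform_nodes W) f \<le> Lp_norm p (G W f)"
    and "\<And>W f. 0 < W \<Longrightarrow> f \<in> Lambda_space p \<Longrightarrow>
           Lp_norm p (G W f) \<le> K\<^sub>1 * lp_norm p (uniform_nodes W) f"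
    and "\<And>W f. 0 < W \<Longrightarrow> f \<in> sobolev s p \<Longrightarrow>
           Lp_norm p (\<lambda>t. f t - G W f t) \<le> K\<^sub>3 * W powr (- real s) * Lp_norm p ((deriv ^^ s) f)"
    and "\<And>W f. 0 < W \<Longrightarrow> f \<in> Lambda_space p \<Longrightarrow>
           W powr (- real s) * Lp_norm p ((deriv ^^ s) (G W f)) \<le> K\<^sub>5 * modulus s p (G W f) (1 / W)"
  shows "\<exists>c>0. \<exists>C>0. \<forall>f\<in>Lambda_space p. \<forall>W>0.
           c * (Lp_norm p (\<lambda>t. f t - G W f t) + W powr (- real s) * Lp_norm p ((deriv ^^ s) (G W f)))
             \<le> semidiscrete_modulus r s p f (1 / W) (uniform_nodes W)
         \<and> semidiscrete_modulus r s p f (1 / W) (uniform_nodes W)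
             \<le> C * (Lp_norm p (\<lambda>t. f t - G W f t) + W powr (- real s) * Lp_norm p ((deriv ^^ s) (G W f)))"
proof -
  note s = assms(1,2) and p = assms(3) and samp = assms(4) and sob = assms(5) and K = assms(6-9)
    and lower = assms(10) and upper = assms(11) and direct = assms(12) and inverse = assms(13)
  have p0: "0 < p" using p by simp
  define A where "A = (\<Sum>m=1..r. \<bar>steklov_coeff r m\<bar> * (real r / real m) ^ s)"
  define E where "E = 2 ^ (r - s) + K\<^sub>3 * A"
  define D where "D = E + K\<^sub>1"
  have A0: "0 \<le> A" by (simp add: A_def sum_nonneg)
  have E0: "0 < E" using A0 K(3) by (simp add: E_def add_pos_nonneg)
  have D0: "0 < D" using E0 K(1) by (simp add: D_def)
  have main: "Lp_norm p (\<lambda>t. f t - G W f t) + W powr (- real s) * Lp_norm p ((deriv ^^ s) (G W f))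
        \<le> (D + K\<^sub>5 * (1 + 2 ^ s * D)) * semidiscrete_modulus r s p f (1 / W) (uniform_nodes W)"
    "semidiscrete_modulus r s p f (1 / W) (uniform_nodes W)
        \<le> ((E * 2 ^ s + 1) / K\<^sub>2 + 2 ^ s)
          * (Lp_norm p (\<lambda>t. f t - G W f t) + W powr (- real s) * Lp_norm p ((deriv ^^ s) (G W f)))"
    if f: "f \<in> Lambda_space p" and W: "0 < W" for f W
  proof -
    define \<delta> where "\<delta> = 1 / W"
    have \<delta>: "0 < \<delta>" using W by (simp add: \<delta>_def)
    define g where "g = steklov \<delta> r f"
    define \<omega> where "\<omega> = modulus s p f \<delta>"
    define l where "l = lp_norm p (uniform_nodes W) (\<lambda>t. g t - f t)"
    define e where "e = Lp_norm p (\<lambda>t. f t - G W f t)"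
    define d where "d = W powr (- real s) * Lp_norm p ((deriv ^^ s) (G W f))"
    have fbm: "f \<in> bounded_measurable" and fLp: "f \<in> Lp_space p"
      using Lambda_space_bounded_measurable[OF f] Lambda_space_subset_Lp[OF f p0] by auto
    have gL: "g \<in> Lambda_space p" unfolding g_def by (rule Lambda_space_steklov[OF f p0 \<delta>])
    have gs: "g \<in> sobolev s p" unfolding g_def by (rule steklov_sobolev(1)[OF fbm fLp p \<delta> s])
    have gf: "(\<lambda>t. g t - f t) \<in> Lambda_space p" by (rule Lambda_space_diff[OF gL f p0])
    have sobLp: "u \<in> Lp_space p" if "u \<in> sobolev s p" for u using that by (simp add: sobolev_def)
    have Gf: "G W f \<in> Lp_space p" and Gg: "G W g \<in> Lp_space p" and gLp: "g \<in> Lp_space p"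
      using sob[OF W f] sob[OF W gL] gs sobLp by auto
    have Gdiff: "G W (\<lambda>t. g t - f t) = (\<lambda>t. G W g t - G W f t)"
      by (rule sampling_operator_diff[OF samp[OF W] gL f gf])
    have \<omega>0: "0 \<le> \<omega>" unfolding \<omega>_def by (rule modulus_nonneg[OF fLp p \<delta>])
    have l0: "0 \<le> l" by (simp add: l_def lp_norm_def)
    have e0: "0 \<le> e" by (simp add: e_def Lp_norm_nonneg)
    have d0: "0 \<le> d" by (simp add: d_def Lp_norm_nonneg)
    have gfB: "(\<lambda>t. g t - f t) \<in> Lp_ball p (2 ^ (r - s) * \<omega>)"
      unfolding g_def \<omega>_def using s
      by (intro Lp_ball_mono[OF Lp_ball_steklov_minus[OF fbm fLp p \<delta>] modulus_le_lower_order[OF fLp p \<delta>]]) auto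
    have gGB: "(\<lambda>t. g t - G W g t) \<in> Lp_ball p (K\<^sub>3 * A * \<omega>)"
    proof -
      have "Lp_norm p (\<lambda>t. g t - G W g t) \<le> K\<^sub>3 * W powr (- real s) * Lp_norm p ((deriv ^^ s) g)"
        by (rule direct[OF W gs])
      also have "\<dots> \<le> K\<^sub>3 * W powr (- real s) * (A * \<delta> powr (- real s) * \<omega>)"
        unfolding g_def A_def \<omega>_def using K(3)
        by (intro mult_left_mono steklov_sobolev(2)[OF fbm fLp p \<delta> s]) auto
      also have "\<dots> = K\<^sub>3 * A * \<omega> * (W powr (- real s) * \<delta> powr (- real s))" by (simp add: mult_ac)
      also have "W powr (- real s) * \<delta> powr (- real s) = 1"
        using W by (simp add: \<delta>_def powr_minus powr_divide)
      finally have "Lp_norm p (\<lambda>t. g t - G W g t) \<le> K\<^sub>3 * A * \<omega>" by simp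
      moreover have "(\<lambda>t. g t - G W g t) \<in> Lp_space p"
        using Lp_ballD(1)[OF Lp_ball_diff[OF Lp_ball_norm[OF gLp] Lp_ball_norm[OF Gg] p]] .
      ultimately show ?thesis by (simp add: Lp_ball_def)
    qed
    have eB: "(\<lambda>t. f t - G W f t) \<in> Lp_ball p e"
      unfolding e_def using Lp_ballD(1)[OF Lp_ball_diff[OF Lp_ball_norm[OF fLp] Lp_ball_norm[OF Gf] p]]
      by (rule Lp_ball_norm)
    have GB: "(\<lambda>t. G W g t - G W f t) \<in> Lp_ball p (K\<^sub>1 * l)"
      using upper[OF W gf] Lp_ballD(1)[OF Lp_ball_diff[OF Lp_ball_norm[OF Gg] Lp_ball_norm[OF Gf] p]]
      by (simp add: Gdiff Lp_ball_def l_def)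
    have e_le: "e \<le> D * (l + \<omega>)"
    proof -
      \<comment> \<open>\<open>f - G f = (g - G g) + G (g - f) - (g - f)\<close>\<close>
      from Lp_ball_diff[OF Lp_ball_add[OF gGB GB p] gfB p]
      have "e \<le> K\<^sub>3 * A * \<omega> + K\<^sub>1 * l + 2 ^ (r - s) * \<omega>"
        unfolding e_def using Lp_ballD(2) by fastforce
      also have "\<dots> = E * \<omega> + K\<^sub>1 * l" by (simp add: E_def algebra_simps)
      also have "\<dots> \<le> D * \<omega> + D * l"
        using E0 K(1) \<omega>0 l0 by (intro add_mono mult_right_mono) (auto simp: D_def)
      finally show ?thesis by (simp add: algebra_simps)
    qed
    have d_le: "d \<le> K\<^sub>5 * (\<omega> + 2 ^ s * e)"
    proof -
      have "modulus s p (G W f) \<delta> \<le> \<omega> + 2 ^ s * Lp_norm p (\<lambda>t. G W f t - f t)"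
        unfolding \<omega>_def by (rule modulus_perturbation[OF Gf fLp p \<delta>])
      also have "Lp_norm p (\<lambda>t. G W f t - f t) = e"
        by (simp add: e_def Lp_norm_def abs_minus_commute)
      finally have "K\<^sub>5 * modulus s p (G W f) \<delta> \<le> K\<^sub>5 * (\<omega> + 2 ^ s * e)"
        using K(4) by (intro mult_left_mono) auto
      then show ?thesis using inverse[OF W f] unfolding d_def \<delta>_def by linarith
    qed
    have \<omega>_le: "\<omega> \<le> 2 ^ s * (e + d)"
    proof -
      have "\<omega> \<le> modulus s p (G W f) \<delta> + 2 ^ s * e"
        unfolding \<omega>_def e_def by (rule modulus_perturbation[OF fLp Gf p \<delta>])
      moreover have "modulus s p (G W f) \<delta> \<le> \<delta> ^ s * Lp_norm p ((deriv ^^ s) (G W f))"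
        by (rule modulus_le_sobolev[OF sob[OF W f] p \<delta> s(1)])
      moreover have "\<delta> ^ s = W powr (- real s)"
        using W by (simp add: \<delta>_def powr_minus powr_realpow divide_inverse power_inverse)
      ultimately have "\<omega> \<le> 1 * d + 2 ^ s * e" by (simp add: d_def)
      also have "\<dots> \<le> 2 ^ s * d + 2 ^ s * e" using d0 e0 by (intro add_mono mult_right_mono) auto
      finally show ?thesis by (simp add: algebra_simps)
    qed
    have l_le: "K\<^sub>2 * l \<le> E * \<omega> + e"
    proof -
      \<comment> \<open>\<open>G (g - f) = (g - f) - (g - G g) + (f - G f)\<close>\<close>
      from Lp_ball_add[OF Lp_ball_diff[OF gfB gGB p] eB p]
      have "Lp_norm p (\<lambda>t. G W g t - G W f t) \<le> 2 ^ (r - s) * \<omega> + K\<^sub>3 * A * \<omega> + e"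
        using Lp_ballD(2) by fastforce
      then show ?thesis using lower[OF W gf] by (simp add: Gdiff l_def E_def algebra_simps)
    qed
    have sm: "semidiscrete_modulus r s p f (1 / W) (uniform_nodes W) = l + \<omega>"
      by (simp add: semidiscrete_modulus_def l_def \<omega>_def g_def \<delta>_def)
    have "d \<le> K\<^sub>5 * ((l + \<omega>) + 2 ^ s * (D * (l + \<omega>)))"
    proof -
      have "\<omega> + 2 ^ s * e \<le> (l + \<omega>) + 2 ^ s * (D * (l + \<omega>))"
        using e_le l0 by (intro add_mono mult_left_mono) auto
      then have "K\<^sub>5 * (\<omega> + 2 ^ s * e) \<le> K\<^sub>5 * ((l + \<omega>) + 2 ^ s * (D * (l + \<omega>)))"
        using K(4) by (intro mult_left_mono) auto
      then show ?thesis using d_le by linarith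
    qed
    then show "Lp_norm p (\<lambda>t. f t - G W f t) + W powr (- real s) * Lp_norm p ((deriv ^^ s) (G W f))
        \<le> (D + K\<^sub>5 * (1 + 2 ^ s * D)) * semidiscrete_modulus r s p f (1 / W) (uniform_nodes W)"
      using e_le unfolding sm e_def[symmetric] d_def[symmetric] by (simp add: algebra_simps)
    have "K\<^sub>2 * l \<le> E * (2 ^ s * (e + d)) + (e + d)"
      using l_le mult_left_mono[OF \<omega>_le less_imp_le[OF E0]] d0 by linarith
    then have "l \<le> (E * 2 ^ s + 1) / K\<^sub>2 * (e + d)" using K(2) by (simp add: field_simps)
    then show "semidiscrete_modulus r s p f (1 / W) (uniform_nodes W)
        \<le> ((E * 2 ^ s + 1) / K\<^sub>2 + 2 ^ s)
          * (Lp_norm p (\<lambda>t. f t - G W f t) + W powr (- real s) * Lp_norm p ((deriv ^^ s) (G W f)))"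
      using \<omega>_le unfolding sm e_def[symmetric] d_def[symmetric] by (simp only: distrib_right)
  qed
  define C1 where "C1 = D + K\<^sub>5 * (1 + 2 ^ s * D)"
  define C2 where "C2 = (E * 2 ^ s + 1) / K\<^sub>2 + 2 ^ s"
  have C1: "0 < C1" using D0 K(4) by (simp add: C1_def add_pos_pos)
  have C2: "0 < C2" using E0 K(2) by (simp add: C2_def add_pos_pos)
  show ?thesis
  proof (intro exI conjI ballI allI impI)
    show "0 < 1 / C1" using C1 by simp
    show "0 < C2" by (rule C2)
    fix f W assume f: "f \<in> Lambda_space p" and W: "0 < (W::real)"
    show "1 / C1 * (Lp_norm p (\<lambda>t. f t - G W f t) + W powr (- real s) * Lp_norm p ((deriv ^^ s) (G W f)))
        \<le> semidiscrete_modulus r s p f (1 / W) (uniform_nodes W)"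
      using main(1)[OF f W] C1 unfolding C1_def[symmetric] by (simp add: field_simps)
    show "semidiscrete_modulus r s p f (1 / W) (uniform_nodes W)
        \<le> C2 * (Lp_norm p (\<lambda>t. f t - G W f t) + W powr (- real s) * Lp_norm p ((deriv ^^ s) (G W f)))"
      using main(2)[OF f W] unfolding C2_def .
  qed
qed

end
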